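(* The Riemann hypothesis holds if and only if the function $$\Lambda(x) = \frac{1}{2\pi}\int_{-\infty}^{\infty} \frac{1}{\xi(\tfrac12+\tau)}\, e^{-ix\tau}\, d\tau, \qquad x\in\mathbb{R},$$ is a Polya frequency function.
   Context: A measurable function $\Lambda:\mathbb{R}\to\mathbb{R}$ is called totally positive if for every $n\in\mathbb{N}$ and all real numbers $x_1<x_2<\dots<x_n$ and $y_1<y_2<\dots<y_n$ one has $\det\big(\Lambda(x_j-y_k)\big)_{j,k=1,\dots,n}\ge 0$. A totally positive function that is moreover integrable on $\mathbb{R}$ is called a Polya frequency function. Let $\zeta$ be the Riemann zeta function and $\xi(s)=\tfrac12 s(s-1)\pi^{-s/2}\Gamma(s/2)\zeta(s)$ the Riemann xi-function (an entire function; it is strictly positive on $\mathbb{R}$ and $1/\xi$ is integrable on $\mathbb{R}$, so the integral defining $\Lambda$ converges). The Riemann hypothesis is the assertion that all non-trivial zeros of $\zeta$ lie on the critical line $\{\tfrac12+it: t\in\mathbb{R}\}$. *)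

theory Defs
  imports "HOL-Complex_Analysis.Complex_Analysis" "Jordan_Normal_Form.Determinant"
begin

(* The analytic continuation of the Dirichlet series to the punctured plane; the
   condition f 1 = 0 only fixes a conventional value at the pole, so that the
   description is unique. *)
definition riemann_zeta :: "complex \<Rightarrow> complex" where
  "riemann_zeta = (THE f. f holomorphic_on - {1}
      \<and> (\<forall>s. Re s > 1 \<longrightarrow> (\<lambda>n. 1 / of_nat (Suc n) powr s) sums f s)
      \<and> f 1 = 0)"

(* Gamma and riemann_zeta have conventional values at their poles; remove_sings
   replaces the values of the product there by its limits. *)
definition riemann_xi :: "complex \<Rightarrow> complex" where
  "riemann_xi = remove_sings (\<lambda>s.
      1/2 * s * (s - 1) * of_real pi powr (- s / 2) * Gamma (s / 2) * riemann_zeta s)"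

(* s = 1 is the pole of zeta, where riemann_zeta has the conventional value 0. *)
definition riemann_hypothesis :: bool where
  "riemann_hypothesis \<longleftrightarrow>
     (\<forall>s. s \<noteq> 1 \<and> riemann_zeta s = 0 \<and> s \<notin> {- 2 * of_nat n |n. n \<ge> 1} \<longrightarrow> Re s = 1/2)"

definition totally_positive :: "(real \<Rightarrow> real) \<Rightarrow> bool" where
  "totally_positive L \<longleftrightarrow> L \<in> borel_measurable lebesgue \<and>
     (\<forall>(n::nat) (x::nat \<Rightarrow> real) (y::nat \<Rightarrow> real).
        strict_mono_on {..<n} x \<and> strict_mono_on {..<n} y \<longrightarrow>
        Determinant.det (Matrix.mat n n (\<lambda>(j, k). L (x j - y k))) \<ge> 0)"

definition polya_frequency_function :: "(real \<Rightarrow> real) \<Rightarrow> bool" where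
  "polya_frequency_function L \<longleftrightarrow> totally_positive L \<and> integrable lebesgue L"

definition xi_Lambda :: "real \<Rightarrow> complex" where
  "xi_Lambda x = 1 / (2 * of_real pi) *
     (\<integral>\<tau>. 1 / riemann_xi (1/2 + of_real \<tau>) * exp (- \<i> * of_real x * of_real \<tau>) \<partial>lborel)"

end

theory Submission imports Defs "HOL-Probability.Probability" "HOL-Real_Asymp.Real_Asymp" begin

text \<open>
  Write \<open>\<Xi>(z) = \<xi>(1/2 + z)\<close>. Jacobi's transformation of the theta function gives
  \<open>\<Xi>(z) = 1/2 + (z\<^sup>2 - 1/4) \<integral> K(u) exp(zu) du\<close> with an even nonnegative kernel \<open>K\<close> that decays
  faster than every Gaussian. Hence \<open>\<Xi>\<close> is an even entire function, positive on the real axis,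
  with real Taylor coefficients and \<open>log |\<Xi>(z)| = o(|z|\<^sup>2)\<close>, and the Riemann hypothesis says
  that its zeros are purely imaginary.

  If they are, then \<open>\<Xi>(z) = F(z\<^sup>2)\<close> with \<open>F\<close> a limit of finite products over its negative
  zeros, so \<open>1/\<Xi>\<close> is a dominated limit of products of factors \<open>1/(1 + \<tau>\<^sup>2/a\<^sup>2)\<close>. Up to a
  constant, \<open>\<Lambda>\<close> is then a limit of convolutions of the totally positive functions
  \<open>exp(-a|x|)\<close>, and Andreief's identity shows that convolution preserves total positivity.

  Conversely, a totally positive integrable \<open>\<Lambda>\<close> decays exponentially, and its moments are the
  Taylor coefficients of the reciprocal of \<open>\<Psi>(w) = \<Xi>(iw)\<close>. So convolution with \<open>\<Lambda>\<close> inverts the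
  differential operator \<open>\<Psi>(D)\<close> on polynomials. Convolution with \<open>\<Lambda>\<close> does not increase the number
  of sign changes, hence \<open>\<Psi>(D)\<close> maps polynomials with simple real zeros to real-rooted
  ones. By Hurwitz' theorem this passes to \<open>\<Psi>(D) x\<^sup>n\<close>, and then, after reversal and
  rescaling, to the limit \<open>\<Psi>\<close>.
\<close>

hide_const (open) Module.smult

section \<open>Power series of Laplace transforms and Fourier inversion\<close>

text \<open>Evenness of \<Xi> shapes the forward direction. In the variable
  \<open>w = z\<^sup>2\<close> the growth bound says that F grows more slowly than
  exp(\<epsilon>|w|) for every \<epsilon> > 0, which is why the products over the zeros in growing
  discs converge to F without exponential factors. A zero -a^2 of F contributes at w = \<tau>^2 the
  factor 1 + (\<tau>/a)^2, which is at least 1; keeping one fixed such factor in all products gives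
  the integrable majorant.

  In the converse the Laplace transform of \<Lambda> is known to converge only in a strip, while
  zeros of \<Psi> may lie outside it. The relation with 1/\<Psi> is therefore turned into an
  identity of formal power series, found near 0 and applied to polynomials, where each coefficient
  involves finitely many terms. Sign changes control the zeros only when these are separated, so x^n
  is approached by polynomials with zeros \<epsilon> j, j < n, before \<epsilon> tends to 0.\<close>

lemma integrable_mult_bounded:
  fixes f g :: "'a \<Rightarrow> 'b::{real_normed_field,banach,second_countable_topology}"
  assumes f: "integrable M f" and [measurable]: "g \<in> borel_measurable M" and B: "\<And>x. norm (g x) \<le> B"
  shows "integrable M (\<lambda>x. f x * g x)"
proof (rule Bochner_Integration.integrable_bound)
  show "integrable M (\<lambda>x. norm (f x) * B)" using f by simp
  show "AE x in M. norm (f x * g x) \<le> norm (norm (f x) * B)"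
  proof (rule AE_I2)
    fix x
    have "norm (f x * g x) \<le> norm (f x) * B" unfolding norm_mult by (intro mult_left_mono B) auto
    then show "norm (f x * g x) \<le> norm (norm (f x) * B)" by simp
  qed
qed (use borel_measurable_integrable[OF f] in measurable)

lemma power_div_fact_le_exp:
  fixes x :: real assumes "x \<ge> 0" shows "x ^ k / fact k \<le> exp x"
proof -
  have s: "(\<lambda>n. x ^ n / fact n) sums exp x"
    using exp_converges[of x] by (simp add: field_simps)
  have "sum (\<lambda>n. x ^ n / fact n) {k} \<le> (\<Sum>n. x ^ n / fact n)"
    by (rule sum_le_suminf) (use s assms in \<open>auto simp: sums_iff\<close>)
  then show ?thesis using s by (simp add: sums_iff)
qed

text \<open>Expanding exp(zu) and integrating term by term is legitimate because all partial sums of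
  the norms stay below the single integrable function |f u| exp(r|u|). Applied to the theta kernel,
  where r is arbitrary, and to \<Lambda>, where it gives a Taylor expansion in a small disc.\<close>

lemma laplace_power_series:
  fixes f :: "real \<Rightarrow> real" and z :: complex
  assumes [measurable]: "f \<in> borel_measurable borel"
    and int: "integrable lborel (\<lambda>u. f u * exp (r * \<bar>u\<bar>))" and z: "norm z \<le> r" and r: "r > 0"
  shows "integrable lborel (\<lambda>u. f u * u ^ k / fact k)"
    and "integrable lborel (\<lambda>u. of_real (f u) * exp (z * of_real u))"
    and "(\<lambda>k. of_real (LBINT u. f u * u ^ k / fact k) * z ^ k) sums
           (LBINT u. of_real (f u) * exp (z * of_real u))"
proof -
  define t where "t k u = of_real (f u * u ^ k / fact k) * z ^ k" for k u
  have bound: "norm (t k u) \<le> \<bar>f u\<bar> * ((r * \<bar>u\<bar>) ^ k / fact k)" for k u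
  proof -
    have "norm (t k u) = \<bar>f u\<bar> * ((norm z * \<bar>u\<bar>) ^ k / fact k)"
      by (simp add: t_def norm_mult norm_divide norm_power power_mult_distrib abs_mult power_abs)
    also have "\<dots> \<le> \<bar>f u\<bar> * ((r * \<bar>u\<bar>) ^ k / fact k)"
      by (intro mult_left_mono divide_right_mono power_mono mult_right_mono) (use z in auto)
    finally show ?thesis .
  qed
  have int': "integrable lborel (\<lambda>u. \<bar>f u\<bar> * exp (r * \<bar>u\<bar>))"
    using integrable_abs[OF int] by (simp add: abs_mult)
  show mom: "integrable lborel (\<lambda>u. f u * u ^ k / fact k)" for k
  proof (rule Bochner_Integration.integrable_bound[OF integrable_divide[OF int', of "r ^ k"]])
    show "AE u in lborel. norm (f u * u ^ k / fact k) \<le> norm (\<bar>f u\<bar> * exp (r * \<bar>u\<bar>) / r ^ k)"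
    proof (rule AE_I2)
      fix u :: real
      have "norm (f u * u ^ k / fact k) * r ^ k = \<bar>f u\<bar> * ((r * \<bar>u\<bar>) ^ k / fact k)"
        by (simp add: power_mult_distrib abs_mult power_abs)
      also have "\<dots> \<le> \<bar>f u\<bar> * exp (r * \<bar>u\<bar>)"
        by (intro mult_left_mono power_div_fact_le_exp) (use r in auto)
      finally show "norm (f u * u ^ k / fact k) \<le> norm (\<bar>f u\<bar> * exp (r * \<bar>u\<bar>) / r ^ k)"
        using r by (simp add: field_simps abs_mult)
    qed
  qed measurable
  have t_int: "integrable lborel (t k)" for k
    unfolding t_def using mom[of k] by (intro integrable_mult_left integrable_of_real)
  have t_sums: "(\<lambda>k. t k u) sums (of_real (f u) * exp (z * of_real u))" for u
  proof -
    have "(\<lambda>k. of_real (f u) * ((z * of_real u) ^ k /\<^sub>R fact k)) sums (of_real (f u) * exp (z * of_real u))"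
      by (intro sums_mult exp_converges)
    moreover have "of_real (f u) * ((z * of_real u) ^ k /\<^sub>R fact k) = t k u" for k
      by (simp add: t_def scaleR_conv_of_real power_mult_distrib field_simps)
    ultimately show ?thesis by simp
  qed
  have norm_le: "(\<Sum>k<n. norm (t k u)) \<le> \<bar>f u\<bar> * exp (r * \<bar>u\<bar>)" for n u
  proof -
    have s: "(\<lambda>n. (r * \<bar>u\<bar>) ^ n / fact n) sums exp (r * \<bar>u\<bar>)"
      using exp_converges[of "r * \<bar>u\<bar>"] by (simp add: field_simps)
    have "(\<Sum>k<n. norm (t k u)) \<le> (\<Sum>k<n. \<bar>f u\<bar> * ((r * \<bar>u\<bar>) ^ k / fact k))"
      by (intro sum_mono bound)
    also have "\<dots> = \<bar>f u\<bar> * (\<Sum>k<n. (r * \<bar>u\<bar>) ^ k / fact k)" by (simp add: sum_distrib_left)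
    also have "(\<Sum>k<n. (r * \<bar>u\<bar>) ^ k / fact k) \<le> (\<Sum>k. (r * \<bar>u\<bar>) ^ k / fact k)"
      by (intro sum_le_suminf) (use s r in \<open>auto simp: sums_iff\<close>)
    also have "\<dots> = exp (r * \<bar>u\<bar>)" using s by (simp add: sums_iff)
    finally show ?thesis by (simp add: mult_left_mono)
  qed
  have AE1: "AE u in lborel. summable (\<lambda>k. norm (t k u))"
    by (intro AE_I2 summableI_nonneg_bounded[OF _ norm_le]) auto
  have "summable (\<lambda>k. LBINT u. norm (t k u))"
  proof (rule summableI_nonneg_bounded)
    show "(\<Sum>k<n. LBINT u. norm (t k u)) \<le> (LBINT u. \<bar>f u\<bar> * exp (r * \<bar>u\<bar>))" for n
    proof -
      have "(\<Sum>k<n. LBINT u. norm (t k u)) = (LBINT u. (\<Sum>k<n. norm (t k u)))"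
        by (rule Bochner_Integration.integral_sum[symmetric]) (use t_int in auto)
      also have "\<dots> \<le> (LBINT u. \<bar>f u\<bar> * exp (r * \<bar>u\<bar>))"
        by (intro integral_mono norm_le int' Bochner_Integration.integrable_sum integrable_norm t_int)
      finally show ?thesis .
    qed
  qed auto
  note S = this
  have eq: "(\<Sum>k. t k u) = of_real (f u) * exp (z * of_real u)" for u
    using t_sums[of u] by (simp add: sums_iff)
  show "integrable lborel (\<lambda>u. of_real (f u) * exp (z * of_real u))"
    using integrable_suminf[OF t_int AE1 S] by (simp add: eq)
  have "(LBINT u. t k u) = of_real (LBINT u. f u * u ^ k / fact k) * z ^ k" for k
    unfolding t_def by (simp only: integral_mult_left_zero integral_complex_of_real)
  with sums_integral[OF t_int AE1 S]
  show "(\<lambda>k. of_real (LBINT u. f u * u ^ k / fact k) * z ^ k) sums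
           (LBINT u. of_real (f u) * exp (z * of_real u))"
    by (simp add: eq)
qed

section \<open>Fourier inversion by Gaussian regularisation\<close>

lemma integrable_pair_lborel_mult:
  fixes f g :: "real \<Rightarrow> 'a::{real_normed_field,banach,second_countable_topology}"
  assumes "integrable lborel f" "integrable lborel g"
  shows "integrable (lborel \<Otimes>\<^sub>M lborel) (\<lambda>(x, y). f x * g y)"
proof (rule lborel_pair.Fubini_integrable)
  have [measurable]: "f \<in> borel_measurable borel" "g \<in> borel_measurable borel"
    using assms by (auto dest: borel_measurable_integrable)
  show "(\<lambda>(x, y). f x * g y) \<in> borel_measurable (lborel \<Otimes>\<^sub>M lborel)" by measurable
  show "integrable lborel (\<lambda>x. LBINT y. norm (case (x, y) of (x, y) \<Rightarrow> f x * g y))"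
    using assms by (simp add: norm_mult)
  show "AE x in lborel. integrable lborel (\<lambda>y. case (x, y) of (x, y) \<Rightarrow> f x * g y)"
    using assms by simp
qed

lemma integral_gaussian_iexp:
  assumes "c > (0::real)"
  shows "integrable lborel (\<lambda>t. exp (- (c * t)\<^sup>2 / 2))"
    and "(LBINT t. exp (\<i> * of_real (s * t)) * of_real (exp (- (c * t)\<^sup>2 / 2)))
       = of_real (sqrt (2 * pi) / c * exp (- (s / c)\<^sup>2 / 2))"
proof -
  have N: "std_normal_density x = exp (- x\<^sup>2 / 2) / sqrt (2 * pi)" for x
    by (simp add: std_normal_density_def)
  have "integrable lborel (\<lambda>x. std_normal_density x * sqrt (2 * pi))"
    by (intro integrable_mult_left) auto
  hence i: "integrable lborel (\<lambda>x::real. exp (- x\<^sup>2 / 2))"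
    by (simp add: N)
  from lborel_integrable_real_affine[OF this, of c 0] assms
  show "integrable lborel (\<lambda>t. exp (- (c * t)\<^sup>2 / 2))" by simp
  have ch: "(LBINT x. std_normal_density x *\<^sub>R exp (\<i> * of_real (t * x))) = of_real (exp (- t\<^sup>2 / 2))" for t
  proof -
    have "char std_normal_distribution t = (LBINT x. std_normal_density x *\<^sub>R exp (\<i> * of_real (t * x)))"
      unfolding char_def by (subst integral_density) (auto simp: normal_density_nonneg)
    then show ?thesis by (simp add: char_std_normal_distribution)
  qed
  have "(LBINT t. exp (\<i> * of_real (s * t)) * of_real (exp (- (c * t)\<^sup>2 / 2)))
     = \<bar>1/c\<bar> *\<^sub>R (LBINT x. exp (\<i> * of_real (s * (0 + 1/c * x))) * of_real (exp (- (c * (0 + 1/c * x))\<^sup>2 / 2)))"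
    by (rule lborel_integral_real_affine) (use assms in auto)
  also have "(LBINT x. exp (\<i> * of_real (s * (0 + 1/c * x))) * of_real (exp (- (c * (0 + 1/c * x))\<^sup>2 / 2)))
     = (LBINT x. of_real (sqrt (2 * pi)) * (std_normal_density x *\<^sub>R exp (\<i> * of_real (s / c * x))))"
    using assms by (intro Bochner_Integration.integral_cong) (auto simp: N scaleR_conv_of_real field_simps)
  also have "\<dots> = of_real (sqrt (2 * pi)) * of_real (exp (- (s / c)\<^sup>2 / 2))"
    by (subst integral_mult_right_zero, subst ch) simp
  finally show "(LBINT t. exp (\<i> * of_real (s * t)) * of_real (exp (- (c * t)\<^sup>2 / 2)))
       = of_real (sqrt (2 * pi) / c * exp (- (s / c)\<^sup>2 / 2))"
    using assms by (simp add: scaleR_conv_of_real)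
qed

text \<open>The double integral behind the right-hand side need not converge absolutely, so Gaussian
  factors exp(-(c n t)^2/2) with c n -> 0 are inserted. Fubini then turns the regularised integral
  into an average of f around x against a normal density of width c n. Dominated convergence handles
  both forms, with majorant |F| on one side and B times the normal density on the other.\<close>

theorem fourier_inversion:
  fixes f :: "real \<Rightarrow> real"
  assumes cont: "continuous_on UNIV f" and int: "integrable lborel f" and bd: "\<And>x. \<bar>f x\<bar> \<le> B"
    and F: "\<And>t. F t = (LBINT x. of_real (f x) * exp (\<i> * of_real t * of_real x))"
    and intF: "integrable lborel F"
  shows "of_real (f x) = 1 / (2 * of_real pi) * (LBINT t. F t * exp (- \<i> * of_real x * of_real t))"
proof -
  have [measurable]: "f \<in> borel_measurable borel" using cont by (rule borel_measurable_continuous_onI)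
  have [measurable]: "F \<in> borel_measurable borel" using intF by (auto dest: borel_measurable_integrable)
  define c where "c n = 1 / real (Suc n)" for n
  have c: "c n > 0" for n by (simp add: c_def)
  define I where "I n = (LBINT t. F t * exp (- \<i> * of_real x * of_real t) * of_real (exp (- (c n * t)\<^sup>2 / 2)))" for n
  have c0: "c \<longlonglongrightarrow> 0" unfolding c_def by real_asymp
  have lim1: "I \<longlonglongrightarrow> (LBINT t. F t * exp (- \<i> * of_real x * of_real t))"
    unfolding I_def
  proof (rule integral_dominated_convergence[where w = "\<lambda>t. norm (F t)"])
    show "AE t in lborel. (\<lambda>n. F t * exp (- \<i> * of_real x * of_real t) * of_real (exp (- (c n * t)\<^sup>2 / 2)))
        \<longlonglongrightarrow> F t * exp (- \<i> * of_real x * of_real t)"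
    proof (rule AE_I2)
      fix t :: real
      have "(\<lambda>n. F t * exp (- \<i> * of_real x * of_real t) * of_real (exp (- (c n * t)\<^sup>2 / 2)))
        \<longlonglongrightarrow> F t * exp (- \<i> * of_real x * of_real t) * of_real (exp (- (0 * t)\<^sup>2 / 2))"
        by (intro tendsto_intros c0) auto
      then show "(\<lambda>n. F t * exp (- \<i> * of_real x * of_real t) * of_real (exp (- (c n * t)\<^sup>2 / 2)))
        \<longlonglongrightarrow> F t * exp (- \<i> * of_real x * of_real t)" by simp
    qed
    show "AE t in lborel. norm (F t * exp (- \<i> * of_real x * of_real t) * of_real (exp (- (c n * t)\<^sup>2 / 2))) \<le> norm (F t)" for n
      by (intro AE_I2) (auto simp: norm_mult intro!: mult_left_le)
  qed (use intF in auto)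
  have I_eq: "I n = of_real (LBINT u. 2 * pi * (f (x + c n * u) * std_normal_density u))" for n
  proof -
    have "I n = (LBINT t. (LBINT y. of_real (f y) * exp (\<i> * of_real t * of_real y) * (exp (- \<i> * of_real x * of_real t) * of_real (exp (- (c n * t)\<^sup>2 / 2)))))"
      unfolding I_def F by (simp add: mult.assoc flip: integral_mult_left_zero)
    also have "\<dots> = (LBINT y. (LBINT t. of_real (f y) * exp (\<i> * of_real t * of_real y) * (exp (- \<i> * of_real x * of_real t) * of_real (exp (- (c n * t)\<^sup>2 / 2)))))"
    proof (rule lborel_pair.Fubini_integral)
      have "integrable (lborel \<Otimes>\<^sub>M lborel) (\<lambda>(y, t). f y * exp (- (c n * t)\<^sup>2 / 2))"
        by (rule integrable_pair_lborel_mult[OF int integral_gaussian_iexp(1)[OF c]])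
      then show "integrable (lborel \<Otimes>\<^sub>M lborel) (\<lambda>(y, t). of_real (f y) * exp (\<i> * of_real t * of_real y) * (exp (- \<i> * of_real x * of_real t) * of_real (exp (- (c n * t)\<^sup>2 / 2))))"
        by (rule Bochner_Integration.integrable_bound) (auto simp: norm_mult abs_mult split: prod.splits)
    qed
    also have "\<dots> = (LBINT y. of_real (f y * (sqrt (2 * pi) / c n * exp (- ((y - x) / c n)\<^sup>2 / 2))))"
    proof (rule Bochner_Integration.integral_cong[OF refl])
      fix y
      have "(LBINT t. of_real (f y) * exp (\<i> * of_real t * of_real y) * (exp (- \<i> * of_real x * of_real t) * of_real (exp (- (c n * t)\<^sup>2 / 2))))
       = (LBINT t. of_real (f y) * (exp (\<i> * of_real ((y - x) * t)) * of_real (exp (- (c n * t)\<^sup>2 / 2))))"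
        by (intro Bochner_Integration.integral_cong[OF refl]) (simp add: algebra_simps flip: exp_add)
      also have "\<dots> = of_real (f y * (sqrt (2 * pi) / c n * exp (- ((y - x) / c n)\<^sup>2 / 2)))"
        by (subst integral_mult_right_zero, subst integral_gaussian_iexp(2)[OF c]) simp
      finally show "(LBINT t. of_real (f y) * exp (\<i> * of_real t * of_real y) * (exp (- \<i> * of_real x * of_real t) * of_real (exp (- (c n * t)\<^sup>2 / 2))))
        = of_real (f y * (sqrt (2 * pi) / c n * exp (- ((y - x) / c n)\<^sup>2 / 2)))" .
    qed
    also have "\<dots> = of_real (LBINT y. f y * (sqrt (2 * pi) / c n * exp (- ((y - x) / c n)\<^sup>2 / 2)))"
      by (rule integral_complex_of_real)
    also have "(LBINT y. f y * (sqrt (2 * pi) / c n * exp (- ((y - x) / c n)\<^sup>2 / 2)))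
       = \<bar>c n\<bar> *\<^sub>R (LBINT u. f (x + c n * u) * (sqrt (2 * pi) / c n * exp (- ((x + c n * u - x) / c n)\<^sup>2 / 2)))"
      using c[of n] by (intro lborel_integral_real_affine) auto
    also have "\<dots> = (LBINT u. 2 * pi * (f (x + c n * u) * std_normal_density u))"
    proof -
      have sq: "sqrt (2 * pi) * sqrt (2 * pi) = 2 * pi" by simp
      have "\<bar>c n\<bar> * (f (x + c n * u) * (sqrt (2 * pi) / c n * exp (- ((x + c n * u - x) / c n)\<^sup>2 / 2)))
          = 2 * pi * (f (x + c n * u) * std_normal_density u)" for u
        unfolding std_normal_density_def using c[of n] sq by (simp add: field_simps)
      then show ?thesis by (simp only: real_scaleR_def flip: integral_mult_right_zero)
    qed
    finally show ?thesis .
  qed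
  have "(\<lambda>n. LBINT u. 2 * pi * (f (x + c n * u) * std_normal_density u)) \<longlonglongrightarrow> (LBINT u. 2 * pi * (f x * std_normal_density u))"
  proof (rule integral_dominated_convergence[where w = "\<lambda>u. 2 * pi * (B * std_normal_density u)"])
    show "AE u in lborel. (\<lambda>n. 2 * pi * (f (x + c n * u) * std_normal_density u)) \<longlonglongrightarrow> 2 * pi * (f x * std_normal_density u)"
    proof (rule AE_I2)
      fix u
      have "(\<lambda>n. x + c n * u) \<longlonglongrightarrow> x + 0 * u" by (intro tendsto_intros c0)
      hence "(\<lambda>n. f (x + c n * u)) \<longlonglongrightarrow> f x"
        using cont by (intro continuous_on_tendsto_compose[OF cont]) auto
      then show "(\<lambda>n. 2 * pi * (f (x + c n * u) * std_normal_density u)) \<longlonglongrightarrow> 2 * pi * (f x * std_normal_density u)"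
        by (intro tendsto_intros)
    qed
    show "AE u in lborel. norm (2 * pi * (f (x + c n * u) * std_normal_density u)) \<le> 2 * pi * (B * std_normal_density u)" for n
      by (intro AE_I2) (auto simp: abs_mult intro!: mult_right_mono bd)
  qed auto
  hence lim2: "I \<longlonglongrightarrow> of_real (2 * pi * f x)"
    unfolding I_eq by (intro tendsto_of_real) simp
  have "(LBINT t. F t * exp (- \<i> * of_real x * of_real t)) = of_real (2 * pi * f x)"
    by (rule LIMSEQ_unique[OF lim1 lim2])
  then show ?thesis by simp
qed

section \<open>The theta transformation\<close>

lemma integrable_exp_neg_abs:
  assumes "a > (0::real)" shows "integrable lborel (\<lambda>x::real. exp (- (a * \<bar>x\<bar>)))"
proof -
  define e where "e x = x ^ 0 * exp (- x) * indicator {0<..} x" for x :: real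
  have "integrable lborel e"
    unfolding e_def using has_bochner_integral_I0i_power_exp_m[of 0] by (simp add: has_bochner_integral_iff)
  from lborel_integrable_real_affine[OF this, of a 0] lborel_integrable_real_affine[OF this, of "-a" 0] assms
  have "integrable lborel (\<lambda>x. e (a * x) + e (- (a * x)))"
    by (intro Bochner_Integration.integrable_add) auto
  then show ?thesis
    by (rule Bochner_Integration.integrable_bound)
       (use assms AE_lborel_singleton[of 0] in \<open>auto simp: e_def indicator_def zero_less_mult_iff mult_less_0_iff\<close>)
qed

text \<open>Jacobi's theta function, the sum over all integers, is 1 + 2
  \<open>half_theta t\<close>: the terms for n and -n are paired and the term for 0 is split
  off.\<close>

definition half_theta :: "real \<Rightarrow> real" where
  "half_theta t = (\<Sum>n. exp (- pi * (real (Suc n))\<^sup>2 * t))"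

lemma half_theta_term_le: "t \<ge> 0 \<Longrightarrow> exp (- pi * (real (Suc n))\<^sup>2 * t) \<le> exp (- pi * t) * exp (- pi * t) ^ n"
proof -
  assume t: "t \<ge> 0"
  have "real (Suc n) * 1 \<le> real (Suc n) * real (Suc n)" by (intro mult_left_mono) auto
  hence "real (Suc n) * (pi * t) \<le> (real (Suc n))\<^sup>2 * (pi * t)"
    using t by (intro mult_right_mono) (auto simp: power2_eq_square)
  then show ?thesis by (simp add: algebra_simps flip: exp_of_nat_mult exp_add)
qed

lemma half_theta_sums:
  assumes "t > 0" shows "(\<lambda>n. exp (- pi * (real (Suc n))\<^sup>2 * t)) sums half_theta t"
  unfolding half_theta_def
proof (rule summable_sums, rule summable_comparison_test')
  show "summable (\<lambda>n. exp (- pi * t) * exp (- pi * t) ^ n)"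
    using assms by (intro summable_mult summable_geometric) auto
  show "norm (exp (- pi * (real (Suc n))\<^sup>2 * t)) \<le> exp (- pi * t) * exp (- pi * t) ^ n" for n
    using half_theta_term_le[of t n] assms by simp
qed

text \<open>For |y| \<le> 1/2 the argument pi y is at most 2 in modulus, so the cubic Taylor error
  is at most 2/3 of it. A third of pi |y| is left, which is at least |y| as pi > 3. This bounds the
  denominator in the Poisson argument from below.\<close>

lemma abs_sin_pi_ge:
  assumes "\<bar>y\<bar> \<le> 1/2" shows "\<bar>sin (pi * y)\<bar> \<ge> \<bar>y\<bar>"
proof -
  have "\<bar>sin (pi * y) - (\<Sum>m<3. sin_coeff m * (pi * y) ^ m)\<bar> \<le> inverse (fact 3) * \<bar>pi * y\<bar> ^ 3"
    by (rule Maclaurin_sin_bound)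
  also have "(\<Sum>m<3. sin_coeff m * (pi * y) ^ m) = pi * y"
    by (simp add: eval_nat_numeral sin_coeff_def)
  finally have 1: "\<bar>sin (pi * y) - pi * y\<bar> \<le> \<bar>pi * y\<bar> * (\<bar>pi * y\<bar>\<^sup>2 / 6)"
    by (simp add: eval_nat_numeral field_simps)
  have "\<bar>pi * y\<bar> \<le> 4 * (1/2)" unfolding abs_mult using assms pi_less_4 by (intro mult_mono) auto
  hence "\<bar>pi * y\<bar>\<^sup>2 / 6 \<le> 2\<^sup>2 / 6" by (intro divide_right_mono power_mono) auto
  hence "\<bar>pi * y\<bar> * (\<bar>pi * y\<bar>\<^sup>2 / 6) \<le> \<bar>pi * y\<bar> * (2/3)" by (intro mult_left_mono) auto
  hence 2: "\<bar>sin (pi * y)\<bar> \<ge> \<bar>pi * y\<bar> / 3" using 1 by linarith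
  have "3 * \<bar>y\<bar> \<le> pi * \<bar>y\<bar>" using pi_gt3 by (intro mult_right_mono) auto
  with 2 show ?thesis by (simp add: abs_mult)
qed

section \<open>The Dirichlet kernel and Fejer averages\<close>

definition dirichlet :: "nat \<Rightarrow> real \<Rightarrow> real" where
  "dirichlet N x = 1 + 2 * (\<Sum>k<N. cos (2 * pi * real (Suc k) * x))"

lemma sin_times_dirichlet: "sin (pi * x) * dirichlet N x = sin (real (2 * N + 1) * pi * x)"
proof (induction N)
  case (Suc N)
  have "sin (pi * x) * dirichlet (Suc N) x
      = sin (pi * x) * dirichlet N x + 2 * (sin (pi * x) * cos (2 * pi * real (Suc N) * x))"
    by (simp add: dirichlet_def algebra_simps)
  also have "2 * (sin (pi * x) * cos (2 * pi * real (Suc N) * x))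
     = sin (pi * x + 2 * pi * real (Suc N) * x) + sin (pi * x - 2 * pi * real (Suc N) * x)"
    by (simp add: sin_times_cos)
  also have "pi * x + 2 * pi * real (Suc N) * x = real (2 * Suc N + 1) * pi * x" by (simp add: algebra_simps)
  also have "pi * x - 2 * pi * real (Suc N) * x = - (real (2 * N + 1) * pi * x)" by (simp add: algebra_simps)
  finally show ?case using Suc by simp
qed (simp add: dirichlet_def)

lemma abs_dirichlet_le: "\<bar>dirichlet N x\<bar> \<le> 1 + 2 * real N"
proof -
  have "\<bar>\<Sum>k<N. cos (2 * pi * real (Suc k) * x)\<bar> \<le> (\<Sum>k<N. \<bar>cos (2 * pi * real (Suc k) * x)\<bar>)" by (rule sum_abs)
  also have "\<dots> \<le> (\<Sum>k<N. 1)" by (intro sum_mono) auto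
  finally show ?thesis by (simp add: dirichlet_def)
qed

lemma borel_measurable_dirichlet [measurable]: "dirichlet N \<in> borel_measurable borel"
  unfolding dirichlet_def by measurable

text \<open>The cosine terms integrate to zero because their antiderivatives vanish at
  half-integers. The intervals are half-open so that consecutive ones tile the line.\<close>

lemma integral_dirichlet:
  fixes n :: int
  shows "has_bochner_integral lborel (\<lambda>x. dirichlet N x * indicator {of_int n - 1/2..<of_int n + 1/2} x) 1"
proof -
  define F where "F x = x + 2 * (\<Sum>k<N. sin (2 * pi * real (Suc k) * x) / (2 * pi * real (Suc k)))" for x
  have D: "(F has_real_derivative dirichlet N x) (at x)" for x
    unfolding F_def dirichlet_def
    by (auto intro!: derivative_eq_intros sum.cong simp del: of_nat_Suc)
  have C: "isCont (dirichlet N) x" for x unfolding dirichlet_def by (intro continuous_intros)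
  have z: "sin (2 * pi * real (Suc k) * (of_int n + 1/2)) = 0" "sin (2 * pi * real (Suc k) * (of_int n - 1/2)) = 0" for k
  proof -
    have "2 * pi * real (Suc k) * (of_int n + 1/2) = of_int (int (Suc k) * (2 * n + 1)) * pi"
         "2 * pi * real (Suc k) * (of_int n - 1/2) = of_int (int (Suc k) * (2 * n - 1)) * pi"
      by (simp_all add: algebra_simps)
    then show "sin (2 * pi * real (Suc k) * (of_int n + 1/2)) = 0" "sin (2 * pi * real (Suc k) * (of_int n - 1/2)) = 0"
      by (simp_all only: sin_zero_iff_int2) blast+
  qed
  have "has_bochner_integral lborel (\<lambda>x. dirichlet N x * indicator {of_int n - 1/2..of_int n + 1/2} x) (F (of_int n + 1/2) - F (of_int n - 1/2))"
    by (intro has_bochner_integral_FTC_Icc_real) (auto intro: D C)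
  moreover have "F (of_int n + 1/2) - F (of_int n - 1/2) = 1"
    unfolding F_def z by simp
  moreover have "AE x in lborel. dirichlet N x * indicator {of_int n - 1/2..of_int n + 1/2} x
      = dirichlet N x * indicator {of_int n - 1/2..<of_int n + 1/2} x"
    using AE_lborel_singleton[of "of_int n + 1/2"] by eventually_elim (auto simp: indicator_def)
  ultimately show ?thesis by (subst (asm) has_bochner_integral_cong_AE) auto
qed

text \<open>If l lay above m, the sequence would eventually stay above their midpoint and pull the
  limit of the averages up to it; the other case follows by negation.\<close>

lemma cesaro_mean_tendsto:
  fixes b :: "nat \<Rightarrow> real"
  assumes b: "b \<longlonglongrightarrow> l" and m: "(\<lambda>M. (\<Sum>N<M. b N) / real M) \<longlonglongrightarrow> m"
  shows "l = m"
proof (rule ccontr)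
  have aux: False if "b \<longlonglongrightarrow> l" "(\<lambda>M. (\<Sum>N<M. b N) / real M) \<longlonglongrightarrow> m" "l > m" for b :: "nat \<Rightarrow> real" and l m
  proof -
    define d where "d = (l + m) / 2"
    have d: "m < d" "d < l" using that by (auto simp: d_def)
    from order_tendstoD(1)[OF that(1) d(2)] obtain K where K: "\<And>n. n \<ge> K \<Longrightarrow> b n > d"
      by (auto simp: eventually_sequentially)
    define S where "S = (\<Sum>N<K. b N)"
    have "(\<Sum>N<M. b N) \<ge> S + (real M - real K) * d" if "M \<ge> K" for M
    proof -
      have "(\<Sum>N<M. b N) = S + (\<Sum>N=K..<M. b N)"
        using that unfolding S_def lessThan_atLeast0 by (simp add: sum.atLeastLessThan_concat)
      moreover have "(\<Sum>N=K..<M. b N) \<ge> (\<Sum>N=K..<M. d)" by (intro sum_mono) (simp add: K less_imp_le)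
      ultimately show ?thesis using that by (simp add: of_nat_diff)
    qed
    hence "\<forall>\<^sub>F M in sequentially. (S + (real M - real K) * d) / real M \<le> (\<Sum>N<M. b N) / real M"
      unfolding eventually_sequentially by (intro exI[of _ K]) (auto intro!: divide_right_mono)
    moreover have "(\<lambda>M. (S + (real M - real K) * d) / real M) \<longlonglongrightarrow> d" by real_asymp
    ultimately have "d \<le> m" using that(2) by (intro tendsto_le[OF _ that(2)]) auto
    with d show False by simp
  qed
  assume "l \<noteq> m"
  then consider "l > m" | "- l > - m" by linarith
  then show False
  proof cases
    case 1 then show ?thesis using aux[OF b m] by simp
  next
    case 2
    have "(\<lambda>N. - b N) \<longlonglongrightarrow> - l" using b by (rule tendsto_minus)
    moreover have "(\<lambda>M. (\<Sum>N<M. - b N) / real M) \<longlonglongrightarrow> - m"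
      using tendsto_minus[OF m] by (simp add: sum_negf)
    ultimately show ?thesis using 2 aux by blast
  qed
qed

text \<open>Telescoping of the squares of sin (N y), the identity behind the Fejer kernel. It bounds
  the sum by 1/|sin y| uniformly in M.\<close>

lemma sum_sin_odd: "(\<Sum>N<M. sin (real (2 * N + 1) * y)) * sin y = (sin (real M * y))\<^sup>2"
proof (induction M)
  case (Suc M)
  have "sin ((2 * real M + 1) * y) * sin y = (sin (real (Suc M) * y))\<^sup>2 - (sin (real M * y))\<^sup>2"
  proof -
    have *: "(sin a)\<^sup>2 - (sin b)\<^sup>2 = sin (a + b) * sin (a - b)" for a b :: real
      by (simp add: sin_add sin_diff cos_squared_eq power2_eq_square[symmetric] algebra_simps power_mult_distrib)
    show ?thesis by (subst *) (simp add: algebra_simps)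
  qed
  with Suc show ?case by (simp add: algebra_simps)
qed simp

text \<open>Chernoff's proof of Poisson summation: subtracting from the Gaussian \<open>f\<close> its values at the
  nearest integers makes the division by \<open>sin (\<pi>x)\<close> in the Dirichlet kernel harmless. The remaining
  sine coefficients \<open>b N\<close> converge, and their averages tend to 0 by dominated convergence.\<close>
theorem half_theta_inversion:
  assumes t: "t > 0"
  shows "1 + 2 * half_theta t = (1 + 2 * half_theta (1 / t)) / sqrt t"
proof -
  \<comment> \<open>With this c the function f below is exp(-pi t x^2), whose values at the integers
    are the terms of theta at t.\<close>
  define c where "c = sqrt (2 * pi * t)"
  have c: "c > 0" "c\<^sup>2 = 2 * pi * t" using t by (auto simp: c_def)
  define f where "f x = exp (- (c * x)\<^sup>2 / 2)" for x :: real
  define h where "h x = f (of_int \<lfloor>x + 1/2\<rfloor>)" for x :: real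
  define G where "G x = (f x - h x) / sin (pi * x)" for x :: real
  have [measurable]: "f \<in> borel_measurable borel" unfolding f_def by measurable
  have [measurable]: "h \<in> borel_measurable borel" unfolding h_def by measurable
  have [measurable]: "G \<in> borel_measurable borel" unfolding G_def by measurable
  define C where "C = exp (2 / c\<^sup>2 + 1)"
  have fle: "f x \<le> exp (2 / c\<^sup>2) * exp (- (2 * \<bar>x\<bar>))" for x
  proof -
    \<comment> \<open>The rate 2 is chosen because one factor exp |\<xi>| is spent below on the
      factor \<xi> of the derivative of f, which leaves decay at rate 1.\<close>
    have "0 \<le> (c * \<bar>x\<bar> - 2 / c)\<^sup>2" by simp
    hence "2 * \<bar>x\<bar> \<le> (c * x)\<^sup>2 / 2 + 2 / c\<^sup>2"
      using c(1) by (simp add: power2_eq_square field_simps)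
    then show ?thesis by (simp add: f_def flip: exp_add)
  qed
  have near: "\<bar>\<xi>\<bar> \<ge> \<bar>x\<bar> - 1" if "\<bar>\<xi> - x\<bar> \<le> 1/2" for \<xi> x :: real using that by linarith
  have rnd: "\<bar>of_int \<lfloor>x + 1/2\<rfloor> - x\<bar> \<le> 1/2" for x :: real by linarith
  have C0: "C > 0" by (simp add: C_def)
  have hle: "\<bar>h x\<bar> \<le> C * exp (- (1 * \<bar>x\<bar>))" for x
  proof -
    have "h x \<le> exp (2 / c\<^sup>2) * exp (- (2 * \<bar>of_int \<lfloor>x + 1/2\<rfloor>\<bar>))" unfolding h_def by (rule fle)
    also have "\<dots> \<le> exp (2 / c\<^sup>2) * exp (1 - \<bar>x\<bar>)"
      using near[OF rnd[of x]] by simp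
    also have "\<dots> = C * exp (- (1 * \<bar>x\<bar>))" by (simp add: C_def flip: exp_add)
    finally show ?thesis by (simp add: h_def f_def)
  qed
  \<comment> \<open>The difference f x - h x is at most a bound for the derivative times the
    distance from x to the nearest integer, and |sin (pi x)| is at least that distance. At integers
    G is 0, since division by zero gives 0.\<close>
  have Gle: "\<bar>G x\<bar> \<le> c\<^sup>2 * C * exp (- (1 * \<bar>x\<bar>))" for x
  proof -
    define n :: real where "n = of_int \<lfloor>x + 1/2\<rfloor>"
    have nx: "\<bar>n - x\<bar> \<le> 1/2" using rnd by (simp add: n_def)
    have der: "(f has_real_derivative - (c\<^sup>2 * \<xi>) * f \<xi>) (at \<xi>)" for \<xi>
      unfolding f_def by (auto intro!: derivative_eq_intros simp: power2_eq_square)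
    have "norm (f x - f n) \<le> c\<^sup>2 * C * exp (- (1 * \<bar>x\<bar>)) * norm (x - n)"
    proof (rule field_differentiable_bound[where S = "closed_segment x n" and f' = "\<lambda>\<xi>. - (c\<^sup>2 * \<xi>) * f \<xi>"])
      fix \<xi> assume "\<xi> \<in> closed_segment x n"
      hence "\<bar>\<xi> - x\<bar> \<le> 1/2" using nx by (auto simp: closed_segment_eq_real_ivl split: if_splits)
      note xi = near[OF this]
      have "norm (- (c\<^sup>2 * \<xi>) * f \<xi>) = c\<^sup>2 * (\<bar>\<xi>\<bar> * f \<xi>)" by (simp add: abs_mult f_def)
      also have "\<bar>\<xi>\<bar> * f \<xi> \<le> exp \<bar>\<xi>\<bar> * (exp (2 / c\<^sup>2) * exp (- (2 * \<bar>\<xi>\<bar>)))"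
      proof (intro mult_mono fle)
        show "\<bar>\<xi>\<bar> \<le> exp \<bar>\<xi>\<bar>" using exp_ge_add_one_self[of "\<bar>\<xi>\<bar>"] by linarith
      qed (auto simp: f_def)
      also have "\<dots> \<le> C * exp (- (1 * \<bar>x\<bar>))" using xi by (simp add: C_def flip: exp_add)
      finally show "norm (- (c\<^sup>2 * \<xi>) * f \<xi>) \<le> c\<^sup>2 * C * exp (- (1 * \<bar>x\<bar>))" by (simp add: mult_left_mono mult.assoc)
    next
      show "(f has_field_derivative - (c\<^sup>2 * \<xi>) * f \<xi>) (at \<xi> within closed_segment x n)" for \<xi>
        by (rule has_field_derivative_at_within[OF der])
    qed auto
    moreover have "norm (x - n) \<le> \<bar>sin (pi * x)\<bar>"
    proof -
      have "\<bar>sin (pi * x)\<bar> = \<bar>sin (pi * (x - n))\<bar>"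
      proof -
        have "pi * (x - n) = pi * x - of_int \<lfloor>x + 1/2\<rfloor> * pi" by (simp add: n_def algebra_simps)
        moreover have s0: "sin (of_int \<lfloor>x + 1/2\<rfloor> * pi) = 0" by (simp add: sin_zero_iff_int2)
        moreover have "\<bar>cos (of_int \<lfloor>x + 1/2\<rfloor> * pi)\<bar> = 1" using s0 by (rule sin_zero_abs_cos_one)
        ultimately show ?thesis by (simp add: sin_diff abs_mult)
      qed
      then show ?thesis using abs_sin_pi_ge[of "x - n"] nx by (simp add: abs_minus_commute)
    qed
    ultimately have le: "\<bar>f x - h x\<bar> \<le> c\<^sup>2 * C * exp (- (1 * \<bar>x\<bar>)) * \<bar>sin (pi * x)\<bar>"
      
    proof -
      assume a: "norm (f x - f n) \<le> c\<^sup>2 * C * exp (- (1 * \<bar>x\<bar>)) * norm (x - n)" "norm (x - n) \<le> \<bar>sin (pi * x)\<bar>"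
      note a(1)
      also have "c\<^sup>2 * C * exp (- (1 * \<bar>x\<bar>)) * norm (x - n) \<le> c\<^sup>2 * C * exp (- (1 * \<bar>x\<bar>)) * \<bar>sin (pi * x)\<bar>"
        using C0 by (intro mult_left_mono a(2)) auto
      finally show "\<bar>f x - h x\<bar> \<le> c\<^sup>2 * C * exp (- (1 * \<bar>x\<bar>)) * \<bar>sin (pi * x)\<bar>" by (simp add: h_def n_def)
    qed
    show ?thesis
    proof (cases "sin (pi * x) = 0")
      case True then show ?thesis using C0 by (simp add: G_def)
    next
      case False then show ?thesis using le by (simp add: G_def abs_divide field_simps)
    qed
  qed
  have intG: "integrable lborel G"
    by (rule Bochner_Integration.integrable_bound[OF integrable_mult_right[OF integrable_exp_neg_abs[of 1], of "c\<^sup>2 * C"]])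
       (use Gle C0 in \<open>auto intro: order_trans[OF _ abs_ge_self]\<close>)
  have inth: "integrable lborel h"
    by (rule Bochner_Integration.integrable_bound[OF integrable_mult_right[OF integrable_exp_neg_abs[of 1], of C]])
       (use hle C0 in \<open>auto intro: order_trans[OF _ abs_ge_self]\<close>)
  have inthD: "integrable lborel (\<lambda>x. h x * dirichlet N x)" for N
    by (rule integrable_mult_bounded[OF inth, where B = "1 + 2 * real N"]) (auto simp: abs_dirichlet_le)
  define b where "b N = (LBINT x. G x * sin (real (2 * N + 1) * pi * x))" for N
  have intGs: "integrable lborel (\<lambda>x. G x * sin (real (2 * N + 1) * pi * x))" for N
    by (rule integrable_mult_bounded[OF intG, where B = 1]) auto
  have split: "f x * dirichlet N x = h x * dirichlet N x + G x * sin (real (2 * N + 1) * pi * x)" for x N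
  proof (cases "sin (pi * x) = 0")
    case True
    then obtain i where i: "pi * x = of_int i * pi" using sin_zero_iff_int2 by metis
    hence x: "x = of_int i" by simp
    have "\<lfloor>x + 1/2\<rfloor> = i" unfolding x by (rule floor_unique) auto
    hence "h x = f x" by (simp add: h_def x)
    then show ?thesis using True by (simp add: G_def)
  next
    case False
    have "G x * sin (real (2 * N + 1) * pi * x) = (f x - h x) * dirichlet N x"
      unfolding sin_times_dirichlet[symmetric] G_def using False by simp
    then show ?thesis by (simp add: left_diff_distrib)
  qed
  \<comment> \<open>On the cell around n the function h is the constant f n and the kernel has
    integral 1, so every N yields the full theta series at t.\<close>
  have inth': "(LBINT x. h x * dirichlet N x) = 1 + 2 * half_theta t" for N
  proof -
    have step: "has_bochner_integral lborel (\<lambda>x. h x * dirichlet N x * indicator {of_int n - 1/2..<of_int n + 1/2} x) (f (of_int n))" for n :: int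
    proof -
      have "h x * dirichlet N x * indicator {of_int n - 1/2..<of_int n + 1/2} x
        = f (of_int n) * (dirichlet N x * indicator {of_int n - 1/2..<of_int n + 1/2} x)" for x
      proof (cases "x \<in> {of_int n - 1/2..<of_int n + 1/2}")
        case True
        hence "of_int n - 1/2 \<le> x" "x < of_int n + 1/2" by auto
        hence "\<lfloor>x + 1/2\<rfloor> = n" by (intro floor_unique; linarith)
        then show ?thesis by (simp only: h_def mult.assoc)
      next
        case False
        then show ?thesis by (simp only: indicator_simps(2)[OF False] mult_zero_right)
      qed
      note eq = this
      show ?thesis unfolding eq
        using has_bochner_integral_mult_right[OF integral_dirichlet[of N n], of "f (of_int n)"] by (simp only: mult_1_right)
    qed
    define A where "A M = {- real M - 1/2..<real M + 1/2}" for M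
    have feven: "f (- x) = f x" for x by (simp add: f_def)
    have part: "has_bochner_integral lborel (\<lambda>x. h x * dirichlet N x * indicator (A M) x) (1 + 2 * (\<Sum>n<M. f (real (Suc n))))" for M
    proof (induction M)
      case 0 then show ?case using step[of 0] by (simp add: A_def f_def)
    next
      case (Suc M)
      have "has_bochner_integral lborel (\<lambda>x. h x * dirichlet N x * indicator (A M) x
           + (h x * dirichlet N x * indicator {of_int (int (Suc M)) - 1/2..<of_int (int (Suc M)) + 1/2} x
            + h x * dirichlet N x * indicator {of_int (- int (Suc M)) - 1/2..<of_int (- int (Suc M)) + 1/2} x))
           (1 + 2 * (\<Sum>n<M. f (real (Suc n))) + (f (of_int (int (Suc M))) + f (of_int (- int (Suc M)))))"
        by (intro has_bochner_integral_add Suc step)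
      moreover have "f (of_int (int (Suc M))) + f (of_int (- int (Suc M))) = 2 * f (real (Suc M))"
        using feven[of "real (Suc M)"] by simp
      moreover have "h x * dirichlet N x * indicator (A M) x
           + (h x * dirichlet N x * indicator {of_int (int (Suc M)) - 1/2..<of_int (int (Suc M)) + 1/2} x
            + h x * dirichlet N x * indicator {of_int (- int (Suc M)) - 1/2..<of_int (- int (Suc M)) + 1/2} x)
          = h x * dirichlet N x * indicator (A (Suc M)) x" for x
        by (auto simp: A_def indicator_def)
      ultimately show ?case by (simp add: algebra_simps)
    qed
    have "(\<lambda>M. LBINT x. h x * dirichlet N x * indicator (A M) x) \<longlonglongrightarrow> (LBINT x. h x * dirichlet N x)"
    proof (rule integral_dominated_convergence[where w = "\<lambda>x. norm (h x * dirichlet N x)"])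
      show "AE x in lborel. (\<lambda>M. h x * dirichlet N x * indicator (A M) x) \<longlonglongrightarrow> h x * dirichlet N x"
      proof (rule AE_I2)
        fix x :: real
        obtain m where m: "\<bar>x\<bar> < real m" using reals_Archimedean2 by blast
        have "\<forall>\<^sub>F M in sequentially. h x * dirichlet N x * indicator (A M) x = h x * dirichlet N x"
          unfolding eventually_sequentially
          by (intro exI[of _ m]) (use m in \<open>auto simp: A_def indicator_def\<close>)
        then show "(\<lambda>M. h x * dirichlet N x * indicator (A M) x) \<longlonglongrightarrow> h x * dirichlet N x" by (rule tendsto_eventually)
      qed
    qed (use inthD[of N] in \<open>auto simp: A_def indicator_def\<close>)
    moreover have "(\<lambda>M. LBINT x. h x * dirichlet N x * indicator (A M) x) \<longlonglongrightarrow> 1 + 2 * half_theta t"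
    proof -
      have "f (real (Suc n)) = exp (- pi * (real (Suc n))\<^sup>2 * t)" for n
        by (simp add: f_def power_mult_distrib c(2))
      hence "(\<lambda>n. f (real (Suc n))) sums half_theta t" using half_theta_sums[OF t] by simp
      then show ?thesis
        unfolding has_bochner_integral_integral_eq[OF part] sums_def by (intro tendsto_intros)
    qed
    ultimately show ?thesis by (rule LIMSEQ_unique)
  qed
  have fint: "integrable lborel f" unfolding f_def by (rule integral_gaussian_iexp(1)[OF c(1)])
  \<comment> \<open>The Fourier transform of the Gaussian is a Gaussian with t replaced by 1/t;
    against the kernel this will give partial sums of theta at 1/t.\<close>
  have fcos: "has_bochner_integral lborel (\<lambda>x. f x * cos (2 * pi * s * x)) (exp (- pi * s\<^sup>2 * (1/t)) / sqrt t)" for s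
  proof -
    have i: "integrable lborel (\<lambda>x. f x * cos (2 * pi * s * x))"
      by (rule integrable_mult_bounded[OF fint, where B = 1]) auto
    have ic: "complex_integrable lborel (\<lambda>x. exp (\<i> * of_real (2 * pi * s * x)) * of_real (f x))"
      by (rule Bochner_Integration.integrable_bound[OF fint]) (auto simp: norm_mult)
    have "(LBINT x. f x * cos (2 * pi * s * x)) = (LBINT x. Re (exp (\<i> * of_real (2 * pi * s * x)) * of_real (f x)))"
      by (intro Bochner_Integration.integral_cong) (simp_all add: Re_exp)
    also have "\<dots> = Re (LBINT x. exp (\<i> * of_real (2 * pi * s * x)) * of_real (f x))"
      by (rule integral_Re[OF ic])
    also have "\<dots> = sqrt (2 * pi) / c * exp (- (2 * pi * s / c)\<^sup>2 / 2)"
      unfolding f_def by (subst integral_gaussian_iexp(2)[OF c(1)]) simp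
    also have "sqrt (2 * pi) / c = 1 / sqrt t" using t by (simp add: c_def real_sqrt_mult)
    also have "- (2 * pi * s / c)\<^sup>2 / 2 = - pi * s\<^sup>2 * (1/t)"
      using t by (simp add: power_divide power_mult_distrib c(2)) (simp add: power2_eq_square field_simps)
    finally show ?thesis using i by (simp add: has_bochner_integral_iff field_simps)
  qed
  have fD: "has_bochner_integral lborel (\<lambda>x. f x * dirichlet N x)
     ((1 + 2 * (\<Sum>k<N. exp (- pi * (real (Suc k))\<^sup>2 * (1/t)))) / sqrt t)" for N
  proof -
    have "has_bochner_integral lborel (\<lambda>x. f x * cos (2 * pi * 0 * x) + 2 * (\<Sum>k<N. f x * cos (2 * pi * real (Suc k) * x)))
       (exp (- pi * 0\<^sup>2 * (1/t)) / sqrt t + 2 * (\<Sum>k<N. exp (- pi * (real (Suc k))\<^sup>2 * (1/t)) / sqrt t))"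
      by (intro has_bochner_integral_add has_bochner_integral_mult_right has_bochner_integral_sum fcos)
    moreover have "f x * cos (2 * pi * 0 * x) + 2 * (\<Sum>k<N. f x * cos (2 * pi * real (Suc k) * x)) = f x * dirichlet N x" for x
      by (simp add: dirichlet_def sum_distrib_left algebra_simps)
    ultimately show ?thesis by (simp add: add_divide_distrib flip: sum_divide_distrib)
  qed
  have bN: "b N = (1 + 2 * (\<Sum>k<N. exp (- pi * (real (Suc k))\<^sup>2 * (1/t)))) / sqrt t - (1 + 2 * half_theta t)" for N
  proof -
    have "(1 + 2 * (\<Sum>k<N. exp (- pi * (real (Suc k))\<^sup>2 * (1/t)))) / sqrt t = (LBINT x. f x * dirichlet N x)"
      using has_bochner_integral_integral_eq[OF fD[of N]] by simp
    also have "\<dots> = 1 + 2 * half_theta t + b N"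
      unfolding split b_def by (subst Bochner_Integration.integral_add[OF inthD intGs]) (simp add: inth')
    finally show ?thesis by simp
  qed
  have blim: "b \<longlonglongrightarrow> (1 + 2 * half_theta (1/t)) / sqrt t - (1 + 2 * half_theta t)"
    unfolding bN using half_theta_sums[of "1/t"] t unfolding sums_def by (intro tendsto_intros) auto
  \<comment> \<open>The averaged sines are bounded by 1 and by 1/(M |sin (pi x)|), so they tend to 0
    off the integers, while G vanishes at the integers.\<close>
  have "(\<lambda>M. LBINT x. G x * ((\<Sum>N<M. sin (real (2 * N + 1) * pi * x)) / real M)) \<longlonglongrightarrow> (\<integral>x. 0 \<partial>(lborel :: real measure))"
  proof (rule integral_dominated_convergence[where w = "\<lambda>x. norm (G x)"])
    show "AE x in lborel. (\<lambda>M. G x * ((\<Sum>N<M. sin (real (2 * N + 1) * pi * x)) / real M)) \<longlonglongrightarrow> 0"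
    proof (rule AE_I2)
      fix x :: real
      show "(\<lambda>M. G x * ((\<Sum>N<M. sin (real (2 * N + 1) * pi * x)) / real M)) \<longlonglongrightarrow> 0"
      proof (cases "sin (pi * x) = 0")
        case True then show ?thesis by (simp add: G_def)
      next
        case False
        have "(\<lambda>M. (\<Sum>N<M. sin (real (2 * N + 1) * pi * x)) / real M) \<longlonglongrightarrow> 0"
        proof (rule Lim_null_comparison)
          show "(\<lambda>M. 1 / \<bar>sin (pi * x)\<bar> / real M) \<longlonglongrightarrow> 0" by real_asymp
          show "\<forall>\<^sub>F M in sequentially. norm ((\<Sum>N<M. sin (real (2 * N + 1) * pi * x)) / real M) \<le> 1 / \<bar>sin (pi * x)\<bar> / real M"
          proof (rule always_eventually, rule allI)
            fix M
            have "\<bar>\<Sum>N<M. sin (real (2 * N + 1) * pi * x)\<bar> * \<bar>sin (pi * x)\<bar> = \<bar>sin (real M * (pi * x))\<bar>\<^sup>2"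
              using sum_sin_odd[where y = "pi * x" and M = M] by (simp add: mult.assoc flip: abs_mult)
            also have "\<dots> \<le> 1\<^sup>2" by (intro power_mono) auto
            finally have "\<bar>\<Sum>N<M. sin (real (2 * N + 1) * pi * x)\<bar> \<le> 1 / \<bar>sin (pi * x)\<bar>"
              using False by (simp add: field_simps)
            then show "norm ((\<Sum>N<M. sin (real (2 * N + 1) * pi * x)) / real M) \<le> 1 / \<bar>sin (pi * x)\<bar> / real M"
              using divide_right_mono[OF _ of_nat_0_le_iff[of M], of "\<bar>\<Sum>N<M. sin (real (2 * N + 1) * pi * x)\<bar>"] by (simp only: real_norm_def abs_divide abs_of_nat)
          qed
        qed
        then show ?thesis by (rule tendsto_mult_right_zero)
      qed
    qed
    show "AE x in lborel. norm (G x * ((\<Sum>N<M. sin (real (2 * N + 1) * pi * x)) / real M)) \<le> norm (G x)" for M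
    proof (rule AE_I2)
      fix x :: real
      have "\<bar>\<Sum>N<M. sin (real (2 * N + 1) * pi * x)\<bar> \<le> (\<Sum>N<M. \<bar>sin (real (2 * N + 1) * pi * x)\<bar>)" by (rule sum_abs)
      also have "\<dots> \<le> (\<Sum>N<M. 1)" by (intro sum_mono) auto
      finally have "\<bar>(\<Sum>N<M. sin (real (2 * N + 1) * pi * x)) / real M\<bar> \<le> 1"
        by (cases "M = 0") (auto simp: abs_divide field_simps)
      then show "norm (G x * ((\<Sum>N<M. sin (real (2 * N + 1) * pi * x)) / real M)) \<le> norm (G x)"
        unfolding real_norm_def abs_mult by (intro mult_left_le) auto
    qed
  qed (use intG in auto)
  moreover have "(LBINT x. G x * ((\<Sum>N<M. sin (real (2 * N + 1) * pi * x)) / real M)) = (\<Sum>N<M. b N) / real M" for M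
    unfolding b_def using intGs
    by (subst Bochner_Integration.integral_sum[symmetric])
       (auto simp: sum_distrib_left intro!: Bochner_Integration.integral_cong simp flip: integral_divide_zero)
  ultimately have "(\<lambda>M. (\<Sum>N<M. b N) / real M) \<longlonglongrightarrow> 0"
    by (simp only: Bochner_Integration.integral_zero)
  from cesaro_mean_tendsto[OF blim this] show ?thesis by simp
qed

section \<open>Mellin transforms in exponential coordinates\<close>

text \<open>With c = s - 1 and c = s this produces the pole terms in the Mellin transform of theta;
  with c = a + i t and c = a - i t it gives the transform of exp(-a|x|).\<close>

lemma has_bochner_integral_exp_neg_half_line:
  fixes c :: complex
  assumes c: "Re c > 0"
  shows "has_bochner_integral lborel (\<lambda>u. indicator {..<0} u *\<^sub>R exp (c * of_real u)) (1 / c)"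
proof -
  have c0: "c \<noteq> 0" using c by auto
  have int: "integrable lborel (\<lambda>u. indicator {..<0} u *\<^sub>R exp (c * of_real u))"
  proof (rule Bochner_Integration.integrable_bound[OF integrable_exp_neg_abs[OF c]])
    show "AE u in lborel. norm (indicator {..<0} u *\<^sub>R exp (c * of_real u)) \<le> norm (exp (- (Re c * \<bar>u\<bar>)))"
      by (intro AE_I2) (auto simp: indicator_def)
  qed measurable
  have einterval: "einterval (-\<infinity>) 0 = {..<0::real}" by (auto simp: einterval_def zero_ereal_def)
  have "(LBINT u=-\<infinity>..0. exp (c * of_real u)) = 1 / c - 0"
  proof (rule interval_integral_FTC_integrable[where F = "\<lambda>u. exp (c * of_real u) / c"])
    show "((\<lambda>u. exp (c * of_real u) / c) has_vector_derivative exp (c * of_real x)) (at x)" for x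
    proof -
      have "((\<lambda>z. exp (c * z) / c) has_field_derivative exp (c * of_real x)) (at (of_real x))"
        using c0 by (auto intro!: derivative_eq_intros)
      from has_vector_derivative_real_field[OF this] show ?thesis by (simp add: o_def)
    qed
    show "isCont (\<lambda>u. exp (c * complex_of_real u)) x" for x by (intro continuous_intros)
    show "set_integrable lborel (einterval (-\<infinity>) 0) (\<lambda>u. exp (c * complex_of_real u))"
      using int unfolding set_integrable_def einterval .
    have "((\<lambda>u. exp (c * complex_of_real u) / c) \<longlongrightarrow> 0) at_bot"
    proof (rule Lim_null_comparison)
      show "((\<lambda>u. exp (Re c * u) / norm c) \<longlongrightarrow> 0) at_bot"
      proof (rule tendsto_divide_zero)
        define r where "r = Re c"
        have "r > 0" using c by (simp add: r_def)
        then show "((\<lambda>u. exp (Re c * u)) \<longlongrightarrow> 0) at_bot" unfolding r_def[symmetric] by real_asymp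
      qed
      show "\<forall>\<^sub>F u in at_bot. norm (exp (c * complex_of_real u) / c) \<le> exp (Re c * u) / norm c"
        by (intro always_eventually) (simp add: norm_divide)
    qed
    then show "(((\<lambda>u. exp (c * complex_of_real u) / c) \<circ> real_of_ereal) \<longlongrightarrow> 0) (at_right (-\<infinity>))"
      by (simp only: ereal_tendsto_simps1)
    have "((\<lambda>u. exp (c * complex_of_real u) / c) \<longlongrightarrow> exp (c * complex_of_real 0) / c) (at_left 0)"
      by (intro tendsto_intros) (use c0 in auto)
    then show "(((\<lambda>u. exp (c * complex_of_real u) / c) \<circ> real_of_ereal) \<longlongrightarrow> 1 / c) (at_left 0)"
      by (simp add: zero_ereal_def ereal_tendsto_simps1)
  qed (auto simp: zero_ereal_def)
  moreover have "(LBINT u=-\<infinity>..0. exp (c * of_real u)) = (LBINT u. indicator {..<0} u *\<^sub>R exp (c * of_real u))"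
    unfolding interval_lebesgue_integral_def set_lebesgue_integral_def einterval by simp
  ultimately show ?thesis using int by (simp add: has_bochner_integral_iff)
qed

lemma has_bochner_integral_exp_neg_abs_iexp:
  fixes a t :: real
  assumes a: "a > 0"
  shows "has_bochner_integral lborel (\<lambda>x. of_real (exp (- (a * \<bar>x\<bar>))) * exp (\<i> * of_real t * of_real x)) (of_real (2 * a / (a\<^sup>2 + t\<^sup>2)))"
proof -
  define e where "e c u = indicator {..<0} u *\<^sub>R exp (c * complex_of_real u)" for c u
  have e: "has_bochner_integral lborel (e c) (1 / c)" if "Re c > 0" for c
    unfolding e_def using has_bochner_integral_exp_neg_half_line[OF that] .
  define c1 c2 where "c1 = Complex a t" and "c2 = Complex a (- t)"
  have c: "Re c1 > 0" "Re c2 > 0" using a by (auto simp: c1_def c2_def)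
  have "has_bochner_integral lborel (\<lambda>u. e c2 (- u)) (1 / c2)"
    using e[OF c(2)] lborel_integrable_real_affine_iff[of "-1" "e c2" 0] lborel_integral_real_affine[of "-1" "e c2" 0]
    by (simp add: has_bochner_integral_iff)
  hence "has_bochner_integral lborel (\<lambda>u. e c1 u + e c2 (- u)) (1 / c1 + 1 / c2)"
    by (intro has_bochner_integral_add e c)
  moreover have "1 / c1 + 1 / c2 = of_real (2 * a / (a\<^sup>2 + t\<^sup>2))"
    using a by (auto simp: c1_def c2_def complex_eq_iff Re_divide Im_divide power2_eq_square add_divide_distrib)
  moreover have "AE u in lborel. e c1 u + e c2 (- u) = of_real (exp (- (a * \<bar>u\<bar>))) * exp (\<i> * of_real t * of_real u)"
    using AE_lborel_singleton[of 0]
  proof eventually_elim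
    case (elim u)
    have 1: "c1 * of_real u = of_real (- (a * \<bar>u\<bar>)) + \<i> * of_real t * of_real u" if "u < 0"
      using that by (auto simp: c1_def complex_eq_iff)
    have 2: "c2 * of_real (- u) = of_real (- (a * \<bar>u\<bar>)) + \<i> * of_real t * of_real u" if "u > 0"
      using that by (auto simp: c2_def complex_eq_iff)
    show ?case
    proof (cases "u < 0")
      case True
      hence "e c1 u + e c2 (- u) = exp (c1 * of_real u)" by (simp add: e_def)
      then show ?thesis unfolding 1[OF True] exp_add by (simp only: exp_of_real)
    next
      case False
      hence "u > 0" using elim by simp
      hence "e c1 u + e c2 (- u) = exp (c2 * of_real (- u))" by (simp add: e_def)
      then show ?thesis unfolding 2[OF \<open>u > 0\<close>] exp_add by (simp only: exp_of_real)
    qed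
  qed
  ultimately show ?thesis
    by (subst (asm) has_bochner_integral_cong_AE)
       (auto intro!: borel_measurable_add simp: e_def)
qed

lemma integral_exp_neg_abs:
  assumes "a > (0::real)" shows "(LBINT x. exp (- (a * \<bar>x\<bar>))) = 2 / a"
proof -
  have "complex_of_real (LBINT x. exp (- (a * \<bar>x\<bar>))) = of_real (2 * a / (a\<^sup>2 + 0\<^sup>2))"
    using has_bochner_integral_integral_eq[OF has_bochner_integral_exp_neg_abs_iexp[OF assms, of 0]]
    by (simp flip: integral_complex_of_real)
  then show ?thesis unfolding of_real_eq_iff using assms by (simp add: power2_eq_square)
qed

lemma has_bochner_integral_Gamma_exp:
  assumes z: "Re z > 0"
  shows "has_bochner_integral lborel (\<lambda>u. exp (z * of_real u) * of_real (exp (- exp u))) (Gamma z)"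
proof -
  define f where "f t = of_real t powr (z - 1) / of_real (exp t)" for t :: real
  define g where "g u = exp (z * of_real u) * of_real (exp (- exp u))" for u :: real
  have meas: "g \<in> borel_measurable lborel" unfolding g_def by measurable
  have range: "exp ` (UNIV :: real set) = {0<..}"
  proof (intro subset_antisym subsetI)
    fix x :: real assume "x \<in> {0<..}"
    hence "x = exp (ln x)" by simp
    then show "x \<in> range exp" by blast
  qed auto
  have "f absolutely_integrable_on exp ` UNIV \<and> integral (exp ` UNIV) f = Gamma z"
    unfolding range f_def
    using absolutely_integrable_Gamma_integral'[OF z] Gamma_integral_complex'[OF z] by (auto intro: integral_unique)
  hence "(\<lambda>u. \<bar>exp u\<bar> *\<^sub>R f (exp u)) absolutely_integrable_on UNIV \<and> integral UNIV (\<lambda>u. \<bar>exp u\<bar> *\<^sub>R f (exp u)) = Gamma z"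
    by (subst has_absolute_integral_change_of_variables_real)
       (auto intro!: derivative_eq_intros injI)
  moreover have "\<bar>exp u\<bar> *\<^sub>R f (exp u) = g u" for u
  proof -
    have "complex_of_real (exp u) powr (z - 1) = exp ((z - 1) * of_real u)"
      by (simp add: powr_def Ln_of_real)
    moreover have "complex_of_real (exp u) * exp ((z - 1) * of_real u) = exp (z * of_real u)"
      by (simp add: algebra_simps flip: exp_of_real exp_add)
    ultimately show ?thesis by (simp add: f_def g_def scaleR_conv_of_real exp_minus field_simps)
  qed
  ultimately have G: "g absolutely_integrable_on UNIV" "integral UNIV g = Gamma z" by simp_all
  hence L: "integrable lebesgue g" by (simp add: set_integrable_def)
  have "integral\<^sup>L lebesgue g = Gamma z"
    using set_lebesgue_integral_eq_integral(2)[OF G(1)] G(2) by (simp add: set_lebesgue_integral_def)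
  then show ?thesis
    using L meas unfolding g_def[symmetric] has_bochner_integral_iff by (simp add: integrable_completion integral_completion)
qed

text \<open>In exponential coordinates the scaling is the affine change v = ln a + 2 u. The value is
  Gamma(s/2) / (2 a^(s/2)), with the power kept as exp and ln.\<close>

lemma has_bochner_integral_Gamma_exp_scaled:
  assumes s: "Re s > 0" and a: "a > 0"
  shows "has_bochner_integral lborel (\<lambda>u. exp (s * of_real u) * of_real (exp (- (a * exp (2 * u)))))
           (Gamma (s / 2) / (2 * exp (s / 2 * of_real (ln a))))"
proof -
  define f where "f v = exp (s / 2 * of_real v) * complex_of_real (exp (- exp v))" for v
  have f: "has_bochner_integral lborel f (Gamma (s / 2))"
    unfolding f_def using s by (intro has_bochner_integral_Gamma_exp) simp
  have eq: "f (ln a + 2 * u) = exp (s / 2 * of_real (ln a)) * (exp (s * of_real u) * of_real (exp (- (a * exp (2 * u)))))" for u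
    using a by (simp add: f_def exp_add algebra_simps)
  have "has_bochner_integral lborel (\<lambda>u. f (ln a + 2 * u)) (Gamma (s / 2) / 2)"
    using f lborel_integrable_real_affine[of f 2 "ln a"] lborel_integral_real_affine[of 2 f "ln a"]
    by (simp add: has_bochner_integral_iff scaleR_conv_of_real field_simps)
  hence "has_bochner_integral lborel (\<lambda>u. exp (s / 2 * of_real (ln a)) * (exp (s * of_real u) * of_real (exp (- (a * exp (2 * u))))))
    (Gamma (s / 2) / 2)" unfolding eq .
  from has_bochner_integral_mult_right[OF this, of "inverse (exp (s / 2 * of_real (ln a)))"]
  show ?thesis by (simp add: field_simps)
qed

section \<open>The even theta kernel and its decay\<close>

lemma borel_measurable_half_theta [measurable]: "half_theta \<in> borel_measurable borel"
  unfolding half_theta_def by measurable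

lemma half_theta_nonneg: "t > 0 \<Longrightarrow> half_theta t \<ge> 0"
  using half_theta_sums[of t] unfolding sums_iff half_theta_def by (auto intro!: suminf_nonneg)

lemma half_theta_le:
  assumes "t \<ge> 1" shows "half_theta t \<le> 2 * exp (- pi * t)"
proof -
  define q where "q = exp (- pi * t)"
  have "q \<le> exp (- 1)" unfolding q_def using assms pi_gt3 mult_mono[of 1 pi 1 t] by simp
  also have "exp (- 1) \<le> (1 / 2 :: real)" using exp_ge_add_one_self[of 1] by (simp add: exp_minus field_simps)
  finally have q: "0 < q" "q \<le> 1 / 2" by (auto simp: q_def)
  have "half_theta t \<le> (\<Sum>n. q * q ^ n)"
    unfolding half_theta_def
  proof (rule suminf_le)
    show "exp (- pi * (real (Suc n))\<^sup>2 * t) \<le> q * q ^ n" for n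
      using half_theta_term_le[of t n] assms by (simp add: q_def)
  qed (use half_theta_sums[of t] assms q in \<open>auto simp: sums_iff intro!: summable_mult summable_geometric\<close>)
  also have "\<dots> = q * (1 / (1 - q))" using q by (subst suminf_mult) (auto simp: suminf_geometric summable_geometric)
  also have "\<dots> \<le> q * 2" using q by (intro mult_left_mono) (auto simp: field_simps)
  finally show ?thesis by (simp add: q_def)
qed

text \<open>The inversion t -> 1/t becomes the reflection u -> -u. The elementary term comes from
  the constant term 1 of theta and is the origin of the poles at s = 0 and s = 1.\<close>

lemma half_theta_exp_reflect:
  "half_theta (exp (2 * - u)) = exp u * half_theta (exp (2 * u)) + (exp u - 1) / 2"
proof -
  have "sqrt (exp (2 * u)) = exp u" by (simp add: exp_double)
  with half_theta_inversion[of "exp (2 * u)"]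
  have "1 + 2 * half_theta (exp (2 * u)) = (1 + 2 * half_theta (exp (2 * - u))) / exp u"
    by (simp add: exp_minus inverse_eq_divide)
  then show ?thesis by (simp add: field_simps)
qed

text \<open>On u \<ge> 0 this is the Mellin integrand of theta on t \<ge> 1, centred at s = 1/2.
  Taking |u| builds in the symmetry of \<xi>; the theta transformation enters when the kernel is
  compared with the Mellin integrand at u < 0.\<close>

definition theta_kernel :: "real \<Rightarrow> real" where
  "theta_kernel u = exp (\<bar>u\<bar> / 2) * half_theta (exp (2 * \<bar>u\<bar>))"

lemma borel_measurable_theta_kernel [measurable]: "theta_kernel \<in> borel_measurable borel"
  unfolding theta_kernel_def by measurable

lemma theta_kernel_minus [simp]: "theta_kernel (- u) = theta_kernel u"
  by (simp add: theta_kernel_def)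

lemma theta_kernel_nonneg: "theta_kernel u \<ge> 0"
  by (simp add: theta_kernel_def half_theta_nonneg)

lemma theta_kernel_le: "theta_kernel u \<le> 2 * exp (\<bar>u\<bar> / 2 - pi * exp (2 * \<bar>u\<bar>))"
proof -
  have "theta_kernel u \<le> exp (\<bar>u\<bar> / 2) * (2 * exp (- pi * exp (2 * \<bar>u\<bar>)))"
    unfolding theta_kernel_def by (intro mult_left_mono half_theta_le) auto
  then show ?thesis by (simp flip: exp_add add: algebra_simps)
qed

lemma integrable_theta_kernel_gaussian: "integrable lborel (\<lambda>u. theta_kernel u * exp (B * u\<^sup>2))"
proof -
  \<comment> \<open>The summand x reserves the integrable factor exp(-|u|). The term pi exp(2x)
    outgrows all others, so the exponent that remains is bounded above on x \<ge> 0.\<close>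
  define \<phi> where "\<phi> x = x / 2 + B * x\<^sup>2 + x - pi * exp (2 * x)" for x
  have "filterlim \<phi> at_bot at_top" unfolding \<phi>_def by real_asymp
  hence "\<forall>\<^sub>F x in at_top. \<phi> x \<le> 0" by (simp add: filterlim_at_bot)
  then obtain X where X: "\<And>x. x \<ge> X \<Longrightarrow> \<phi> x \<le> 0" by (auto simp: eventually_at_top_linorder)
  define C where "C = 2 * \<bar>X\<bar> + \<bar>B\<bar> * X\<^sup>2"
  have "C \<ge> 0" by (simp add: C_def)
  have C: "\<phi> x \<le> C" if "x \<ge> 0" for x
  proof (cases "x \<ge> X")
    case True then show ?thesis using X[OF True] \<open>C \<ge> 0\<close> by simp
  next
    case False
    hence "x \<le> \<bar>X\<bar>" by simp
    hence "x\<^sup>2 \<le> X\<^sup>2" using that by (simp add: abs_le_square_iff[symmetric])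
    hence "\<bar>B\<bar> * x\<^sup>2 \<le> \<bar>B\<bar> * X\<^sup>2" by (intro mult_left_mono) auto
    moreover have "B * x\<^sup>2 \<le> \<bar>B\<bar> * x\<^sup>2" by (intro mult_right_mono) auto
    moreover have "pi * exp (2 * x) \<ge> 0" by simp
    moreover have "x / 2 + x \<le> 2 * \<bar>X\<bar>" using \<open>x \<le> \<bar>X\<bar>\<close> that by simp
    ultimately show ?thesis unfolding \<phi>_def C_def by linarith
  qed
  show ?thesis
  proof (rule Bochner_Integration.integrable_bound)
    show "integrable lborel (\<lambda>u::real. 2 * exp C * exp (- (1 * \<bar>u\<bar>)))" by (intro integrable_mult_right integrable_exp_neg_abs) auto
    show "AE u in lborel. norm (theta_kernel u * exp (B * u\<^sup>2)) \<le> norm (2 * exp C * exp (- (1 * \<bar>u\<bar>)))"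
    proof (rule AE_I2)
      fix u :: real
      have "theta_kernel u * exp (B * u\<^sup>2) \<le> 2 * exp (\<bar>u\<bar> / 2 - pi * exp (2 * \<bar>u\<bar>)) * exp (B * u\<^sup>2)"
        by (intro mult_right_mono theta_kernel_le) auto
      also have "\<dots> = 2 * exp (\<phi> \<bar>u\<bar>) * exp (- (1 * \<bar>u\<bar>))" by (simp add: \<phi>_def flip: exp_add)
      also have "\<dots> \<le> 2 * exp C * exp (- (1 * \<bar>u\<bar>))" using C[of "\<bar>u\<bar>"] by simp
      finally show "norm (theta_kernel u * exp (B * u\<^sup>2)) \<le> norm (2 * exp C * exp (- (1 * \<bar>u\<bar>)))"
        using theta_kernel_nonneg[of u] by (simp add: abs_mult)
    qed
  qed measurable
qed

lemma integrable_theta_kernel_exp: "integrable lborel (\<lambda>u. theta_kernel u * exp (r * \<bar>u\<bar>))"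
proof (rule Bochner_Integration.integrable_bound)
  show "integrable lborel (\<lambda>u. exp (r\<^sup>2) * (theta_kernel u * exp (1 * u\<^sup>2)))"
    by (intro integrable_mult_right integrable_theta_kernel_gaussian)
  show "AE u in lborel. norm (theta_kernel u * exp (r * \<bar>u\<bar>)) \<le> norm (exp (r\<^sup>2) * (theta_kernel u * exp (1 * u\<^sup>2)))"
  proof (rule AE_I2)
    fix u :: real
    have "0 \<le> (r - \<bar>u\<bar>)\<^sup>2 + r\<^sup>2 + u\<^sup>2" by simp
    hence "r * \<bar>u\<bar> \<le> r\<^sup>2 + u\<^sup>2" by (simp add: power2_eq_square algebra_simps)
    hence "theta_kernel u * exp (r * \<bar>u\<bar>) \<le> theta_kernel u * exp (r\<^sup>2 + u\<^sup>2)" by (intro mult_left_mono theta_kernel_nonneg) auto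
    then show "norm (theta_kernel u * exp (r * \<bar>u\<bar>)) \<le> norm (exp (r\<^sup>2) * (theta_kernel u * exp (1 * u\<^sup>2)))"
      using theta_kernel_nonneg[of u] by (simp add: abs_mult exp_add algebra_simps)
  qed
qed measurable

section \<open>The zeta and xi functions\<close>

lemma norm_integral_le:
  fixes f :: "'a \<Rightarrow> 'b::{banach,second_countable_topology}"
  assumes "integrable M f" "integrable M g" "\<And>x. norm (f x) \<le> g x"
  shows "norm (integral\<^sup>L M f) \<le> integral\<^sup>L M g"
  by (rule order_trans[OF integral_norm_bound integral_mono]) (use assms in auto)

lemma Gamma_nonzero_Re_pos:
  assumes "Re z > 0" shows "Gamma z \<noteq> 0"
proof (rule Gamma_nonzero, rule notI)
  assume "z \<in> \<int>\<^sub>\<le>\<^sub>0"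
  then obtain n where "z = of_int n" "n \<le> 0" by (rule nonpos_Ints_cases)
  with assms show False by simp
qed

section \<open>The centred xi function as an even power series\<close>

definition theta_moment :: "nat \<Rightarrow> real" where
  "theta_moment k = (LBINT u. theta_kernel u * u ^ k / fact k)"

text \<open>This is \<xi>(1/2 + z), as shown later: the factor s (s - 1) becomes z^2 - 1/4, and the
  constant 1/2 is what that factor makes of the pole terms (1/(s - 1) - 1/s)/2.\<close>

definition xi_centered :: "complex \<Rightarrow> complex" where
  "xi_centered z = 1 / 2 + (z\<^sup>2 - 1 / 4) * (LBINT u. of_real (theta_kernel u) * exp (z * of_real u))"

lemma theta_moment_odd: "odd k \<Longrightarrow> theta_moment k = 0"
proof -
  assume k: "odd k"
  have "theta_moment k = \<bar>-1\<bar> *\<^sub>R (LBINT u. theta_kernel (0 + -1 * u) * (0 + -1 * u) ^ k / fact k)"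
    unfolding theta_moment_def by (rule lborel_integral_real_affine) simp
  also have "\<dots> = (LBINT u. - (theta_kernel u * u ^ k / fact k))"
    using k by (simp add: power_minus_odd)
  also have "\<dots> = - theta_moment k" by (simp add: theta_moment_def)
  finally show ?thesis by simp
qed

lemma theta_laplace_sums:
  fixes z :: complex
  shows "(\<lambda>k. of_real (theta_moment (2 * k)) * (z\<^sup>2) ^ k) sums
     (LBINT u. of_real (theta_kernel u) * exp (z * of_real u))"
proof -
  have "(\<lambda>k. of_real (theta_moment k) * z ^ k) sums
     (LBINT u. of_real (theta_kernel u) * exp (z * of_real u))"
    unfolding theta_moment_def
    by (rule laplace_power_series(3)[where r = "norm z + 1"])
       (auto intro!: integrable_theta_kernel_exp add_nonneg_pos)
  moreover have "of_real (theta_moment n) * z ^ n = 0" if "n \<notin> range (\<lambda>k. 2 * k)" for n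
  proof -
    have "odd n" using that by (auto elim!: evenE)
    then show ?thesis by (simp add: theta_moment_odd)
  qed
  ultimately have "(\<lambda>k. of_real (theta_moment (2 * k)) * z ^ (2 * k)) sums
     (LBINT u. of_real (theta_kernel u) * exp (z * of_real u))"
    by (subst sums_mono_reindex[where g = "\<lambda>k. 2 * k"]) (auto simp: strict_mono_def)
  then show ?thesis by (simp add: power_mult)
qed

text \<open>Taylor coefficients of \<Xi> in the variable z^2. Multiplication by z^2 shifts the even
  moments by one index, and the constant 1/2 fills the vacated index 0.\<close>

definition xi_coeff :: "nat \<Rightarrow> real" where
  "xi_coeff k = (case k of 0 \<Rightarrow> 1 / 2 | Suc j \<Rightarrow> theta_moment (2 * j)) - theta_moment (2 * k) / 4"

lemma xi_centered_sums: "(\<lambda>k. of_real (xi_coeff k) * (z\<^sup>2) ^ k) sums xi_centered z"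
proof -
  define E where "E = (LBINT u. of_real (theta_kernel u) * exp (z * of_real u))"
  have E: "(\<lambda>k. of_real (theta_moment (2 * k)) * (z\<^sup>2) ^ k) sums E"
    unfolding E_def by (rule theta_laplace_sums)
  define a where "a k = (case k of 0 \<Rightarrow> 1 / 2 | Suc j \<Rightarrow> of_real (theta_moment (2 * j)) * (z\<^sup>2) ^ k)" for k
  have "(\<lambda>k. z\<^sup>2 * (of_real (theta_moment (2 * k)) * (z\<^sup>2) ^ k)) sums (z\<^sup>2 * E)" by (intro sums_mult E)
  hence "(\<lambda>k. a (Suc k)) sums (z\<^sup>2 * E)" by (simp add: a_def algebra_simps)
  hence "a sums (z\<^sup>2 * E + a 0)" by (rule sums_Suc)
  hence "(\<lambda>k. a k - 1 / 4 * (of_real (theta_moment (2 * k)) * (z\<^sup>2) ^ k)) sums (z\<^sup>2 * E + a 0 - 1 / 4 * E)"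
    by (intro sums_diff sums_mult E)
  moreover have "a k - 1 / 4 * (of_real (theta_moment (2 * k)) * (z\<^sup>2) ^ k) = of_real (xi_coeff k) * (z\<^sup>2) ^ k" for k
    by (simp add: a_def xi_coeff_def algebra_simps split: nat.splits)
  moreover have "z\<^sup>2 * E + a 0 - 1 / 4 * E = xi_centered z"
    by (simp add: a_def xi_centered_def E_def algebra_simps)
  ultimately show ?thesis by simp
qed

lemma holomorphic_on_UNIV_power_series:
  fixes f :: "complex \<Rightarrow> complex"
  assumes "\<And>z. (\<lambda>n. a n * z ^ n) sums f z"
  shows "f holomorphic_on UNIV"
  unfolding holomorphic_on_def
proof (intro ballI)
  fix z :: complex
  have "f holomorphic_on ball 0 (norm z + 1)"
    by (rule power_series_holomorphic[where a = a]) (use assms in auto)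
  moreover have "z \<in> ball 0 (norm z + 1)" by simp
  ultimately show "f field_differentiable at z within UNIV"
    by (metis holomorphic_on_imp_differentiable_at open_ball)
qed

text \<open>Substituting \<open>csqrt w\<close> turns the even series into a power series in w; the
  branch cut is harmless since the series sees only the square.\<close>

lemma holomorphic_xi_centered: "xi_centered holomorphic_on UNIV"
proof -
  define F where "F w = xi_centered (csqrt w)" for w
  have "(\<lambda>k. of_real (xi_coeff k) * w ^ k) sums F w" for w
    using xi_centered_sums[of "csqrt w"] by (simp add: F_def)
  hence "F holomorphic_on UNIV" by (rule holomorphic_on_UNIV_power_series)
  moreover have "xi_centered z = F (z\<^sup>2)" for z
    using sums_unique2[OF xi_centered_sums[of z]] xi_centered_sums[of "csqrt (z\<^sup>2)"] by (simp add: F_def)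
  ultimately have "(\<lambda>z. F (z\<^sup>2)) holomorphic_on UNIV"
    by (intro holomorphic_on_compose_gen[where g = F and f = "\<lambda>z. z\<^sup>2", unfolded o_def]) (auto intro!: holomorphic_intros)
  moreover have "xi_centered = (\<lambda>z. F (z\<^sup>2))" using \<open>\<And>z. xi_centered z = F (z\<^sup>2)\<close> by blast
  ultimately show ?thesis by simp
qed

text \<open>The n-th term of theta, counted from 1, contributes Gamma(s/2) / (2 pi^(s/2) n^s). The
  norm of its integrand is the integrand for the real number \<sigma> = Re s, so the integrals of
  the norms are a multiple of the convergent series of n^(-\<sigma>), and sum and integral may be
  exchanged.\<close>

lemma mellin_theta:
  assumes s: "Re s > 1"
  shows "complex_integrable lborel (\<lambda>u. of_real (half_theta (exp (2 * u))) * exp (s * of_real u))"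
    and "(\<lambda>n. 1 / of_nat (Suc n) powr s) sums
      (2 * of_real pi powr (s / 2) / Gamma (s / 2) *
        (LBINT u. of_real (half_theta (exp (2 * u))) * exp (s * of_real u)))"
proof -
  define a where "a n = pi * (real (Suc n))\<^sup>2" for n
  have a: "a n > 0" for n by (simp add: a_def)
  define g where "g s n u = exp (s * of_real u) * complex_of_real (exp (- (a n * exp (2 * u))))" for s n u
  have gI: "has_bochner_integral lborel (g s n) (Gamma (s / 2) / (2 * exp (s / 2 * of_real (ln (a n)))))" if "Re s > 0" for s n
    unfolding g_def using that a by (rule has_bochner_integral_Gamma_exp_scaled)
  have lna: "ln (a n) = ln pi + 2 * ln (real (Suc n))" for n
    by (simp add: a_def ln_mult ln_realpow)
  have ex: "exp (s / 2 * of_real (ln (a n))) = of_real pi powr (s / 2) * of_nat (Suc n) powr s" for s :: complex and n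
  proof -
    have "s / 2 * of_real (ln (a n)) = s / 2 * Ln (of_real pi) + s * Ln (of_nat (Suc n))"
      unfolding lna by (simp add: algebra_simps Ln_of_real Ln_of_nat del: of_nat_Suc)
    then have "exp (s / 2 * of_real (ln (a n))) = exp (s / 2 * Ln (of_real pi)) * exp (s * Ln (of_nat (Suc n)))"
      by (simp only: exp_add)
    then show ?thesis by (simp add: powr_def del: of_nat_Suc)
  qed
  have Ga: "Gamma (s / 2) \<noteq> 0"
    using s by (intro Gamma_nonzero_Re_pos) auto
  have pi0: "complex_of_real pi powr (s / 2) \<noteq> 0" by simp
  have norm_g: "norm (g s n u) = Re (g (of_real (Re s)) n u)" for n u
    by (simp add: g_def norm_mult Re_exp)
  define \<sigma> where "\<sigma> = Re s"
  have \<sigma>: "\<sigma> > 1" using s by (simp add: \<sigma>_def)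
  have int_norm: "(LBINT u. norm (g s n u)) = Re (Gamma (of_real (\<sigma> / 2))) / (2 * pi powr (\<sigma> / 2)) * real (Suc n) powr (- \<sigma>)" for n
  proof -
    have "has_bochner_integral lborel (g (of_real \<sigma>) n) (Gamma (of_real \<sigma> / 2) / (2 * exp (of_real \<sigma> / 2 * of_real (ln (a n)))))"
      using \<sigma> by (intro gI) auto
    hence "(LBINT u. Re (g (of_real \<sigma>) n u)) = Re (Gamma (of_real \<sigma> / 2) / (2 * exp (of_real \<sigma> / 2 * of_real (ln (a n)))))"
      by (simp add: has_bochner_integral_iff)
    also have "of_real \<sigma> / 2 * of_real (ln (a n)) = complex_of_real (\<sigma> / 2 * ln (a n))" by simp
    also have "2 * exp (complex_of_real (\<sigma> / 2 * ln (a n))) = of_real (2 * (pi powr (\<sigma> / 2) * real (Suc n) powr \<sigma>))"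
      unfolding exp_of_real by (simp add: lna powr_def algebra_simps flip: exp_add)
    also have "Re (Gamma (of_real \<sigma> / 2) / of_real (2 * (pi powr (\<sigma> / 2) * real (Suc n) powr \<sigma>)))
       = Re (Gamma (of_real (\<sigma> / 2))) / (2 * pi powr (\<sigma> / 2)) * real (Suc n) powr (- \<sigma>)"
      by (simp only: Re_divide_of_real) (simp add: powr_minus field_simps)
    finally show ?thesis by (simp add: norm_g \<sigma>_def)
  qed
  have S: "summable (\<lambda>n. LBINT u. norm (g s n u))"
    unfolding int_norm
    using \<sigma> summable_real_powr_iff[of "- \<sigma>"] by (intro summable_mult) (subst summable_Suc_iff, simp)
  have psi: "(\<lambda>n. exp (- (a n * exp (2 * u)))) sums half_theta (exp (2 * u))" for u
    using half_theta_sums[of "exp (2 * u)"] by (simp add: a_def)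
  have norm_g': "norm (g s n u) = exp (\<sigma> * u) * exp (- (a n * exp (2 * u)))" for n u
    by (simp add: g_def norm_mult \<sigma>_def)
  have AE1: "AE u in lborel. summable (\<lambda>n. norm (g s n u))"
    unfolding norm_g' using psi by (intro AE_I2 summable_mult) (auto simp: sums_iff)
  have gint: "complex_integrable lborel (g s n)" for n
    using gI[of s n] s by (simp add: has_bochner_integral_iff)
  have gs: "(\<Sum>n. g s n u) = of_real (half_theta (exp (2 * u))) * exp (s * of_real u)" for u
  proof -
    have "(\<lambda>n. g s n u) sums (exp (s * of_real u) * of_real (half_theta (exp (2 * u))))"
      unfolding g_def by (intro sums_mult sums_of_real psi)
    then show ?thesis by (simp add: sums_iff mult.commute)
  qed
  show "complex_integrable lborel (\<lambda>u. of_real (half_theta (exp (2 * u))) * exp (s * of_real u))"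
    using integrable_suminf[OF gint AE1 S] by (simp add: gs)
  have "(\<lambda>n. Gamma (s / 2) / (2 * exp (s / 2 * of_real (ln (a n))))) sums
      (LBINT u. of_real (half_theta (exp (2 * u))) * exp (s * of_real u))"
  proof -
    have "(LBINT u. g s n u) = Gamma (s / 2) / (2 * exp (s / 2 * of_real (ln (a n))))" for n
      using gI[of s n] s by (simp add: has_bochner_integral_iff)
    with sums_integral[OF gint AE1 S] show ?thesis by (simp add: gs)
  qed
  from sums_mult[OF this, of "2 * of_real pi powr (s / 2) / Gamma (s / 2)"]
  show "(\<lambda>n. 1 / of_nat (Suc n) powr s) sums
      (2 * of_real pi powr (s / 2) / Gamma (s / 2) *
        (LBINT u. of_real (half_theta (exp (2 * u))) * exp (s * of_real u)))"
    unfolding ex using Ga pi0 by (simp add: field_simps del: of_nat_Suc)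
qed

text \<open>Riemann's argument: the part u < 0 is rewritten by the reflection formula. It becomes
  the theta kernel again, plus half the difference of exp((s - 1) u) and exp(s u), which integrate
  to 1/(s - 1) and 1/s; multiplying by s (s - 1) clears these poles.\<close>

lemma integral_half_theta_eq:
  assumes s: "Re s > 1"
  shows "(s * (s - 1)) * (LBINT u. of_real (half_theta (exp (2 * u))) * exp (s * of_real u)) = xi_centered (s - 1 / 2)"
proof -
  define z where "z = s - 1 / 2"
  define E where "E = (LBINT u. of_real (theta_kernel u) * exp (z * of_real u))"
  define h where "h c u = indicator {..<0} u *\<^sub>R exp (c * complex_of_real u)" for c u
  have h: "has_bochner_integral lborel (h c) (1 / c)" if "Re c > 0" for c
    unfolding h_def by (rule has_bochner_integral_exp_neg_half_line[OF that])
  have s0: "s \<noteq> 0" "s - 1 \<noteq> 0" using s by auto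
  have Eint: "complex_integrable lborel (\<lambda>u. of_real (theta_kernel u) * exp (z * of_real u))"
    by (rule laplace_power_series(2)[where r = "norm z + 1"])
       (auto intro!: integrable_theta_kernel_exp add_nonneg_pos)
  have E: "has_bochner_integral lborel (\<lambda>u. of_real (theta_kernel u) * exp (z * of_real u)) E"
    using Eint by (simp add: has_bochner_integral_iff E_def)
  have "has_bochner_integral lborel (\<lambda>u. of_real (theta_kernel u) * exp (z * of_real u) + 1 / 2 * (h (s - 1) u - h s u))
     (E + 1 / 2 * (1 / (s - 1) - 1 / s))"
    using s by (intro has_bochner_integral_add E has_bochner_integral_mult_right has_bochner_integral_diff h) auto
  moreover have "of_real (theta_kernel u) * exp (z * of_real u) + 1 / 2 * (h (s - 1) u - h s u)
     = of_real (half_theta (exp (2 * u))) * exp (s * of_real u)" for u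
  proof (cases "u < 0")
    case False
    have "s * of_real u = z * of_real u + of_real (u / 2)" by (simp add: z_def algebra_simps)
    then show ?thesis using False by (simp add: h_def theta_kernel_def exp_add flip: exp_of_real)
  next
    case True
    have e1: "exp (z * of_real u) * exp (of_real (- u / 2)) = exp (s * of_real u) * of_real (exp (- u))"
      by (simp add: z_def algebra_simps flip: exp_of_real exp_add)
    have e2: "exp ((s - 1) * of_real u) = exp (s * of_real u) * of_real (exp (- u))"
      by (simp add: algebra_simps flip: exp_of_real exp_add)
    have r: "half_theta (exp (2 * u)) = exp (- u) * half_theta (exp (2 * - u)) + (exp (- u) - 1) / 2"
      using half_theta_exp_reflect[of "- u"] by simp
    have "of_real (theta_kernel u) * exp (z * of_real u) = of_real (half_theta (exp (2 * - u))) * (exp (z * of_real u) * exp (of_real (- u / 2)))"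
      using True by (simp add: theta_kernel_def algebra_simps flip: exp_of_real)
    hence X: "of_real (theta_kernel u) * exp (z * of_real u) = of_real (half_theta (exp (2 * - u))) * (exp (s * of_real u) * of_real (exp (- u)))"
      by (simp only: e1)
    have h1: "h (s - 1) u = exp (s * of_real u) * of_real (exp (- u))"
      unfolding e2[symmetric] using True by (simp add: h_def)
    have h2: "h s u = exp (s * of_real u)" using True by (simp add: h_def)
    show ?thesis unfolding X h1 h2 r by (simp add: field_simps)
  qed
  ultimately have "(LBINT u. of_real (half_theta (exp (2 * u))) * exp (s * of_real u)) = E + 1 / 2 * (1 / (s - 1) - 1 / s)"
    by (simp add: has_bochner_integral_iff)
  moreover have "(s * (s - 1)) * (E + 1 / 2 * (1 / (s - 1) - 1 / s)) = 1 / 2 + (z\<^sup>2 - 1 / 4) * E"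
  proof -
    have "(s * (s - 1)) * (1 / 2 * (1 / (s - 1) - 1 / s)) = 1 / 2" using s0 by (simp add: field_simps)
    moreover have "s * (s - 1) = z\<^sup>2 - 1 / 4" by (simp add: z_def power2_eq_square algebra_simps)
    ultimately show ?thesis by (simp add: distrib_left)
  qed
  ultimately show ?thesis by (simp add: xi_centered_def E_def z_def)
qed

text \<open>The formula for \<open>\<xi>\<close> solved for \<open>\<zeta>\<close>; writing \<open>1 / \<Gamma>(s/2)\<close> as \<open>(s/2) rGamma (s/2 + 1)\<close>
  cancels the factor \<open>s\<close>.\<close>
definition zeta_continuation :: "complex \<Rightarrow> complex" where
  "zeta_continuation s = of_real pi powr (s / 2) * xi_centered (s - 1 / 2) * rGamma (s / 2 + 1) / (s - 1)"

lemma holomorphic_xi_centered_compose [holomorphic_intros]: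
  "f holomorphic_on A \<Longrightarrow> (\<lambda>z. xi_centered (f z)) holomorphic_on A"
  using holomorphic_on_compose_gen[OF _ holomorphic_xi_centered, of f A] by (simp add: o_def)

lemma zeta_continuation_sums:
  assumes s: "Re s > 1"
  shows "(\<lambda>n. 1 / of_nat (Suc n) powr s) sums zeta_continuation s"
proof -
  define I where "I = (LBINT u. of_real (half_theta (exp (2 * u))) * exp (s * of_real u))"
  have s0: "s \<noteq> 0" "s - 1 \<noteq> 0" using s by auto
  have Ga: "Gamma (s / 2) \<noteq> 0"
    using s by (intro Gamma_nonzero_Re_pos) auto
  have "s / 2 * rGamma (s / 2 + 1) = inverse (Gamma (s / 2))"
    using rGamma_plus1[of "s / 2"] by (simp add: rGamma_inverse_Gamma)
  hence rG: "rGamma (s / 2 + 1) = 2 / (s * Gamma (s / 2))" using s0 Ga by (simp add: field_simps)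
  have "zeta_continuation s = 2 * of_real pi powr (s / 2) / Gamma (s / 2) * I"
    unfolding zeta_continuation_def integral_half_theta_eq[OF s, symmetric] rG I_def[symmetric]
    using s0 Ga by (simp add: field_simps)
  with mellin_theta(2)[OF s] show ?thesis by (simp add: I_def)
qed

lemma holomorphic_zeta_continuation: "zeta_continuation holomorphic_on - {1}"
  unfolding zeta_continuation_def by (intro holomorphic_intros) auto

text \<open>The definite description is met by \<open>zeta_continuation\<close> with the value at 1
  reset to 0. Uniqueness is analytic continuation from Re s > 1 to the punctured plane, which is
  connected.\<close>

lemma riemann_zeta_eq: "riemann_zeta s = (if s = 1 then 0 else zeta_continuation s)"
proof -
  define Z where "Z s = (if s = 1 then 0 else zeta_continuation s)" for s
  have "riemann_zeta = Z"
    unfolding riemann_zeta_def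
  proof (rule the_equality)
    have "Z holomorphic_on - {1}"
      by (rule holomorphic_transform[OF holomorphic_zeta_continuation]) (auto simp: Z_def)
    moreover have "(\<lambda>n. 1 / of_nat (Suc n) powr s) sums Z s" if "Re s > 1" for s
      using zeta_continuation_sums[OF that] that by (auto simp: Z_def)
    ultimately show Z: "Z holomorphic_on - {1} \<and> (\<forall>s. Re s > 1 \<longrightarrow> (\<lambda>n. 1 / of_nat (Suc n) powr s) sums Z s) \<and> Z 1 = 0"
      by (auto simp: Z_def)
    fix f :: "complex \<Rightarrow> complex"
    assume f: "f holomorphic_on - {1} \<and> (\<forall>s. Re s > 1 \<longrightarrow> (\<lambda>n. 1 / of_nat (Suc n) powr s) sums f s) \<and> f 1 = 0"
    show "f = Z"
    proof
      fix s
      show "f s = Z s"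
      proof (cases "s = 1")
        case False
        have "f s = Z s"
        proof (rule analytic_continuation_open[where s = "{s. Re s > 1}" and s' = "- {1}" and f = f and g = Z])
          show "open {s. 1 < Re s}" by (simp add: open_halfspace_Re_gt)
          have "(2::complex) \<in> {s. 1 < Re s}" by simp
          then show "{s. 1 < Re s} \<noteq> {}" by blast
          show "connected (- {1::complex})" by (intro connected_punctured_universe) simp
          show "f z = Z z" if "z \<in> {s. 1 < Re s}" for z
            using f Z that by (auto intro: sums_unique2)
        qed (use f Z False in auto)
        then show ?thesis .
      qed (use f Z in auto)
    qed
  qed
  then have "riemann_zeta s = Z s" by simp
  then show ?thesis by (simp only: Z_def)
qed

text \<open>\<open>remove_sings\<close> looks at punctured neighbourhoods. The explicit product
  agrees with the entire function wherever s \<noteq> 1 and \<open>rGamma (s / 2)\<close> is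
  nonzero; the exceptional points are isolated, so the limit at every s is the value of the entire
  function.\<close>

theorem riemann_xi_eq: "riemann_xi s = xi_centered (s - 1 / 2)"
  unfolding riemann_xi_def
proof (rule remove_sings_eqI)
  define \<phi> where "\<phi> s = 1/2 * s * (s - 1) * of_real pi powr (- s / 2) * Gamma (s / 2) * riemann_zeta s" for s
  have hol: "(\<lambda>s. rGamma (s / 2) * (s - 1)) holomorphic_on UNIV" by (intro holomorphic_intros) auto
  \<comment> \<open>The point 2 witnesses that this holomorphic function is not identically zero, so
    its zeros are isolated.\<close>
  have ev: "\<forall>\<^sub>F s in at s. rGamma (s / 2) * (s - 1) \<noteq> 0 \<and> s \<in> UNIV"
    by (rule non_zero_neighbour_alt[OF hol, where \<beta> = 2]) (auto simp: rGamma_eq_zero_iff)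
  have "\<forall>\<^sub>F s in at s. xi_centered (s - 1 / 2) = \<phi> s"
    using ev
  proof eventually_elim
    case (elim s)
    hence s: "s \<noteq> 1" and G: "rGamma (s / 2) \<noteq> 0" by auto
    have s0: "s \<noteq> 0" using G by auto
    have rG: "rGamma (s / 2 + 1) = 2 / s * rGamma (s / 2)"
      using rGamma_plus1[of "s / 2"] s0 by (simp add: field_simps)
    have Gr: "Gamma (s / 2) * rGamma (s / 2) = 1"
      using G by (simp add: rGamma_inverse_Gamma)
    have pp: "of_real pi powr (- s / 2) * of_real pi powr (s / 2) = (1::complex)"
      by (simp flip: powr_add)
    have "\<phi> s = (of_real pi powr (- s / 2) * of_real pi powr (s / 2)) * (Gamma (s / 2) * rGamma (s / 2)) * xi_centered (s - 1 / 2)"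
      using s s0 unfolding \<phi>_def riemann_zeta_eq zeta_continuation_def rG by (simp add: field_simps)
    then show ?case by (simp only: pp Gr mult_1_left)
  qed
  moreover have "(\<lambda>s. xi_centered (s - 1 / 2)) \<midarrow>s\<rightarrow> xi_centered (s - 1 / 2)"
  proof -
    have "(\<lambda>s. xi_centered (s - 1 / 2)) holomorphic_on UNIV" by (intro holomorphic_intros)
    hence "continuous_on UNIV (\<lambda>s. xi_centered (s - 1 / 2))" by (rule holomorphic_on_imp_continuous_on)
    then show ?thesis by (simp add: continuous_on_eq_continuous_at isCont_def)
  qed
  ultimately have "\<phi> \<midarrow>s\<rightarrow> xi_centered (s - 1 / 2)" by (rule Lim_transform_eventually[rotated])
  then show "(\<lambda>s. 1/2 * s * (s - 1) * of_real pi powr (- s / 2) * Gamma (s / 2) * riemann_zeta s) \<midarrow>s\<rightarrow> xi_centered (s - 1 / 2)"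
    by (simp add: \<phi>_def[abs_def])
qed

section \<open>Positivity and growth of the centred xi function\<close>

definition theta_laplace :: "real \<Rightarrow> real" where
  "theta_laplace \<tau> = (LBINT u. theta_kernel u * exp (\<tau> * u))"

lemma integrable_theta_laplace: "integrable lborel (\<lambda>u. theta_kernel u * exp (\<tau> * u))"
proof (rule Bochner_Integration.integrable_bound[OF integrable_theta_kernel_exp[of "\<bar>\<tau>\<bar>"]])
  show "AE u in lborel. norm (theta_kernel u * exp (\<tau> * u)) \<le> norm (theta_kernel u * exp (\<bar>\<tau>\<bar> * \<bar>u\<bar>))"
  proof (rule AE_I2)
    fix u
    have "\<tau> * u \<le> \<bar>\<tau>\<bar> * \<bar>u\<bar>" unfolding abs_mult[symmetric] by (rule abs_ge_self)
    then show "norm (theta_kernel u * exp (\<tau> * u)) \<le> norm (theta_kernel u * exp (\<bar>\<tau>\<bar> * \<bar>u\<bar>))"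
      by (auto simp: abs_mult intro!: mult_left_mono)
  qed
qed measurable

lemma xi_centered_of_real: "xi_centered (of_real \<tau>) = of_real (1 / 2 + (\<tau>\<^sup>2 - 1 / 4) * theta_laplace \<tau>)"
proof -
  have "(LBINT u. of_real (theta_kernel u) * exp (of_real \<tau> * of_real u))
     = (LBINT u. complex_of_real (theta_kernel u * exp (\<tau> * u)))"
    by (simp flip: exp_of_real)
  also have "\<dots> = of_real (theta_laplace \<tau>)" unfolding theta_laplace_def by (rule integral_complex_of_real)
  finally show ?thesis by (simp add: xi_centered_def)
qed

text \<open>The tangent bound exp(\<tau> u) \<ge> 1 + \<tau> u is integrated against the kernel,
  whose first moment vanishes by evenness.\<close>

lemma theta_laplace_ge_0: "theta_laplace \<tau> \<ge> theta_laplace 0"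
proof -
  have i1: "integrable lborel theta_kernel" using integrable_theta_laplace[of 0] by simp
  have i2: "integrable lborel (\<lambda>u. theta_kernel u * u ^ 1 / fact 1)"
    by (rule laplace_power_series(1)[where r = 1 and z = 0]) (use integrable_theta_kernel_exp[of 1] in auto)
  have "theta_laplace 0 = (LBINT u. theta_kernel u) + \<tau> * theta_moment 1"
    by (simp add: theta_laplace_def theta_moment_odd)
  also have "\<dots> = (LBINT u. theta_kernel u + \<tau> * (theta_kernel u * u ^ 1 / fact 1))"
    unfolding theta_moment_def using i1 i2 by (subst Bochner_Integration.integral_add) auto
  also have "\<dots> \<le> theta_laplace \<tau>"
    unfolding theta_laplace_def
  proof (rule integral_mono)
    show "theta_kernel u + \<tau> * (theta_kernel u * u ^ 1 / fact 1) \<le> theta_kernel u * exp (\<tau> * u)" for u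
    proof -
      have "theta_kernel u * (1 + \<tau> * u) \<le> theta_kernel u * exp (\<tau> * u)"
        by (intro mult_left_mono theta_kernel_nonneg) (simp add: add.commute)
      then show ?thesis by (simp add: algebra_simps)
    qed
  qed (use i1 i2 integrable_theta_laplace in auto)
  finally show ?thesis .
qed

lemma integral_pos_lborel:
  fixes f :: "real \<Rightarrow> real"
  assumes f: "integrable lborel f" and pos: "\<And>x. f x > 0"
  shows "(LBINT x. f x) > 0"
proof -
  have "(LBINT x. f x) \<noteq> 0"
  proof
    assume "(LBINT x. f x) = 0"
    hence "AE x in lborel. f x = 0"
      using integral_nonneg_eq_0_iff_AE[OF f] pos by (simp add: less_imp_le)
    moreover have "{x \<in> space lborel. f x \<noteq> 0} = UNIV"
    proof -
      have "f x \<noteq> 0" for x using pos[of x] by simp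
      then show ?thesis by simp
    qed
    ultimately have "emeasure lborel (UNIV :: real set) = 0"
      using AE_iff_measurable[of UNIV lborel "\<lambda>x. f x = 0"] by simp
    then show False by simp
  qed
  moreover have "(LBINT x. f x) \<ge> 0"
    using pos by (intro Bochner_Integration.integral_nonneg) (simp add: less_imp_le)
  ultimately show ?thesis by simp
qed

lemma theta_laplace_0_pos: "theta_laplace 0 > 0"
proof -
  have i1: "integrable lborel theta_kernel" using integrable_theta_laplace[of 0] by simp
  have pos: "theta_kernel u > 0" for u
  proof -
    have "0 < (\<Sum>n<1. exp (- pi * (real (Suc n))\<^sup>2 * exp (2 * \<bar>u\<bar>)))" by simp
    also have "\<dots> \<le> half_theta (exp (2 * \<bar>u\<bar>))"
      unfolding half_theta_def using half_theta_sums[of "exp (2 * \<bar>u\<bar>)"] by (intro sum_le_suminf) (auto simp: sums_iff)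
    finally show ?thesis unfolding theta_kernel_def by simp
  qed
  then show ?thesis using integral_pos_lborel[OF i1] by (simp add: theta_laplace_def)
qed

text \<open>Between -1/2 and 1/2 the factor \<tau>^2 - 1/4 is negative, so positivity of \<Xi> there
  calls for an upper bound of the integral. The value 2 exp(-pi), below 1, suffices: the factor has
  modulus at most 1/4 and is set against 1/2.\<close>

lemma theta_laplace_near_0:
  assumes "\<bar>\<tau>\<bar> \<le> 1 / 2" shows "theta_laplace \<tau> \<le> 2 * exp (- pi)"
proof -
  have "theta_laplace \<tau> \<le> (LBINT u. 2 * exp (- pi) * exp (- (2 * \<bar>u\<bar>)))"
    unfolding theta_laplace_def
  proof (rule integral_mono)
    show "integrable lborel (\<lambda>u::real. 2 * exp (- pi) * exp (- (2 * \<bar>u\<bar>)))"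
      by (intro integrable_mult_right integrable_exp_neg_abs) auto
    fix u :: real
    have "\<tau> * u \<le> \<bar>\<tau>\<bar> * \<bar>u\<bar>" unfolding abs_mult[symmetric] by (rule abs_ge_self)
    also have "\<dots> \<le> 1 / 2 * \<bar>u\<bar>" using assms by (intro mult_right_mono) auto
    finally have 1: "\<tau> * u \<le> \<bar>u\<bar> / 2" by simp
    have 2: "pi * exp (2 * \<bar>u\<bar>) \<ge> pi * (1 + 2 * \<bar>u\<bar>)" by (intro mult_left_mono) auto
    have 3: "pi * \<bar>u\<bar> \<ge> 3 * \<bar>u\<bar>" using pi_gt3 by (intro mult_right_mono) auto
    have "theta_kernel u * exp (\<tau> * u) \<le> 2 * exp (\<bar>u\<bar> / 2 - pi * exp (2 * \<bar>u\<bar>)) * exp (\<bar>u\<bar> / 2)"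
      using 1 by (intro mult_mono theta_kernel_le) auto
    also have "\<dots> = 2 * exp (\<bar>u\<bar> - pi * exp (2 * \<bar>u\<bar>))" by (simp flip: exp_add)
    also have "\<dots> \<le> 2 * exp (- pi + - (2 * \<bar>u\<bar>))"
    proof -
      have "\<bar>u\<bar> - pi * exp (2 * \<bar>u\<bar>) \<le> - pi + - (2 * \<bar>u\<bar>)" using 2 3 by (simp add: algebra_simps)
      then show ?thesis by simp
    qed
    finally show "theta_kernel u * exp (\<tau> * u) \<le> 2 * exp (- pi) * exp (- (2 * \<bar>u\<bar>))" by (simp only: exp_add mult.assoc)
  qed (rule integrable_theta_laplace)
  also have "\<dots> = 2 * exp (- pi)" using integral_exp_neg_abs[of 2] by simp
  finally show ?thesis .
qed

text \<open>One quantitative bound delivers positivity on the real axis, integrability of the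
  reciprocal and, by its quadratic growth, that \<Xi> is not constant.\<close>

theorem xi_centered_of_real_ge:
  obtains c where "c > 0" "\<And>\<tau>. Re (xi_centered (of_real \<tau>)) \<ge> c * (1 + \<tau>\<^sup>2)"
proof -
  define e where "e = theta_laplace 0"
  have e: "e > 0" unfolding e_def by (rule theta_laplace_0_pos)
  have ep: "exp (- pi) < 1 / 2"
  proof -
    have "exp pi \<ge> 1 + pi" by (rule exp_ge_add_one_self)
    hence "exp pi > 2" using pi_gt3 by linarith
    then show ?thesis by (simp add: exp_minus field_simps)
  qed
  \<comment> \<open>For |\<tau>| \<le> 1/2 the function is at least 1/4 while 1 + \<tau>^2 is at
    most 5/4, whence 1/5. Outside, the estimate uses c \<le> e and 5c/4 \<le> 1/2.\<close>
  define c where "c = min (1 / 5) (e / 5)"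
  show ?thesis
  proof (rule that)
    show "c > 0" using e by (simp add: c_def)
    fix \<tau> :: real
    have ge: "Re (xi_centered (of_real \<tau>)) = 1 / 2 + (\<tau>\<^sup>2 - 1 / 4) * theta_laplace \<tau>"
      by (simp add: xi_centered_of_real)
    show "Re (xi_centered (of_real \<tau>)) \<ge> c * (1 + \<tau>\<^sup>2)"
    proof (cases "\<bar>\<tau>\<bar> \<le> 1 / 2")
      case True
      hence t2: "\<tau>\<^sup>2 \<le> 1 / 4" using power_mono[of "\<bar>\<tau>\<bar>" "1/2" 2] by (simp add: power2_eq_square)
      have "(1 / 4 - \<tau>\<^sup>2) * theta_laplace \<tau> \<le> (1 / 4) * 1"
        using t2 theta_laplace_near_0[OF True] ep e theta_laplace_ge_0[of \<tau>] unfolding e_def by (intro mult_mono) auto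
      moreover have "c * (1 + \<tau>\<^sup>2) \<le> 1 / 5 * (1 + 1 / 4)" using t2 e by (intro mult_mono) (auto simp: c_def)
      ultimately show ?thesis unfolding ge by (simp add: algebra_simps)
    next
      case False
      hence t2: "\<tau>\<^sup>2 \<ge> 1 / 4" using power_mono[of "1/2" "\<bar>\<tau>\<bar>" 2] by (simp add: power2_eq_square)
      have "(\<tau>\<^sup>2 - 1 / 4) * theta_laplace \<tau> \<ge> (\<tau>\<^sup>2 - 1 / 4) * e"
        using t2 theta_laplace_ge_0[of \<tau>] by (intro mult_left_mono) (auto simp: e_def)
      moreover have "c * (1 + \<tau>\<^sup>2) = c * (\<tau>\<^sup>2 - 1 / 4) + c * (5 / 4)" by (simp add: algebra_simps)
      moreover have "c * (\<tau>\<^sup>2 - 1 / 4) \<le> e * (\<tau>\<^sup>2 - 1 / 4)" using t2 e by (intro mult_right_mono) (auto simp: c_def min_def)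
      moreover have "c * (5 / 4) \<le> 1 / 2" by (simp add: c_def min_def)
      ultimately show ?thesis unfolding ge by (simp add: algebra_simps)
    qed
  qed
qed

text \<open>The inequality |z| |u| \<le> \<delta> |z|^2 + u^2/(4 \<delta>) separates z from u, and
  the kernel is integrable against every Gaussian exp(B u^2). Half of \<epsilon> goes into this
  step, the other half absorbs the factor z^2 - 1/4.\<close>

theorem xi_centered_growth:
  assumes \<epsilon>: "\<epsilon> > 0"
  obtains C where "\<And>z. norm (xi_centered z) \<le> C * exp (\<epsilon> * (norm z)\<^sup>2)"
proof -
  define \<delta> where "\<delta> = \<epsilon> / 2"
  have \<delta>: "\<delta> > 0" using \<epsilon> by (simp add: \<delta>_def)
  define I where "I = (LBINT u. theta_kernel u * exp (1 / (4 * \<delta>) * u\<^sup>2))"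
  have I0: "I \<ge> 0" unfolding I_def by (intro Bochner_Integration.integral_nonneg) (simp add: theta_kernel_nonneg)
  have E: "norm (LBINT u. of_real (theta_kernel u) * exp (z * of_real u)) \<le> exp (\<delta> * (norm z)\<^sup>2) * I" for z :: complex
  proof -
    have "norm (LBINT u. of_real (theta_kernel u) * exp (z * of_real u))
       \<le> (LBINT u. exp (\<delta> * (norm z)\<^sup>2) * (theta_kernel u * exp (1 / (4 * \<delta>) * u\<^sup>2)))"
    proof (rule norm_integral_le)
      show "integrable lborel (\<lambda>u. exp (\<delta> * (norm z)\<^sup>2) * (theta_kernel u * exp (1 / (4 * \<delta>) * u\<^sup>2)))"
        by (intro integrable_mult_right integrable_theta_kernel_gaussian)
      show "complex_integrable lborel (\<lambda>u. of_real (theta_kernel u) * exp (z * of_real u))"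
        by (rule laplace_power_series(2)[where r = "norm z + 1"])
           (auto intro!: integrable_theta_kernel_exp add_nonneg_pos)
      fix u :: real
      have "Re z * u \<le> \<bar>Re z\<bar> * \<bar>u\<bar>" unfolding abs_mult[symmetric] by (rule abs_ge_self)
      also have "\<dots> \<le> norm z * \<bar>u\<bar>" by (intro mult_right_mono abs_Re_le_cmod) auto
      also have "\<dots> \<le> \<delta> * (norm z)\<^sup>2 + 1 / (4 * \<delta>) * u\<^sup>2"
      proof -
        have "0 \<le> (2 * \<delta> * norm z - \<bar>u\<bar>)\<^sup>2 / (4 * \<delta>)" using \<delta> by simp
        also have "\<dots> = \<delta> * (norm z)\<^sup>2 + 1 / (4 * \<delta>) * u\<^sup>2 - norm z * \<bar>u\<bar>"
          using \<delta> by (simp add: power2_eq_square field_simps)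
        finally show ?thesis by simp
      qed
      finally have "exp (Re z * u) \<le> exp (\<delta> * (norm z)\<^sup>2) * exp (1 / (4 * \<delta>) * u\<^sup>2)" by (simp flip: exp_add)
      hence "theta_kernel u * exp (Re z * u) \<le> theta_kernel u * (exp (\<delta> * (norm z)\<^sup>2) * exp (1 / (4 * \<delta>) * u\<^sup>2))"
        by (intro mult_left_mono theta_kernel_nonneg)
      then show "norm (of_real (theta_kernel u) * exp (z * of_real u)) \<le> exp (\<delta> * (norm z)\<^sup>2) * (theta_kernel u * exp (1 / (4 * \<delta>) * u\<^sup>2))"
        using theta_kernel_nonneg[of u] by (simp add: norm_mult algebra_simps)
    qed
    also have "\<dots> = exp (\<delta> * (norm z)\<^sup>2) * I" by (simp add: I_def)
    finally show ?thesis .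
  qed
  show ?thesis
  proof (rule that)
    fix z :: complex
    define x where "x = (norm z)\<^sup>2"
    have x: "x \<ge> 0" by (simp add: x_def)
    have e1: "exp (\<delta> * x) \<ge> 1" using \<delta> x by simp
    have e2: "x \<le> exp (\<delta> * x) / \<delta>"
    proof -
      have "\<delta> * x \<le> exp (\<delta> * x)" using exp_ge_add_one_self[of "\<delta> * x"] by linarith
      then show ?thesis using \<delta> by (simp add: field_simps)
    qed
    have "norm (z\<^sup>2 - 1 / 4) \<le> norm (z\<^sup>2) + norm (1 / 4 :: complex)" by (rule norm_triangle_ineq4)
    hence q: "norm (z\<^sup>2 - 1 / 4) \<le> x + 1 / 4" by (simp add: x_def norm_power)
    also have "x + 1 / 4 \<le> (1 / \<delta> + 1) * exp (\<delta> * x)"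
    proof -
      have "(1 / \<delta> + 1) * exp (\<delta> * x) = exp (\<delta> * x) / \<delta> + exp (\<delta> * x)" by (simp add: algebra_simps)
      then show ?thesis using e1 e2 by linarith
    qed
    finally have "norm (z\<^sup>2 - 1 / 4) * norm (LBINT u. of_real (theta_kernel u) * exp (z * of_real u))
       \<le> ((1 / \<delta> + 1) * exp (\<delta> * x)) * (exp (\<delta> * x) * I)"
      using E[of z] \<delta> unfolding x_def[symmetric] by (intro mult_mono) auto
    also have "\<dots> = (1 / \<delta> + 1) * I * exp (\<epsilon> * x)" by (simp add: \<delta>_def flip: exp_add)
    finally have A: "norm (z\<^sup>2 - 1 / 4) * norm (LBINT u. of_real (theta_kernel u) * exp (z * of_real u))
       \<le> (1 / \<delta> + 1) * I * exp (\<epsilon> * x)" .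
    have "norm (xi_centered z) \<le> norm (1 / 2 :: complex) + norm ((z\<^sup>2 - 1 / 4) * (LBINT u. of_real (theta_kernel u) * exp (z * of_real u)))"
      unfolding xi_centered_def by (rule norm_triangle_ineq)
    also have "\<dots> \<le> 1 / 2 * exp (\<epsilon> * x) + (1 / \<delta> + 1) * I * exp (\<epsilon> * x)"
      using A \<epsilon> x unfolding norm_mult by (intro add_mono) auto
    finally show "norm (xi_centered z) \<le> (1 / 2 + (1 / \<delta> + 1) * I) * exp (\<epsilon> * (norm z)\<^sup>2)"
      by (simp add: x_def algebra_simps)
  qed
qed

text \<open>\<open>rGamma (s / 2 + 1)\<close> vanishes exactly at the trivial zeros. At these points
  and at s = 1, all real, the shifted \<Xi> is nonzero, so its zeros are precisely the zeros that
  the hypothesis speaks of.\<close>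

theorem riemann_hypothesis_iff_xi:
  "riemann_hypothesis \<longleftrightarrow> (\<forall>z. xi_centered z = 0 \<longrightarrow> Re z = 0)"
proof -
  obtain c where c: "c > 0" "\<And>\<tau>. Re (xi_centered (of_real \<tau>)) \<ge> c * (1 + \<tau>\<^sup>2)" using xi_centered_of_real_ge by metis
  have real_nz: "xi_centered (of_real \<tau>) \<noteq> 0" for \<tau>
  proof
    assume "xi_centered (of_real \<tau>) = 0"
    with c(2)[of \<tau>] have "c * (1 + \<tau>\<^sup>2) \<le> 0" by simp
    moreover have "c * (1 + \<tau>\<^sup>2) > 0" using c(1) by (simp add: add_pos_nonneg)
    ultimately show False by simp
  qed
  have zero_iff: "(s \<noteq> 1 \<and> riemann_zeta s = 0 \<and> s \<notin> {- 2 * of_nat n |n. n \<ge> 1}) \<longleftrightarrow> xi_centered (s - 1 / 2) = 0" for s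
  proof -
    have rG: "rGamma (s / 2 + 1) = 0 \<longleftrightarrow> s \<in> {- 2 * of_nat n |n. n \<ge> 1}"
    proof -
      have "rGamma (s / 2 + 1) = 0 \<longleftrightarrow> (\<exists>n. s / 2 + 1 = - of_nat n)"
        unfolding rGamma_eq_zero_iff by (auto elim!: nonpos_Ints_cases')
      also have "\<dots> \<longleftrightarrow> (\<exists>n. s = - 2 * of_nat (Suc n))"
      proof (intro ex_cong1 iffI)
        fix n :: nat assume "s / 2 + 1 = - of_nat n"
        moreover have "s = 2 * (s / 2 + 1) - 2" by (simp add: algebra_simps)
        ultimately show "s = - 2 * of_nat (Suc n)" by simp
      next
        fix n :: nat assume "s = - 2 * of_nat (Suc n)"
        hence e: "s / 2 = - of_nat (Suc n)" by simp
        show "s / 2 + 1 = - of_nat n" unfolding e by simp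
      qed
      also have "\<dots> \<longleftrightarrow> s \<in> {- 2 * of_nat n |n. n \<ge> 1}"
      proof
        assume "\<exists>n. s = - 2 * of_nat (Suc n)"
        then obtain n where "s = - 2 * of_nat (Suc n)" by blast
        then show "s \<in> {- 2 * of_nat n |n. n \<ge> 1}" by (intro CollectI exI[of _ "Suc n"]) simp
      next
        assume "s \<in> {- 2 * of_nat n |n. n \<ge> 1}"
        then obtain n where "s = - 2 * of_nat n" "n \<ge> 1" by blast
        then show "\<exists>n. s = - 2 * of_nat (Suc n)" by (intro exI[of _ "n - 1"]) (simp del: of_nat_Suc)
      qed
      finally show ?thesis .
    qed
    have nz1: "xi_centered (s - 1 / 2) \<noteq> 0" if "s = of_real r" for r
      using real_nz[of "r - 1 / 2"] that by simp
    have "xi_centered (s - 1 / 2) \<noteq> 0" if "s \<in> {- 2 * of_nat n |n. n \<ge> 1}"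
    proof -
      from that obtain n where "s = of_real (- 2 * real n)" by auto
      then show ?thesis by (rule nz1)
    qed
    moreover have "xi_centered (s - 1 / 2) \<noteq> 0" if "s = 1" using nz1[of 1] that by simp
    ultimately show ?thesis using rG by (auto simp: riemann_zeta_eq zeta_continuation_def)
  qed
  have "riemann_hypothesis \<longleftrightarrow> (\<forall>s. xi_centered (s - 1 / 2) = 0 \<longrightarrow> Re s = 1 / 2)"
    unfolding riemann_hypothesis_def zero_iff ..
  also have "\<dots> \<longleftrightarrow> (\<forall>z. xi_centered z = 0 \<longrightarrow> Re z = 0)"
  proof safe
    fix z assume "\<forall>s. xi_centered (s - 1 / 2) = 0 \<longrightarrow> Re s = 1 / 2" "xi_centered z = 0"
    from this(1)[rule_format, of "z + 1 / 2"] this(2) show "Re z = 0" by simp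
  next
    fix s assume "\<forall>z. xi_centered z = 0 \<longrightarrow> Re z = 0" "xi_centered (s - 1 / 2) = 0"
    then have "Re (s - 1 / 2) = 0" by blast
    then show "Re s = 1 / 2" by simp
  qed
  finally show ?thesis .
qed

section \<open>Total positivity under convolution\<close>

abbreviation det_fun :: "nat \<Rightarrow> (nat \<Rightarrow> nat \<Rightarrow> 'a::comm_ring_1) \<Rightarrow> 'a" where
  "det_fun n f \<equiv> Determinant.det (Matrix.mat n n (\<lambda>(i, j). f i j))"

text \<open>The determinant condition of \<open>totally_positive\<close> alone; measurability is
  tracked separately and with respect to \<open>borel\<close>, which suits products and
  convolutions.\<close>

definition tp_dets :: "(real \<Rightarrow> real) \<Rightarrow> bool" where
  "tp_dets L \<longleftrightarrow> (\<forall>(n::nat) (x::nat \<Rightarrow> real) (y::nat \<Rightarrow> real).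
        strict_mono_on {..<n} x \<and> strict_mono_on {..<n} y \<longrightarrow>
        det_fun n (\<lambda>j k. L (x j - y k)) \<ge> 0)"

lemma tp_detsD:
  "tp_dets L \<Longrightarrow> strict_mono_on {..<n} x \<Longrightarrow> strict_mono_on {..<n} y \<Longrightarrow>
    det_fun n (\<lambda>j k. L (x j - y k)) \<ge> 0"
  by (auto simp: tp_dets_def)

section \<open>Determinants of matrices given by functions\<close>

lemma det_mat_rows:
  "det_fun n (\<lambda>i j. f i j) = (\<Sum>p | p permutes {..<n}. signof p * (\<Prod>i<n. f i (p i)))"
proof -
  have "det_fun n (\<lambda>i j. f i j) = (\<Sum>p | p permutes {0..<n}. signof p * (\<Prod>i = 0..<n. Matrix.mat n n (\<lambda>(i, j). f i j) $$ (i, p i)))"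
    by (rule det_def') auto
  also have "\<dots> = (\<Sum>p | p permutes {..<n}. signof p * (\<Prod>i<n. f i (p i)))"
    unfolding lessThan_atLeast0
  proof (intro sum.cong refl arg_cong2[where f = "(*)"] prod.cong)
    fix p i assume "p \<in> {p. p permutes {0..<n}}" "i \<in> {0..<n}"
    moreover from this have "p i \<in> {0..<n}" using permutes_in_image by fastforce
    ultimately show "Matrix.mat n n (\<lambda>(i, j). f i j) $$ (i, p i) = f i (p i)" by simp
  qed
  finally show ?thesis .
qed

lemma det_mat_transpose:
  "det_fun n (\<lambda>i j. f j i) = det_fun n (\<lambda>i j. f i j)"
proof -
  have "Matrix.mat n n (\<lambda>(i, j). f j i) = transpose_mat (Matrix.mat n n (\<lambda>(i, j). f i j))"
    by (intro eq_matI) auto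
  then show ?thesis by (simp add: det_transpose[of _ n])
qed

lemma det_mat_cols:
  "det_fun n (\<lambda>i j. f i j) = (\<Sum>p | p permutes {..<n}. signof p * (\<Prod>j<n. f (p j) j))"
  using det_mat_rows[of n "\<lambda>i j. f j i"] det_mat_transpose[of n f] by simp

lemma det_mat_permute_rows:
  assumes "p permutes {..<n}"
  shows "det_fun n (\<lambda>i j. f (p i) j) = signof p * det_fun n (\<lambda>i j. f i j)"
proof -
  have p: "p permutes {0..<n}" using assms by (simp add: lessThan_atLeast0)
  have "det_fun n (\<lambda>i j. Matrix.mat n n (\<lambda>(i, j). f i j) $$ (p i, j))
     = signof p * det_fun n (\<lambda>i j. f i j)"
    by (rule det_permute_rows[OF _ p]) simp
  also have "Matrix.mat n n (\<lambda>(i, j). Matrix.mat n n (\<lambda>(i, j). f i j) $$ (p i, j)) = Matrix.mat n n (\<lambda>(i, j). f (p i) j)"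
  proof (intro eq_matI)
    fix i j assume "i < dim_row (Matrix.mat n n (\<lambda>(i, j). f (p i) j))" "j < dim_col (Matrix.mat n n (\<lambda>(i, j). f (p i) j))"
    moreover from this have "p i < n" using permutes_in_image[OF assms, of i] by simp
    ultimately show "Matrix.mat n n (\<lambda>(i, j). Matrix.mat n n (\<lambda>(i, j). f i j) $$ (p i, j)) $$ (i, j) = Matrix.mat n n (\<lambda>(i, j). f (p i) j) $$ (i, j)"
      by simp
  qed auto
  finally show ?thesis .
qed

lemma det_mat_permute_cols:
  assumes "p permutes {..<n}"
  shows "det_fun n (\<lambda>i j. f i (p j)) = signof p * det_fun n (\<lambda>i j. f i j)"
  using det_mat_permute_rows[OF assms, of "\<lambda>i j. f j i"] det_mat_transpose[of n f] det_mat_transpose[of n "\<lambda>i j. f i (p j)"]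
  by simp

lemma det_mat_scale:
  fixes f :: "nat \<Rightarrow> nat \<Rightarrow> 'a::comm_ring_1"
  shows "det_fun n (\<lambda>i j. u i * f i j * v j)
      = (\<Prod>i<n. u i) * (\<Prod>j<n. v j) * det_fun n (\<lambda>i j. f i j)"
proof -
  have "signof p * (\<Prod>i<n. u i * f i (p i) * v (p i)) = (\<Prod>i<n. u i) * (\<Prod>j<n. v j) * (signof p * (\<Prod>i<n. f i (p i)))"
    if "p permutes {..<n}" for p
  proof -
    have "(\<Prod>i<n. v (p i)) = (\<Prod>j<n. v j)"
      by (rule prod.permute[OF that, unfolded o_def, symmetric])
    then show ?thesis by (simp add: prod.distrib mult_ac)
  qed
  then show ?thesis by (simp add: det_mat_rows sum_distrib_left)
qed

lemma det_mat_tendsto: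
  fixes f :: "nat \<Rightarrow> nat \<Rightarrow> nat \<Rightarrow> real"
  assumes "\<And>i j. (\<lambda>m. f m i j) \<longlonglongrightarrow> g i j"
  shows "(\<lambda>m. det_fun n (\<lambda>i j. f m i j)) \<longlonglongrightarrow> det_fun n (\<lambda>i j. g i j)"
  unfolding det_mat_rows by (intro tendsto_intros assms)

section \<open>Closure properties of the determinant condition\<close>

lemma tp_dets_limit:
  assumes "\<And>m. tp_dets (f m)" "\<And>x. (\<lambda>m. f m x) \<longlonglongrightarrow> g x"
  shows "tp_dets g"
  unfolding tp_dets_def
proof (intro allI impI)
  fix n :: nat and x y :: "nat \<Rightarrow> real"
  assume xy: "strict_mono_on {..<n} x \<and> strict_mono_on {..<n} y"
  have "(\<lambda>m. det_fun n (\<lambda>i j. f m (x i - y j))) \<longlonglongrightarrow> det_fun n (\<lambda>i j. g (x i - y j))"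
    by (intro det_mat_tendsto assms)
  then show "det_fun n (\<lambda>i j. g (x i - y j)) \<ge> 0"
    by (rule LIMSEQ_le_const) (use tp_detsD[OF assms(1)] xy in auto)
qed

lemma tp_dets_nonneg:
  assumes "tp_dets g" shows "g x \<ge> 0"
proof -
  have "det_fun 1 (\<lambda>j k. g ((\<lambda>_. x) j - (\<lambda>_. 0) k)) \<ge> 0"
    by (rule tp_detsD[OF assms]) (auto simp: strict_mono_on_def)
  then show ?thesis by (simp add: det_single)
qed

lemma tp_dets_scale:
  assumes "tp_dets g" "c \<ge> 0" shows "tp_dets (\<lambda>x. c * g x)"
  unfolding tp_dets_def
proof (intro allI impI)
  fix n :: nat and x y :: "nat \<Rightarrow> real"
  assume "strict_mono_on {..<n} x \<and> strict_mono_on {..<n} y"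
  then show "det_fun n (\<lambda>j k. c * g (x j - y k)) \<ge> 0"
    using det_mat_scale[of n "\<lambda>_. c" "\<lambda>j k. g (x j - y k)" "\<lambda>_. 1"] tp_detsD[OF assms(1), of n x y] assms(2) by simp
qed

lemma tp_dets_reflect:
  assumes "tp_dets g" shows "tp_dets (\<lambda>x. g (- x))"
  unfolding tp_dets_def
proof (intro allI impI)
  fix n :: nat and x y :: "nat \<Rightarrow> real"
  assume "strict_mono_on {..<n} x \<and> strict_mono_on {..<n} y"
  then show "det_fun n (\<lambda>j k. g (- (x j - y k))) \<ge> 0"
    using tp_detsD[OF assms, of n y x] det_mat_transpose[of n "\<lambda>j k. g (y j - x k)"] by simp
qed

text \<open>Column j of the determinant depends on the variable t j alone. Expanding over
  permutations by columns leaves products of one-variable functions, so the product integral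
  factorises and the determinant reassembles.\<close>

lemma
  fixes K h :: "nat \<Rightarrow> real \<Rightarrow> real"
  assumes int: "\<And>i j. i < n \<Longrightarrow> j < n \<Longrightarrow> integrable lborel (\<lambda>t. K i t * h j t)"
  shows integrable_det_columns: "integrable (Pi\<^sub>M {..<n} (\<lambda>_. lborel)) (\<lambda>t. det_fun n (\<lambda>i j. K i (t j)) * (\<Prod>j<n. h j (t j)))"
    and integral_det_columns: "(\<integral>t. det_fun n (\<lambda>i j. K i (t j)) * (\<Prod>j<n. h j (t j)) \<partial>Pi\<^sub>M {..<n} (\<lambda>_. lborel))
      = det_fun n (\<lambda>i j. LBINT t. K i t * h j t)"
proof -
  interpret product_sigma_finite "\<lambda>_::nat. lborel :: real measure" by standard
  have eq: "det_fun n (\<lambda>i j. K i (t j)) * (\<Prod>j<n. h j (t j))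
     = (\<Sum>p | p permutes {..<n}. signof p * (\<Prod>j<n. K (p j) (t j) * h j (t j)))" for t
    unfolding det_mat_cols sum_distrib_right by (simp add: prod.distrib mult_ac)
  have I: "integrable (Pi\<^sub>M {..<n} (\<lambda>_. lborel)) (\<lambda>t. \<Prod>j<n. K (p j) (t j) * h j (t j))"
    and E: "(\<integral>t. (\<Prod>j<n. K (p j) (t j) * h j (t j)) \<partial>Pi\<^sub>M {..<n} (\<lambda>_. lborel)) = (\<Prod>j<n. LBINT t. K (p j) t * h j t)"
    if p: "p permutes {..<n}" for p
  proof -
    have i: "integrable lborel (\<lambda>t. K (p j) t * h j t)" if "j \<in> {..<n}" for j
      using int permutes_in_image[OF p, of j] that by auto
    show "integrable (Pi\<^sub>M {..<n} (\<lambda>_. lborel)) (\<lambda>t. \<Prod>j<n. K (p j) (t j) * h j (t j))"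
      by (rule product_integrable_prod) (use i in auto)
    show "(\<integral>t. (\<Prod>j<n. K (p j) (t j) * h j (t j)) \<partial>Pi\<^sub>M {..<n} (\<lambda>_. lborel)) = (\<Prod>j<n. LBINT t. K (p j) t * h j t)"
      by (rule product_integral_prod) (use i in auto)
  qed
  show "integrable (Pi\<^sub>M {..<n} (\<lambda>_. lborel)) (\<lambda>t. det_fun n (\<lambda>i j. K i (t j)) * (\<Prod>j<n. h j (t j)))"
    unfolding eq by (intro Bochner_Integration.integrable_sum integrable_mult_right) (auto intro: I)
  show "(\<integral>t. det_fun n (\<lambda>i j. K i (t j)) * (\<Prod>j<n. h j (t j)) \<partial>Pi\<^sub>M {..<n} (\<lambda>_. lborel))
      = det_fun n (\<lambda>i j. LBINT t. K i t * h j t)"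
    unfolding eq unfolding det_mat_cols
    by (subst Bochner_Integration.integral_sum) (auto intro!: integrable_mult_right I sum.cong simp: E)
qed

text \<open>The continuous Cauchy-Binet formula. Expanding the second determinant over permutations
  q and integrating column by column gives the determinant of the pairings with columns permuted by
  q; its sign cancels the sign of q, so all n! terms are equal.\<close>

theorem andreief_identity:
  fixes K H :: "nat \<Rightarrow> real \<Rightarrow> real"
  assumes int: "\<And>i k. i < n \<Longrightarrow> k < n \<Longrightarrow> integrable lborel (\<lambda>t. K i t * H k t)"
  shows "fact n * det_fun n (\<lambda>i k. LBINT t. K i t * H k t)
     = (\<integral>t. det_fun n (\<lambda>i j. K i (t j)) * det_fun n (\<lambda>j k. H k (t j)) \<partial>Pi\<^sub>M {..<n} (\<lambda>_. lborel))"
    (is "_ = ?R")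
proof -
  define B where "B i k = (LBINT t. K i t * H k t)" for i k
  define D where "D t = det_fun n (\<lambda>i j. K i (t j))" for t
  have int': "integrable lborel (\<lambda>t. K i t * H (q j) t)" if "q permutes {..<n}" "i < n" "j < n" for q i j
    using int permutes_in_image[OF that(1), of j] that by auto
  have "?R = (\<integral>t. (\<Sum>q | q permutes {..<n}. signof q * (D t * (\<Prod>j<n. H (q j) (t j)))) \<partial>Pi\<^sub>M {..<n} (\<lambda>_. lborel))"
    unfolding det_mat_rows[of n "\<lambda>j k. H k (_ j)"] D_def[symmetric]
    by (simp add: sum_distrib_left mult_ac)
  also have "\<dots> = (\<Sum>q | q permutes {..<n}. signof q * (\<integral>t. D t * (\<Prod>j<n. H (q j) (t j)) \<partial>Pi\<^sub>M {..<n} (\<lambda>_. lborel)))"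
    unfolding D_def
  proof (subst Bochner_Integration.integral_sum)
    fix q assume "q \<in> {q. q permutes {..<n}}"
    hence q: "q permutes {..<n}" by simp
    show "integrable (Pi\<^sub>M {..<n} (\<lambda>_. lborel)) (\<lambda>t. signof q * (det_fun n (\<lambda>i j. K i (t j)) * (\<Prod>j<n. H (q j) (t j))))"
      by (intro integrable_mult_right integrable_det_columns[of n K "\<lambda>j. H (q j)"] int'[OF q])
  qed simp
  also have "\<dots> = (\<Sum>q | q permutes {..<n}. det_fun n (\<lambda>i k. B i k))"
  proof (intro sum.cong refl)
    fix q assume "q \<in> {q. q permutes {..<n}}"
    hence q: "q permutes {..<n}" by simp
    have "(\<integral>t. D t * (\<Prod>j<n. H (q j) (t j)) \<partial>Pi\<^sub>M {..<n} (\<lambda>_. lborel)) = det_fun n (\<lambda>i j. B i (q j))"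
      unfolding D_def B_def by (rule integral_det_columns[of n K "\<lambda>j. H (q j)"]) (use int' q in auto)
    also have "\<dots> = signof q * det_fun n (\<lambda>i k. B i k)" by (rule det_mat_permute_cols[OF q])
    finally show "signof q * (\<integral>t. D t * (\<Prod>j<n. H (q j) (t j)) \<partial>Pi\<^sub>M {..<n} (\<lambda>_. lborel)) = det_fun n (\<lambda>i k. B i k)"
      by (simp add: sign_def)
  qed
  also have "\<dots> = fact n * det_fun n (\<lambda>i k. B i k)"
    by (simp add: card_permutations)
  finally show ?thesis by (simp add: B_def)
qed

lemma sorting_permutation:
  fixes t :: "nat \<Rightarrow> real"
  assumes "inj_on t {..<n}"
  obtains q where "q permutes {..<n}" "strict_mono_on {..<n} (\<lambda>j. t (q j))"
proof -
  define l where "l = sorted_list_of_set (t ` {..<n})"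
  have l: "sorted_wrt (<) l" "set l = t ` {..<n}" "length l = n"
    using assms by (auto simp: l_def card_image)
  define q where "q j = (if j < n then inv_into {..<n} t (l ! j) else j)" for j
  have lq: "t (q j) = l ! j" "q j < n" if "j < n" for j
  proof -
    have "l ! j \<in> t ` {..<n}" using l that by (metis nth_mem)
    then show "t (q j) = l ! j" "q j < n"
      using that f_inv_into_f[of "l ! j" t "{..<n}"] inv_into_into[of "l ! j" t "{..<n}"] by (auto simp: q_def)
  qed
  have mono: "strict_mono_on {..<n} (\<lambda>j. t (q j))"
    using l by (auto simp: strict_mono_on_def lq sorted_wrt_iff_nth_less)
  have "inj_on q {..<n}"
  proof (rule inj_onI)
    fix i j assume "i \<in> {..<n}" "j \<in> {..<n}" "q i = q j"
    then show "i = j" using inj_onD[OF strict_mono_on_imp_inj_on[OF mono], of i j] by simp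
  qed
  moreover have "q ` {..<n} \<subseteq> {..<n}" using lq by auto
  ultimately have "bij_betw q {..<n} {..<n}"
    using endo_inj_surj[of "{..<n}" q] by (simp add: bij_betw_def)
  hence "q permutes {..<n}" by (rule bij_imp_permutes) (auto simp: q_def)
  with mono show ?thesis using that by blast
qed

text \<open>The integrand in Andreief's identity is nonnegative at every t, not just at ordered
  ones: sorting distinct coordinates multiplies both determinants by the same sign, and for repeated
  coordinates the first one has two equal columns.\<close>

theorem tp_dets_convolution:
  fixes f g :: "real \<Rightarrow> real"
  assumes f: "tp_dets f" and g: "tp_dets g"
    and int: "\<And>x y. integrable lborel (\<lambda>t. f (x - t) * g (t - y))"
  shows "tp_dets (\<lambda>x. LBINT t. f (x - t) * g t)"
  unfolding tp_dets_def
proof (intro allI impI)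
  fix n :: nat and x y :: "nat \<Rightarrow> real"
  assume "strict_mono_on {..<n} x \<and> strict_mono_on {..<n} y"
  hence x: "strict_mono_on {..<n} x" and y: "strict_mono_on {..<n} y" by auto
  have shift: "(LBINT t. f (a - b - t) * g t) = (LBINT t. f (a - t) * g (t - b))" for a b
    using lborel_integral_real_affine[of 1 "\<lambda>t. f (a - b - t) * g t" "- b"] by simp
  have nonneg: "det_fun n (\<lambda>i j. f (x i - t j)) * det_fun n (\<lambda>j k. g (t j - y k)) \<ge> 0" for t
  proof (cases "inj_on t {..<n}")
    case True
    then obtain q where q: "q permutes {..<n}" "strict_mono_on {..<n} (\<lambda>j. t (q j))" by (rule sorting_permutation)
    have "0 \<le> det_fun n (\<lambda>i j. f (x i - t (q j))) * det_fun n (\<lambda>j k. g (t (q j) - y k))"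
      by (intro mult_nonneg_nonneg tp_detsD[OF f x q(2)] tp_detsD[OF g q(2) y])
    also have "\<dots> = det_fun n (\<lambda>i j. f (x i - t j)) * det_fun n (\<lambda>j k. g (t j - y k))"
      using det_mat_permute_cols[OF q(1), of "\<lambda>i j. f (x i - t j)"] det_mat_permute_rows[OF q(1), of "\<lambda>j k. g (t j - y k)"]
      by (simp add: sign_def)
    finally show ?thesis .
  next
    case False
    then obtain i j where ij: "i < n" "j < n" "i \<noteq> j" "t i = t j" by (auto simp: inj_on_def)
    have "det_fun n (\<lambda>i j. f (x i - t j)) = 0"
      by (rule det_identical_columns[OF _ ij(3,1,2)]) (use ij in \<open>auto intro!: eq_vecI\<close>)
    then show ?thesis by simp
  qed
  have "fact n * det_fun n (\<lambda>i k. LBINT t. f (x i - t) * g (t - y k))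
     = (\<integral>t. det_fun n (\<lambda>i j. f (x i - t j)) * det_fun n (\<lambda>j k. g (t j - y k)) \<partial>Pi\<^sub>M {..<n} (\<lambda>_. lborel))"
    by (rule andreief_identity[of n "\<lambda>i t. f (x i - t)" "\<lambda>k t. g (t - y k)"]) (rule int)
  also have "\<dots> \<ge> 0" by (intro Bochner_Integration.integral_nonneg nonneg)
  finally have "det_fun n (\<lambda>i k. LBINT t. f (x i - t) * g (t - y k)) \<ge> 0"
    using fact_gt_zero[of n, where 'a = real] by (simp only: zero_le_mult_iff) linarith
  then show "det_fun n (\<lambda>j k. LBINT t. f (x j - y k - t) * g t) \<ge> 0"
    unfolding shift .
qed

text \<open>The ones of each row form an initial segment that grows with the row. If
  \<open>x i < y i\<close> for some i, the rows up to i live in the first i columns and the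
  determinant vanishes by the pigeonhole principle; if two neighbouring rows coincide it vanishes as
  well; otherwise x and y interlace and the matrix is lower triangular.\<close>

lemma det_staircase_nonneg:
  fixes x y :: "nat \<Rightarrow> real"
  assumes x: "strict_mono_on {..<n} x" and y: "strict_mono_on {..<n} y"
  shows "det_fun n (\<lambda>i j. if y j \<le> x i then 1 else 0 :: real) \<ge> 0"
proof -
  define M where "M i j = (if y j \<le> x i then 1 else 0 :: real)" for i j
  have mono: "z i \<le> z j" if "strict_mono_on {..<n} z" "i \<le> j" "j < n" for z :: "nat \<Rightarrow> real" and i j
    using that strict_mono_onD[OF that(1), of i j] by (cases "i = j") auto
  note xm = mono[OF x] and ym = mono[OF y]
  consider (a) i where "i < n" "x i < y i" | (b) i where "\<forall>i<n. y i \<le> x i" "Suc i < n" "y (Suc i) \<le> x i"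
    | (c) "\<forall>i<n. y i \<le> x i" "\<forall>i. Suc i < n \<longrightarrow> x i < y (Suc i)"
    by (meson not_le)
  then have "det_fun n (\<lambda>i j. M i j) \<ge> 0"
  proof cases
    case a
    have "(\<Prod>r<n. M r (p r)) = 0" if p: "p permutes {..<n}" for p
    proof -
      have "\<exists>r\<le>i. p r \<ge> i"
      proof (rule ccontr)
        assume "\<not> (\<exists>r\<le>i. p r \<ge> i)"
        hence "p r < i" if "r \<le> i" for r using that not_le by blast
        hence "p ` {..i} \<subseteq> {..<i}" by auto
        hence "card (p ` {..i}) \<le> card {..<i}" by (intro card_mono) auto
        moreover have "card (p ` {..i}) = card {..i}"
          by (intro card_image inj_on_subset[OF permutes_inj[OF p]]) auto
        ultimately show False by simp
      qed
      then obtain r where r: "r \<le> i" "p r \<ge> i" by blast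
      have pr: "p r < n" using permutes_in_image[OF p, of r] r a by simp
      have "x r < y (p r)" using xm[OF r(1) a(1)] ym[OF r(2) pr] a(2) by linarith
      hence "M r (p r) = 0" by (simp add: M_def)
      then show ?thesis using r a by (intro prod_zero) auto
    qed
    then have "det_fun n (\<lambda>i j. M i j) = 0"
      unfolding det_mat_rows by (intro sum.neutral) (auto simp del: prod_zero_iff)
    then show ?thesis by simp
  next
    case (b i0)
    define I where "I = {i. Suc i < n \<and> y (Suc i) \<le> x i}"
    have I: "finite I" "I \<noteq> {}" using b by (auto simp: I_def intro!: finite_subset[of _ "{..<n}"])
    \<comment> \<open>For the largest such i, row i + 1 gains no further ones, so rows i and i + 1
      are equal.\<close>
    define i where "i = Max I"
    have i: "Suc i < n" "y (Suc i) \<le> x i" using Max_in[OF I] by (auto simp: i_def I_def)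
    have imax: "x (Suc i) < y (Suc (Suc i))" if "Suc (Suc i) < n"
    proof (rule ccontr)
      assume "\<not> x (Suc i) < y (Suc (Suc i))"
      hence "Suc i \<in> I" using that by (auto simp: I_def)
      from Max_ge[OF I(1) this] show False by (simp add: i_def)
    qed
    have "M i j = M (Suc i) j" if "j < n" for j
    proof (cases "j \<le> Suc i")
      case True
      have "y j \<le> x i" using ym[OF True i(1)] i(2) by simp
      then show ?thesis using xm[of i "Suc i"] i by (auto simp: M_def)
    next
      case False
      hence "x (Suc i) < y j" 
      proof -
        have "Suc (Suc i) \<le> j" using False by simp
        then show ?thesis using imax ym[of "Suc (Suc i)" j] that by (meson less_le_trans le_less_trans)
      qed
      then show ?thesis using xm[of i "Suc i"] i by (auto simp: M_def)
    qed
    hence "det_fun n (\<lambda>i j. M i j) = 0"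
      using i by (intro det_identical_rows[of _ n i "Suc i"]) (auto intro!: eq_vecI)
    then show ?thesis by simp
  next
    case c
    have M0: "M i j = 0" if "i < j" "j < n" for i j
    proof -
      have "x i < y (Suc i)" using c(2) that by simp
      also have "\<dots> \<le> y j" using ym that by simp
      finally show ?thesis by (simp add: M_def)
    qed
    hence "det_fun n (\<lambda>i j. M i j) = prod_list (diag_mat (Matrix.mat n n (\<lambda>(i, j). M i j)))"
      by (intro det_lower_triangular[of n]) (auto simp: M0)
    also have "\<dots> = (\<Prod>i<n. M i i)" by (simp add: diag_mat_def prod.list_conv_set_nth atLeast0LessThan)
    also have "\<dots> \<ge> 0" by (intro prod_nonneg) (auto simp: M_def)
    finally show ?thesis .
  qed
  then show ?thesis by (simp add: M_def)
qed

text \<open>On its support the kernel factors as exp(-a x) exp(a y); these factors come out of rows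
  and columns and leave the staircase matrix.\<close>

lemma tp_dets_one_sided_exp: "tp_dets (\<lambda>x. if 0 \<le> x then exp (- (a * x)) else 0)"
  unfolding tp_dets_def
proof (intro allI impI)
  fix n :: nat and x y :: "nat \<Rightarrow> real"
  assume xy: "strict_mono_on {..<n} x \<and> strict_mono_on {..<n} y"
  have "(if 0 \<le> x j - y k then exp (- (a * (x j - y k))) else 0) = exp (- (a * x j)) * (if y k \<le> x j then 1 else 0) * exp (a * y k)" for j k
    by (simp add: algebra_simps flip: exp_add)
  then show "det_fun n (\<lambda>j k. if 0 \<le> x j - y k then exp (- (a * (x j - y k))) else 0) \<ge> 0"
    using det_staircase_nonneg[of n x y] xy
      det_mat_scale[of n "\<lambda>j. exp (- (a * x j))" "\<lambda>j k. if y k \<le> x j then 1 else 0" "\<lambda>k. exp (a * y k)"]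
    by (simp add: prod_nonneg)
qed

text \<open>Convolving the one-sided exponential with its reflection gives exp(-a|x|)/(2a), so the
  convolution theorem applies.\<close>

lemma tp_dets_exp_neg_abs:
  assumes a: "a > 0" shows "tp_dets (\<lambda>x. exp (- (a * \<bar>x\<bar>)))"
proof -
  define f where "f x = (if 0 \<le> x then exp (- (a * x)) else 0)" for x :: real
  \<comment> \<open>For t below min x y the product of the two one-sided factors is a constant times
    a translate of this half-line exponential; above it the product is 0, and the point min x y is a
    null set.\<close>
  define h where "h u = indicator {..<0} u * exp (2 * a * u)" for u :: real
  have h: "has_bochner_integral lborel h (1 / (2 * a))"
  proof -
    have "has_bochner_integral lborel (\<lambda>u. indicator {..<0} u *\<^sub>R exp (of_real (2 * a) * of_real u)) (1 / complex_of_real (2 * a))"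
      using a by (intro has_bochner_integral_exp_neg_half_line) auto
    moreover have "indicator {..<0} u *\<^sub>R exp (of_real (2 * a) * of_real u) = complex_of_real (h u)" for u
      by (simp add: h_def scaleR_conv_of_real indicator_def flip: exp_of_real)
    ultimately have "has_bochner_integral lborel (\<lambda>u. complex_of_real (h u)) (complex_of_real (1 / (2 * a)))" by simp
    from has_bochner_integral_Re[OF this] show ?thesis by simp
  qed
  have fm: "f (x - t) * f (- (t - y)) = exp (- (a * (x + y))) * exp (2 * a * min x y) * h (t - min x y)"
    if "t \<noteq> min x y" for x y t
  proof (cases "t < min x y")
    case True
    have "- (a * (x - t)) + - (a * (- (t - y))) = - (a * (x + y)) + (2 * a * min x y + 2 * a * (t - min x y))"
      by (simp add: algebra_simps)
    with True show ?thesis by (simp add: f_def h_def mult.assoc flip: exp_add)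
  next
    case False
    then show ?thesis using that by (auto simp: f_def h_def)
  qed
  have mm: "has_bochner_integral lborel (\<lambda>t. f (x - t) * f (- (t - y))) (exp (- (a * (x + y))) * exp (2 * a * min x y) * (1 / (2 * a)))" for x y
  proof -
    have "has_bochner_integral lborel (\<lambda>t. h (t - min x y)) (1 / (2 * a))"
      using h lborel_integrable_real_affine[of h 1 "- min x y"] lborel_integral_real_affine[of 1 h "- min x y"]
      by (simp add: has_bochner_integral_iff)
    hence "has_bochner_integral lborel (\<lambda>t. exp (- (a * (x + y))) * exp (2 * a * min x y) * h (t - min x y)) (exp (- (a * (x + y))) * exp (2 * a * min x y) * (1 / (2 * a)))"
      by (intro has_bochner_integral_mult_right)
    moreover have "AE t in lborel. exp (- (a * (x + y))) * exp (2 * a * min x y) * h (t - min x y) = f (x - t) * f (- (t - y))"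
      using AE_lborel_singleton[of "min x y"] by eventually_elim (rule fm[symmetric])
    ultimately show ?thesis
      by (subst (asm) has_bochner_integral_cong_AE) (auto simp: h_def f_def)
  qed
  have T: "tp_dets (\<lambda>x. LBINT t. f (x - t) * f (- t))"
  proof (rule tp_dets_convolution[where g = "\<lambda>t. f (- t)"])
    show "tp_dets f" unfolding f_def by (rule tp_dets_one_sided_exp)
    then show "tp_dets (\<lambda>t. f (- t))" by (rule tp_dets_reflect)
    show "integrable lborel (\<lambda>t. f (x - t) * f (- (t - y)))" for x y
      using mm[of x y] by (simp add: has_bochner_integral_iff)
  qed
  have E: "(LBINT t. f (x - t) * f (- t)) = 1 / (2 * a) * exp (- (a * \<bar>x\<bar>))" for x
    using has_bochner_integral_integral_eq[OF mm[of x 0]]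
    by (auto simp: min_def abs_if simp flip: exp_add)
  have "tp_dets (\<lambda>x. 2 * a * (LBINT t. f (x - t) * f (- t)))"
    using a by (intro tp_dets_scale T) auto
  then show ?thesis unfolding E using a by simp
qed

section \<open>Products for entire functions of order less than one\<close>

lemma entire_divide_linear_factor:
  assumes f: "f holomorphic_on UNIV" and a: "f a = 0" "a \<noteq> 0"
  obtains g where "g holomorphic_on UNIV" "\<And>z. f z = (1 - z / a) * g z"
proof -
  define q where "q z = (if z = a then deriv f a else (f z - f a) / (z - a))" for z
  have "q holomorphic_on UNIV" unfolding q_def by (rule pole_lemma_open[OF f]) auto
  hence "(\<lambda>z. - a * q z) holomorphic_on UNIV" by (intro holomorphic_intros)
  moreover have "f z = (1 - z / a) * (- a * q z)" for z
    using a by (cases "z = a") (auto simp: q_def field_simps)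
  ultimately show ?thesis using that by blast
qed

lemma max_modulus_cball:
  assumes g: "g holomorphic_on UNIV" and R: "R > 0" and B: "\<And>z. norm z = R \<Longrightarrow> norm (g z) \<le> B" and z: "norm z \<le> R"
  shows "norm (g z) \<le> B"
proof (rule maximum_modulus_frontier[where S = "cball 0 R" and f = g])
  show "g holomorphic_on interior (cball 0 R)" using g by (rule holomorphic_on_subset) auto
  show "continuous_on (closure (cball 0 R)) g"
    using holomorphic_on_imp_continuous_on[OF g] by (rule continuous_on_subset) auto
qed (use assms in \<open>auto simp: dist_norm\<close>)

text \<open>On the circle |z| = k R each factor 1 - z/w has modulus at least k - 1, and the maximum
  modulus principle carries the bound for g inwards. With k = 4 this limits the number of zeros;
  with k = 2 it bounds the quotient regardless of how many factors there are.\<close>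

lemma entire_div_prod_bound:
  assumes g: "g holomorphic_on UNIV" and fg: "\<And>z. f z = (\<Prod>w\<leftarrow>ws. 1 - z / w) * g z"
    and ws: "\<And>w. w \<in> set ws \<Longrightarrow> norm w < R" "\<And>w. w \<in> set ws \<Longrightarrow> w \<noteq> 0" and R: "R > 0" and k: "k \<ge> 2"
    and M: "\<And>z. norm z = k * R \<Longrightarrow> norm (f z) \<le> M" and z: "norm z \<le> k * R"
  shows "(k - 1) ^ length ws * norm (g z) \<le> M"
proof -
  have "norm (g z) \<le> M / (k - 1) ^ length ws"
  proof (rule max_modulus_cball[OF g _ _ z])
    fix z :: complex assume z: "norm z = k * R"
    have "set ws' \<subseteq> set ws \<Longrightarrow> (k - 1) ^ length ws' \<le> norm (\<Prod>w\<leftarrow>ws'. 1 - z / w)" for ws'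
    proof (induction ws')
      case (Cons w ws')
      have w: "norm w < R" "w \<noteq> 0" using Cons.prems ws by auto
      have "k \<le> norm z / norm w"
        using w k R unfolding z by (simp add: pos_le_divide_eq)
      also have "norm z / norm w = norm (z / w)" by (simp add: norm_divide)
      finally have "k - 1 \<le> norm (1 - z / w)" using norm_triangle_ineq2[of "z / w" 1] by (simp add: norm_minus_commute)
      then show ?case using Cons k by (auto simp: norm_mult intro!: mult_mono)
    qed auto
    hence "(k - 1) ^ length ws * norm (g z) \<le> norm (\<Prod>w\<leftarrow>ws. 1 - z / w) * norm (g z)"
      by (intro mult_right_mono) auto
    also have "\<dots> \<le> M" using M[OF z] fg[of z] by (simp add: norm_mult)
    finally show "norm (g z) \<le> M / (k - 1) ^ length ws" using k by (simp add: field_simps)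
  qed (use R k in auto)
  then show ?thesis using k by (simp add: field_simps)
qed

text \<open>Each division by a zero in the disc lowers the modulus bound on the fourfold disc by the
  factor 3 while keeping the value at 0, so only finitely many divisions are possible.\<close>
lemma entire_factor_zeros_in_disc:
  assumes f: "f holomorphic_on UNIV" and f0: "f 0 \<noteq> 0" and R: "R > 0"
  obtains ws g where "\<And>w. w \<in> set ws \<Longrightarrow> norm w < R \<and> w \<noteq> 0 \<and> f w = 0"
    and "g holomorphic_on UNIV" and "\<And>z. f z = (\<Prod>w\<leftarrow>ws. 1 - z / w) * g z" and "\<And>z. norm z < R \<Longrightarrow> g z \<noteq> 0"
proof -
  define P where "P ws g \<longleftrightarrow> (\<forall>w\<in>set ws. norm w < R \<and> w \<noteq> 0) \<and> g holomorphic_on UNIV \<and> (\<forall>z. f z = (\<Prod>w\<leftarrow>ws. 1 - z / w) * g z)" for ws g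
  have "compact (f ` sphere 0 (4 * R))"
    by (intro compact_continuous_image holomorphic_on_imp_continuous_on holomorphic_on_subset[OF f]) auto
  then obtain M where M: "\<And>z. norm z = 4 * R \<Longrightarrow> norm (f z) \<le> M"
    using compact_imp_bounded[of "f ` sphere 0 (4 * R)"] unfolding bounded_iff by (metis imageI mem_sphere_0)
  have bound: "3 ^ length ws * norm (f 0) \<le> M" if "P ws g" for ws g
  proof -
    have "(4 - 1) ^ length ws * norm (g 0) \<le> M"
      by (rule entire_div_prod_bound[where f = f and R = R]) (use that R M in \<open>auto simp: P_def\<close>)
    moreover have "(\<Prod>w\<leftarrow>ws. 1 - 0 / w) = (1 :: complex)" by (induction ws) auto
    hence "g 0 = f 0" using that by (simp add: P_def)
    ultimately show ?thesis by simp
  qed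
  obtain N where N: "M / norm (f 0) < 3 ^ N" using real_arch_pow[of 3 "M / norm (f 0)"] by auto
  have len: "length ws \<le> N" if "P ws g" for ws g
  proof (rule ccontr)
    assume "\<not> length ws \<le> N"
    hence "(3::real) ^ N \<le> 3 ^ length ws" by (intro power_increasing) auto
    moreover have "3 ^ length ws \<le> M / norm (f 0)" using bound[OF that] f0 by (simp add: field_simps)
    ultimately show False using N by linarith
  qed
  define Q where "Q n \<longleftrightarrow> (\<exists>ws g. P ws g \<and> length ws = n)" for n
  have Q0: "Q 0" unfolding Q_def using f by (intro exI[of _ "[]"] exI[of _ f]) (simp add: P_def)
  have QN: "\<forall>n. Q n \<longrightarrow> n \<le> N" using len by (auto simp: Q_def)
  \<comment> \<open>A factorisation with the largest number of divisions: another zero of g in the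
    disc would permit one more.\<close>
  define m where "m = (GREATEST n. Q n)"
  have "Q m" unfolding m_def by (rule GreatestI_nat[of Q 0 N]) (use QN Q0 in auto)
  then obtain ws g where wg: "P ws g" "length ws = m" by (auto simp: Q_def)
  have nz: "g z \<noteq> 0" if z: "norm z < R" for z
  proof
    assume gz: "g z = 0"
    have "z \<noteq> 0"
    proof
      assume "z = 0"
      hence "f 0 = 0" using wg gz by (auto simp: P_def)
      with f0 show False by simp
    qed
    from wg have "g holomorphic_on UNIV" by (simp add: P_def)
    from entire_divide_linear_factor[OF this gz \<open>z \<noteq> 0\<close>]
    obtain g' where g': "g' holomorphic_on UNIV" "\<And>x. g x = (1 - x / z) * g' x" by blast
    have "P (z # ws) g'" using wg g' z \<open>z \<noteq> 0\<close> by (auto simp: P_def)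
    hence "Q (Suc m)" using wg(2) unfolding Q_def by (intro exI[of _ "z # ws"] exI[of _ g']) simp
    hence "Suc m \<le> m" unfolding m_def by (rule Greatest_le_nat[of Q _ N]) (use QN in auto)
    then show False by simp
  qed
  have fw: "f w = 0" if "w \<in> set ws" for w
  proof -
    have "w \<noteq> 0" using that wg by (auto simp: P_def)
    hence "(\<Prod>v\<leftarrow>ws. 1 - w / v) = 0" using that by (auto simp: prod_list_zero_iff)
    then show ?thesis using wg by (simp add: P_def)
  qed
  show ?thesis using that[of ws g] wg fw nz by (auto simp: P_def)
qed

text \<open>Where Re h < A, the value of h is closer to 0 than to 2A, so h/(2A - h) maps the disc
  into the unit disc and fixes 0. Schwarz' lemma, solved for |h|, gives the estimate.\<close>

lemma borel_caratheodory:
  assumes h: "h holomorphic_on ball 0 R" and h0: "h 0 = 0" and A: "A > 0" and le: "\<And>z. norm z < R \<Longrightarrow> Re (h z) < A"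
    and z: "norm z < R"
  shows "norm (h z) \<le> 2 * A * norm z / (R - norm z)"
proof -
  have R: "R > 0" using z norm_ge_zero[of z] by linarith
  have lt: "norm (h w) < norm (2 * A - h w)" if "norm w < R" for w
  proof -
    have "(norm (2 * A - h w))\<^sup>2 - (norm (h w))\<^sup>2 = 4 * A * (A - Re (h w))"
      unfolding cmod_power2 by (simp add: power2_eq_square algebra_simps)
    also have "\<dots> > 0" using A le[OF that] by simp
    finally have "(norm (h w))\<^sup>2 < (norm (2 * A - h w))\<^sup>2" by simp
    then show ?thesis by (rule power2_less_imp_less) auto
  qed
  have nz: "2 * A - h w \<noteq> 0" if "norm w < R" for w using lt[OF that] by auto
  define \<phi> where "\<phi> w = h (R * w) / (2 * A - h (R * w))" for w :: complex
  have Rw: "norm (R * w) < R" if "norm w < 1" for w :: complex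
    using that R by (simp add: norm_mult)
  have hR: "(\<lambda>w. h (R * w)) holomorphic_on ball 0 1"
  proof -
    have "(h \<circ> (\<lambda>w. of_real R * w)) holomorphic_on ball 0 1"
      by (rule holomorphic_on_compose_gen[OF _ h]) (auto intro!: holomorphic_intros simp: Rw)
    then show ?thesis by (simp add: o_def)
  qed
  have "\<phi> holomorphic_on ball 0 1"
    unfolding \<phi>_def using nz Rw by (intro holomorphic_intros hR) auto
  moreover have "\<phi> 0 = 0" by (simp add: \<phi>_def h0)
  moreover have "norm (\<phi> w) < 1" if "norm w < 1" for w
    using lt[OF Rw[OF that]] nz[OF Rw[OF that]] by (simp add: \<phi>_def norm_divide pos_divide_less_eq)
  moreover have zR: "norm (z / R) < 1" using z R by (simp add: norm_divide)
  ultimately have "norm (\<phi> (z / R)) \<le> norm (z / R)"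
    by (metis Schwarz_Lemma(1))
  hence "norm (h z) / norm (2 * A - h z) \<le> norm z / R" using R by (simp add: \<phi>_def norm_divide)
  hence "norm (h z) * R \<le> norm z * norm (2 * A - h z)"
    using R nz[OF z] by (simp add: field_simps)
  also have "\<dots> \<le> norm z * (2 * A + norm (h z))"
    using norm_triangle_ineq4[of "of_real (2 * A)" "h z"] A by (intro mult_left_mono) auto
  finally show ?thesis using z by (simp add: field_simps)
qed

text \<open>After the zeros of modulus below n + 1 are divided out, the normalised quotient is exp
  of a holomorphic function on that disc. The bound for f on the circle of radius 2 (n + 1) limits
  its real part by a constant plus 2 \<epsilon> (n + 1), so at a fixed z the Borel-Caratheodory
  estimate tends to 4 \<epsilon> |z|. As \<epsilon> is arbitrary, the quotient tends to 1.\<close>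

theorem entire_order_lt_1_product:
  assumes f: "f holomorphic_on UNIV" and f0: "f 0 \<noteq> 0"
    and growth: "\<And>\<epsilon>. \<epsilon> > 0 \<Longrightarrow> \<exists>C. \<forall>z. norm (f z) \<le> C * exp (\<epsilon> * norm z)"
  obtains ws :: "nat \<Rightarrow> complex list" where
    "\<And>n w. w \<in> set (ws n) \<Longrightarrow> w \<noteq> 0 \<and> f w = 0"
    "\<And>w. f w = 0 \<Longrightarrow> \<forall>\<^sub>F n in sequentially. w \<in> set (ws n)"
    "\<And>z. (\<lambda>n. f 0 * (\<Prod>w\<leftarrow>ws n. 1 - z / w)) \<longlonglongrightarrow> f z"
proof -
  have "\<exists>ws g. (\<forall>w\<in>set ws. norm w < real (Suc n) \<and> w \<noteq> 0 \<and> f w = 0) \<and> g holomorphic_on UNIV \<and>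
      (\<forall>z. f z = (\<Prod>w\<leftarrow>ws. 1 - z / w) * g z) \<and> (\<forall>z. norm z < real (Suc n) \<longrightarrow> g z \<noteq> 0)" for n
    by (rule entire_factor_zeros_in_disc[OF f f0, of "real (Suc n)"]) (simp, blast)
  then obtain ws g where wg: "\<And>n w. w \<in> set (ws n) \<Longrightarrow> norm w < real (Suc n) \<and> w \<noteq> 0 \<and> f w = 0"
    "\<And>n. g n holomorphic_on UNIV" "\<And>n z. f z = (\<Prod>w\<leftarrow>ws n. 1 - z / w) * g n z"
    "\<And>n z. norm z < real (Suc n) \<Longrightarrow> g n z \<noteq> 0" by metis
  have gt_Suc: "\<exists>n. norm z < real (Suc n)" for z :: complex
  proof -
    obtain n where "norm z < real n" using reals_Archimedean2 by blast
    then show ?thesis by (intro exI[of _ n]) simp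
  qed
  have g0: "g n 0 = f 0" for n
  proof -
    have "(\<Prod>w\<leftarrow>xs. 1 - 0 / w) = (1 :: complex)" for xs by (induction xs) auto
    then show ?thesis using wg(3)[of 0 n] by simp
  qed
  have lim: "(\<lambda>n. g n z / f 0) \<longlonglongrightarrow> 1" for z
  proof -
    \<comment> \<open>The estimate is stated for all C and \<epsilon> at once, so that the logarithm
      h n is fixed before \<epsilon> and can be shown to tend to 0.\<close>
    have "\<exists>h. \<forall>n. norm z < real (Suc n) \<longrightarrow> g n z / f 0 = exp (h n) \<and>
      (\<forall>C \<epsilon>. \<epsilon> > 0 \<longrightarrow> (\<forall>z. norm (f z) \<le> C * exp (\<epsilon> * norm z)) \<longrightarrow>
         norm (h n) \<le> 2 * (ln (C / norm (f 0)) + \<epsilon> * 2 * real (Suc n) + 1) * norm z / (real (Suc n) - norm z))"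
    proof (rule choice, rule allI)
      fix n
      have "(\<lambda>z. g n z / f 0) holomorphic_on ball 0 (real (Suc n))"
        using f0 by (intro holomorphic_intros holomorphic_on_subset[OF wg(2)]) auto
      from contractible_imp_holomorphic_log[OF this convex_imp_contractible[OF convex_ball]]
      obtain h where h: "h holomorphic_on ball 0 (real (Suc n))" "\<And>w. w \<in> ball 0 (real (Suc n)) \<Longrightarrow> g n w / f 0 = exp (h w)"
        using wg(4)[of _ n] f0 by (auto simp del: of_nat_Suc)
      have e0: "exp (h 0) = 1" using h(2)[of 0] f0 g0 by simp
      \<comment> \<open>As exp (h 0) = 1, subtracting h 0 keeps the exponential and selects the
        branch that vanishes at 0.\<close>
      define k where "k w = h w - h 0" for w
      have ek: "g n w / f 0 = exp (k w)" if "norm w < real (Suc n)" for w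
        using h(2)[of w] that e0 by (simp add: k_def exp_diff)
      have kh: "k holomorphic_on ball 0 (real (Suc n))" unfolding k_def by (intro holomorphic_intros h)
      show "\<exists>y. norm z < real (Suc n) \<longrightarrow> g n z / f 0 = exp y \<and>
      (\<forall>C \<epsilon>. \<epsilon> > 0 \<longrightarrow> (\<forall>z. norm (f z) \<le> C * exp (\<epsilon> * norm z)) \<longrightarrow>
         norm y \<le> 2 * (ln (C / norm (f 0)) + \<epsilon> * 2 * real (Suc n) + 1) * norm z / (real (Suc n) - norm z))"
      proof (intro exI[of _ "k z"] impI conjI allI)
        assume z: "norm z < real (Suc n)"
        show "g n z / f 0 = exp (k z)" by (rule ek[OF z])
        fix C \<epsilon> :: real assume \<epsilon>: "\<epsilon> > 0" and C: "\<forall>z. norm (f z) \<le> C * exp (\<epsilon> * norm z)"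
        have C0: "norm (f 0) \<le> C" using C[rule_format, of 0] by simp
        hence Cpos: "C > 0" using zero_less_norm_iff[of "f 0"] f0 by linarith
        show "norm (k z) \<le> 2 * (ln (C / norm (f 0)) + \<epsilon> * 2 * real (Suc n) + 1) * norm z / (real (Suc n) - norm z)"
        proof (rule borel_caratheodory[OF kh])
          show "k 0 = 0" by (simp add: k_def)
          have "ln (C / norm (f 0)) \<ge> 0" using C0 f0 by (intro ln_ge_zero) (simp add: field_simps)
          then show "ln (C / norm (f 0)) + \<epsilon> * 2 * real (Suc n) + 1 > 0" using \<epsilon> by (intro add_nonneg_pos add_nonneg_nonneg) auto
          fix w :: complex assume w: "norm w < real (Suc n)"
          have "(2 - 1) ^ length (ws n) * norm (g n w) \<le> C * exp (\<epsilon> * (2 * real (Suc n)))"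
          proof (rule entire_div_prod_bound[OF wg(2,3), where R = "real (Suc n)"])
            fix z :: complex assume "norm z = 2 * real (Suc n)"
            then show "norm (f z) \<le> C * exp (\<epsilon> * (2 * real (Suc n)))" using C by metis
          qed (use wg(1) w in auto)
          hence "norm (g n w / f 0) \<le> C / norm (f 0) * exp (\<epsilon> * (2 * real (Suc n)))"
            by (simp add: norm_divide divide_right_mono)
          also have "norm (g n w / f 0) = exp (Re (k w))" unfolding ek[OF w] by simp
          also have "C / norm (f 0) = exp (ln (C / norm (f 0)))" using Cpos f0 by simp
          finally have "exp (Re (k w)) \<le> exp (ln (C / norm (f 0)) + \<epsilon> * (2 * real (Suc n)))" by (simp only: exp_add)
          then show "Re (k w) < ln (C / norm (f 0)) + \<epsilon> * 2 * real (Suc n) + 1" by (simp add: algebra_simps)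
        qed (rule z)
      qed
    qed
    then obtain h where h1: "\<And>n. norm z < real (Suc n) \<Longrightarrow> g n z / f 0 = exp (h n)"
      and h2: "\<And>n C \<epsilon>. norm z < real (Suc n) \<Longrightarrow> \<epsilon> > 0 \<Longrightarrow> \<forall>z. norm (f z) \<le> C * exp (\<epsilon> * norm z) \<Longrightarrow>
         norm (h n) \<le> 2 * (ln (C / norm (f 0)) + \<epsilon> * 2 * real (Suc n) + 1) * norm z / (real (Suc n) - norm z)"
      by blast
    obtain n0 where n0: "norm z < real (Suc n0)" using gt_Suc[of z] by blast
    have ev: "\<forall>\<^sub>F n in sequentially. norm z < real (Suc n)"
      unfolding eventually_sequentially using n0 by (intro exI[of _ n0]) auto
    have "h \<longlonglongrightarrow> 0"
    proof (rule tendstoI)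
      fix e :: real assume e: "e > 0"
      \<comment> \<open>Makes the limit 4 \<epsilon> |z| of the estimate smaller than e; the added 1
        covers z = 0.\<close>
      define \<epsilon> where "\<epsilon> = e / (8 * (norm z + 1))"
      have \<epsilon>: "\<epsilon> > 0" using e by (simp add: \<epsilon>_def add_nonneg_pos)
      obtain C where C: "\<forall>z. norm (f z) \<le> C * exp (\<epsilon> * norm z)" using growth[OF \<epsilon>] by blast
      define L r where "L = ln (C / norm (f 0))" and "r = norm z"
      have "(\<lambda>n. 2 * (L + \<epsilon> * 2 * real (Suc n) + 1) * r / (real (Suc n) - r)) \<longlonglongrightarrow> 4 * \<epsilon> * r"
        by real_asymp
      moreover have "4 * \<epsilon> * r < e"
      proof -
        have "r \<ge> 0" by (simp add: r_def)
        then show ?thesis using e unfolding \<epsilon>_def r_def[symmetric] by (simp add: field_simps add_pos_nonneg)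
      qed
      ultimately have "\<forall>\<^sub>F n in sequentially. 2 * (L + \<epsilon> * 2 * real (Suc n) + 1) * r / (real (Suc n) - r) < e"
        by (rule order_tendstoD)
      with ev show "\<forall>\<^sub>F n in sequentially. dist (h n) 0 < e"
      proof eventually_elim
        case (elim n)
        from h2[OF elim(1) \<epsilon> C] elim(2) show ?case unfolding L_def r_def by simp
      qed
    qed
    hence "(\<lambda>n. exp (h n)) \<longlonglongrightarrow> exp 0" by (intro tendsto_intros)
    moreover have "\<forall>\<^sub>F n in sequentially. exp (h n) = g n z / f 0"
      using ev by eventually_elim (simp add: h1)
    ultimately show ?thesis by (simp add: Lim_transform_eventually)
  qed
  show ?thesis
  proof (rule that)
    show "w \<noteq> 0 \<and> f w = 0" if "w \<in> set (ws n)" for n w using wg(1)[OF that] by simp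
    show "\<forall>\<^sub>F n in sequentially. w \<in> set (ws n)" if "f w = 0" for w
    proof -
      obtain n0 where n0: "norm w < real (Suc n0)" using gt_Suc[of w] by blast
      have "w \<in> set (ws n)" if "n \<ge> n0" for n
      proof -
        have "g n w \<noteq> 0" using n0 that by (intro wg(4)) auto
        hence "(\<Prod>v\<leftarrow>ws n. 1 - w / v) = 0" using wg(3)[of w n] \<open>f w = 0\<close> by simp
        then show ?thesis by (auto simp: prod_list_zero_iff)
      qed
      then show ?thesis by (auto simp: eventually_sequentially)
    qed
    show "(\<lambda>n. f 0 * (\<Prod>w\<leftarrow>ws n. 1 - z / w)) \<longlonglongrightarrow> f z" for z
    proof -
      have "(\<lambda>n. f z / (g n z / f 0)) \<longlonglongrightarrow> f z / 1"
        by (intro tendsto_intros lim) auto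
      moreover have "\<forall>\<^sub>F n in sequentially. f z / (g n z / f 0) = f 0 * (\<Prod>w\<leftarrow>ws n. 1 - z / w)"
      proof -
        obtain n0 where n0: "norm z < real (Suc n0)" using gt_Suc[of z] by blast
        have "g n z \<noteq> 0" if "n \<ge> n0" for n using n0 that by (intro wg(4)) auto
        hence "f z / (g n z / f 0) = f 0 * (\<Prod>w\<leftarrow>ws n. 1 - z / w)" if "n \<ge> n0" for n
          using that f0 wg(3)[of z n] by simp
        then show ?thesis by (auto simp: eventually_sequentially)
      qed
      ultimately show ?thesis by (simp add: Lim_transform_eventually)
    qed
  qed
qed

section \<open>Variation diminution\<close>

lemma sum_skip:
  fixes f :: "nat \<Rightarrow> 'a::comm_monoid_add"
  assumes "j \<le> k"
  shows "(\<Sum>i<Suc k. f i) = f j + (\<Sum>i<k. f (if i < j then i else Suc i))"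
proof -
  define s where "s i = (if i < j then i else Suc i)" for i
  have inj: "inj_on s {..<k}" by (auto simp: inj_on_def s_def split: if_splits)
  have "s ` {..<k} = {..<Suc k} - {j}"
  proof (intro subset_antisym subsetI)
    fix x assume "x \<in> {..<Suc k} - {j}"
    hence "x = s (if x < j then x else x - 1)" "(if x < j then x else x - 1) \<in> {..<k}"
      using assms by (auto simp: s_def)
    then show "x \<in> s ` {..<k}" by blast
  qed (use assms in \<open>auto simp: s_def\<close>)
  hence "(\<Sum>i\<in>{..<Suc k} - {j}. f i) = (\<Sum>i<k. f (s i))"
    using sum.reindex[OF inj, of f] by (simp add: o_def)
  then show ?thesis using assms by (subst sum.remove[of _ j]) (auto simp: s_def)
qed

text \<open>If the leading square minor is nonzero, expanding the vanishing determinant of the matrix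
  bordered by \<open>q\<close> along \<open>q\<close> gives a sum of nonnegative terms, not all zero. Otherwise one
  column depends on the others on the first rows and can be dropped together with the last row.\<close>
theorem totally_nonnegative_no_alternation:
  fixes A :: "nat \<Rightarrow> nat \<Rightarrow> real"
  assumes tn: "\<And>n a b. strict_mono_on {..<n} a \<Longrightarrow> strict_mono_on {..<n} b \<Longrightarrow> (\<forall>i<n. a i \<le> k) \<Longrightarrow> (\<forall>j<n. b j < k) \<Longrightarrow>
      det_fun n (\<lambda>i j. A (a i) (b j)) \<ge> 0"
    and q: "\<And>i. i \<le> k \<Longrightarrow> q i = (\<Sum>j<k. c j * A i j)"
    and alt: "\<And>i. i \<le> k \<Longrightarrow> (-1) ^ i * q i > 0"
  shows False
  using assms
proof (induction k arbitrary: A c)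
  case 0
  from 0(2)[of 0] 0(3)[of 0] show ?case by simp
next
  case (Suc k)
  define m where "m = Suc k"
  define D where "D = det_fun m (\<lambda>i j. A i j)"
  show ?case
  proof (cases "D = 0")
    case False
    define B where "B = Matrix.mat (Suc m) (Suc m) (\<lambda>(i, j). if j < m then A i j else q i)"
    have B: "B \<in> carrier_mat (Suc m) (Suc m)" by (simp add: B_def)
    \<comment> \<open>Since q is the combination of the columns of A with coefficients c, appending
      -1 gives a nonzero kernel vector of the bordered matrix.\<close>
    define v where "v = Matrix.vec (Suc m) (\<lambda>j. if j < m then c j else - 1)"
    have "v $ m \<noteq> 0" by (simp add: v_def)
    hence v0: "v \<noteq> 0\<^sub>v (Suc m)" by auto
    have "B *\<^sub>v v = 0\<^sub>v (Suc m)"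
    proof (rule eq_vecI)
      fix i assume "i < dim_vec (0\<^sub>v (Suc m) :: real vec)"
      hence i: "i < Suc m" by simp
      have "(B *\<^sub>v v) $ i = (\<Sum>j<Suc m. (if j < m then A i j else q i) * (if j < m then c j else - 1))"
        using i by (simp add: B_def v_def scalar_prod_def atLeast0LessThan del: sum.lessThan_Suc)
      also have "\<dots> = (\<Sum>j<m. c j * A i j) - q i" by (simp add: mult.commute)
      also have "\<dots> = 0" using Suc.prems(2)[of i] i by (simp add: m_def)
      finally show "(B *\<^sub>v v) $ i = 0\<^sub>v (Suc m) $ i" using i by simp
    qed (simp add: B_def)
    hence "Determinant.det B = 0"
      using det_0_iff_vec_prod_zero[OF B] v0 by (intro iffD2[OF det_0_iff_vec_prod_zero[OF B]] exI[of _ v]) (auto simp: v_def)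
    moreover define M where "M i = Determinant.det (mat_delete B i m)" for i
    have M: "M i = det_fun m (\<lambda>r s. A (if r < i then r else Suc r) s)" if "i \<le> m" for i
      unfolding M_def mat_delete_def
      by (intro arg_cong[where f = Determinant.det] eq_matI) (use that in \<open>auto simp: B_def\<close>)
    have "Determinant.det B = (\<Sum>i<Suc m. B $$ (i, m) * cofactor B i m)"
      by (rule laplace_expansion_column[OF B]) simp
    also have "\<dots> = (\<Sum>i<Suc m. (-1) ^ m * ((-1) ^ i * q i * M i))"
      by (intro sum.cong) (auto simp: B_def cofactor_def M_def power_add)
    also have "\<dots> = (-1) ^ m * (\<Sum>i<Suc m. (-1) ^ i * q i * M i)" by (rule sum_distrib_left[symmetric])
    ultimately have s0: "(\<Sum>i<Suc m. (-1) ^ i * q i * M i) = 0" by simp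
    have M0: "M i \<ge> 0" if "i \<le> m" for i
      unfolding M[OF that]
      by (rule Suc.prems(1)[of m "\<lambda>r. if r < i then r else Suc r" "\<lambda>s. s"])
         (auto simp: strict_mono_on_def m_def)
    have nn: "(-1) ^ i * q i * M i \<ge> 0" if "i \<in> {..<Suc m}" for i
      using that by (intro mult_nonneg_nonneg[OF less_imp_le[OF Suc.prems(3)] M0]) (auto simp: m_def)
    have "(-1) ^ m * q m * M m = 0"
      using s0 nn sum_nonneg_eq_0_iff[of "{..<Suc m}" "\<lambda>i. (-1) ^ i * q i * M i"] by blast
    moreover have "(-1) ^ m * q m \<noteq> 0" using Suc.prems(3)[OF eq_refl[OF m_def]] by (metis less_irrefl)
    ultimately have "M m = 0" by (metis mult_eq_0_iff)
    moreover have "M m = D"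
      unfolding M[OF order_refl] D_def by (intro arg_cong[where f = Determinant.det] eq_matI) auto
    ultimately show False using False by simp
  next
    case True
    define B where "B = Matrix.mat m m (\<lambda>(i, j). A i j)"
    have B: "B \<in> carrier_mat m m" by (simp add: B_def)
    from True obtain v where v: "v \<in> carrier_vec m" "v \<noteq> 0\<^sub>v m" "B *\<^sub>v v = 0\<^sub>v m"
      using det_0_iff_vec_prod_zero[OF B] by (auto simp: D_def B_def)
    obtain j0 where j0: "j0 < m" "v $ j0 \<noteq> 0"
    proof -
      have "\<exists>j<m. v $ j \<noteq> 0"
      proof (rule ccontr)
        assume "\<not> ?thesis"
        hence "v = 0\<^sub>v m" using v(1) by (intro eq_vecI) auto
        with v(2) show False by simp
      qed
      then show ?thesis using that by blast
    qed
    have vz: "(\<Sum>j<m. A i j * v $ j) = 0" if "i < m" for i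
    proof -
      have "(B *\<^sub>v v) $ i = (\<Sum>j<m. A i j * v $ j)"
        using that v(1) by (simp add: B_def scalar_prod_def atLeast0LessThan)
      then show ?thesis using v(3) that by simp
    qed
    \<comment> \<open>Subtracting a multiple of the kernel vector leaves q unchanged on rows 0 to k
      and removes the coefficient of column j0; these rows and the other k columns form the smaller
      instance.\<close>
    define c' where "c' j = c j - c j0 / v $ j0 * v $ j" for j
    define s where "s j = (if j < j0 then j else Suc j)" for j
    have sm: "strict_mono_on {..<n} (\<lambda>j. s (b j))" if "strict_mono_on {..<n} b" for n and b :: "nat \<Rightarrow> nat"
    proof (rule strict_mono_onI)
      fix i j assume "i \<in> {..<n}" "j \<in> {..<n}" "i < j"
      hence "b i < b j" using strict_mono_onD[OF that] by blast
      then show "s (b i) < s (b j)" by (auto simp: s_def)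
    qed
    show False
    proof (rule Suc.IH[of "\<lambda>i j. A i (s j)" "\<lambda>j. c' (s j)"])
      fix n :: nat and a b :: "nat \<Rightarrow> nat"
      assume ab: "strict_mono_on {..<n} a" "strict_mono_on {..<n} b" "\<forall>i<n. a i \<le> k" "\<forall>j<n. b j < k"
      show "det_fun n (\<lambda>i j. A (a i) (s (b j))) \<ge> 0"
      proof (rule Suc.prems(1)[of n a "\<lambda>j. s (b j)"])
        show "\<forall>i<n. a i \<le> Suc k" using ab(3) by auto
        show "\<forall>j<n. s (b j) < Suc k" using ab(4) by (auto simp: s_def less_Suc_eq)
      qed (use ab sm in auto)
    next
      fix i assume i: "i \<le> k"
      have "q i = (\<Sum>j<m. c j * A i j) - c j0 / v $ j0 * (\<Sum>j<m. A i j * v $ j)"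
        using Suc.prems(2)[of i] vz[of i] i by (simp add: m_def)
      also have "\<dots> = (\<Sum>j<m. c' j * A i j)"
        by (simp add: c'_def sum_distrib_left left_diff_distrib right_diff_distrib sum_subtractf mult_ac)
      also have "\<dots> = c' j0 * A i j0 + (\<Sum>j<k. c' (s j) * A i (s j))"
        unfolding m_def s_def by (rule sum_skip) (use j0 in \<open>simp add: m_def\<close>)
      also have "c' j0 = 0" using j0 by (simp add: c'_def)
      finally show "q i = (\<Sum>j<k. c' (s j) * A i (s j))" by simp
    next
      fix i assume "i \<le> k"
      then show "(-1) ^ i * q i > 0" using Suc.prems(3)[of i] by simp
    qed
  qed
qed

text \<open>Between consecutive real zeros the polynomial has constant sign, so its convolution with
  the kernel is a combination of \<open>card R + 1\<close> functions forming a totally nonnegative system.\<close>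
theorem tp_convolution_poly_alternation:
  fixes g :: "real \<Rightarrow> real" and p :: "real poly" and x :: "nat \<Rightarrow> real"
  assumes tp: "tp_dets g" and gm [measurable]: "g \<in> borel_measurable borel" and p0: "p \<noteq> 0"
    and int: "\<And>x. integrable lborel (\<lambda>y. g (x - y) * poly p y)"
    and x: "strict_mono_on {..k} x" and k: "k = Suc (card {y. poly p y = 0})"
    and alt: "\<And>i. i \<le> k \<Longrightarrow> (-1) ^ i * (s * (LBINT y. g (x i - y) * poly p y)) > 0"
  shows False
proof -
  define R where "R = {y. poly p y = 0}"
  have fR: "finite R" unfolding R_def using p0 by (rule poly_roots_finite)
  have kR: "k = Suc (card R)" by (simp add: k R_def)
  \<comment> \<open>The number of the interval containing y, counted by the zeros to its left; a
    zero itself belongs to the interval that ends there.\<close>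
  define idx where "idx y = card {r \<in> R. r < y}" for y
  have idx_le: "idx y \<le> card R" for y unfolding idx_def using fR by (intro card_mono) auto
  have idx_mono: "idx y \<le> idx z" if "y \<le> z" for y z
    unfolding idx_def using fR that by (intro card_mono) auto
  have meas: "{y. idx y = j} \<in> sets borel" for j
  proof -
    have "real (idx y) = (\<Sum>r\<in>R. indicator {r<..} y)" for y
    proof -
      have "(\<Sum>r\<in>R. indicator {r<..} y) = (\<Sum>r\<in>R. if r < y then 1 else (0::real))"
        by (intro sum.cong) (auto simp: indicator_def)
      also have "\<dots> = (\<Sum>r\<in>{r\<in>R. r < y}. 1)" by (rule sum.inter_filter[OF fR, symmetric])
      finally show ?thesis by (simp add: idx_def)
    qed
    hence "(\<lambda>y. real (idx y)) \<in> borel_measurable borel" by simp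
    hence "{y \<in> space borel. real (idx y) = real j} \<in> sets borel" by measurable
    then show ?thesis by simp
  qed
  note meas [measurable]
  have [measurable]: "poly p \<in> borel_measurable borel"
    by (intro borel_measurable_continuous_onI continuous_on_poly continuous_on_id)
  define h where "h j y = \<bar>poly p y\<bar> * indicator {y. idx y = j} y" for j y
  \<comment> \<open>The sign of p on the j-th interval, with default 1 where p takes no negative
    value.\<close>
  define \<sigma> where "\<sigma> j = (if \<exists>y. idx y = j \<and> poly p y < 0 then - 1 else 1 :: real)" for j
  have same: "poly p z < 0" if "idx y = idx z" "poly p y < 0" "poly p z \<noteq> 0" for y z
  proof (rule ccontr)
    assume "\<not> poly p z < 0"
    hence pz: "poly p z > 0" using that by simp
    have "y \<noteq> z" using pz that by auto
    define u w where "u = min y z" and "w = max y z"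
    have uw: "u < w" "idx u = idx w" using \<open>y \<noteq> z\<close> that(1) by (auto simp: u_def w_def min_def max_def)
    have "\<exists>r. u < r \<and> r < w \<and> poly p r = 0"
    proof (cases "y < z")
      case True
      then show ?thesis using poly_IVT_pos[of y z p] that(2) pz by (auto simp: u_def w_def)
    next
      case False
      then show ?thesis using poly_IVT_neg[of z y p] that(2) pz \<open>y \<noteq> z\<close> by (auto simp: u_def w_def)
    qed
    then obtain r where r: "u < r" "r < w" "r \<in> R" by (auto simp: R_def)
    have "r \<in> {s \<in> R. s < w}" "r \<notin> {s \<in> R. s < u}" "{s \<in> R. s < u} \<subseteq> {s \<in> R. s < w}" using r uw by auto
    hence "{s \<in> R. s < u} \<subset> {s \<in> R. s < w}" by blast
    hence "idx u < idx w" unfolding idx_def using fR by (intro psubset_card_mono) auto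
    with uw show False by simp
  qed
  have sgn: "poly p y = \<sigma> (idx y) * \<bar>poly p y\<bar>" for y
  proof (cases "poly p y = 0")
    case False
    then show ?thesis using same[of _ y] by (auto simp: \<sigma>_def abs_if)
  qed simp
  have decomp: "g (a - y) * poly p y = (\<Sum>j<k. \<sigma> j * (g (a - y) * h j y))" for a y
  proof -
    have "(\<Sum>j<k. \<sigma> j * (g (a - y) * h j y)) = (\<Sum>j<k. if j = idx y then \<sigma> j * (g (a - y) * \<bar>poly p y\<bar>) else 0)"
      by (intro sum.cong) (auto simp: h_def)
    also have "\<dots> = \<sigma> (idx y) * (g (a - y) * \<bar>poly p y\<bar>)"
      using idx_le[of y] kR by (simp add: less_Suc_eq_le)
    also have "\<dots> = g (a - y) * (\<sigma> (idx y) * \<bar>poly p y\<bar>)" by simp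
    finally show ?thesis using sgn[of y] by simp
  qed
  have inth: "integrable lborel (\<lambda>y. g (a - y) * h j y)" for a j
  proof (rule Bochner_Integration.integrable_bound[OF int[of a]])
    show "(\<lambda>y. g (a - y) * h j y) \<in> borel_measurable lborel"
      unfolding h_def by measurable
    show "AE y in lborel. norm (g (a - y) * h j y) \<le> norm (g (a - y) * poly p y)"
      by (intro AE_I2) (auto simp: h_def abs_mult indicator_def)
  qed
  define A where "A i j = (LBINT y. g (x i - y) * h j y)" for i j
  show False
  proof (rule totally_nonnegative_no_alternation[where k = k and A = A and c = "\<lambda>j. s * \<sigma> j" and q = "\<lambda>i. s * (LBINT y. g (x i - y) * poly p y)"])
    fix n :: nat and a b :: "nat \<Rightarrow> nat"
    assume ab: "strict_mono_on {..<n} a" "strict_mono_on {..<n} b" "\<forall>i<n. a i \<le> k" "\<forall>j<n. b j < k"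
    have xa: "strict_mono_on {..<n} (\<lambda>i. x (a i))"
      using ab x by (auto simp: strict_mono_on_def)
    have "det_fun n (\<lambda>i j. A (a i) (b j))
      = (\<integral>t. det_fun n (\<lambda>i j. g (x (a i) - t j)) * (\<Prod>j<n. h (b j) (t j)) \<partial>Pi\<^sub>M {..<n} (\<lambda>_. lborel))"
      unfolding A_def by (rule integral_det_columns[of n "\<lambda>i t. g (x (a i) - t)" "\<lambda>j. h (b j)", symmetric]) (rule inth)
    also have "\<dots> \<ge> 0"
    proof (rule Bochner_Integration.integral_nonneg)
      fix t :: "nat \<Rightarrow> real"
      \<comment> \<open>The factors h confine t j to the interval numbered b j. As the b j increase,
        so do the t j, and total positivity applies.\<close>
      show "det_fun n (\<lambda>i j. g (x (a i) - t j)) * (\<Prod>j<n. h (b j) (t j)) \<ge> 0"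
      proof (cases "\<forall>j<n. idx (t j) = b j")
        case True
        have "strict_mono_on {..<n} t"
        proof (rule strict_mono_onI)
          fix i j assume ij: "i \<in> {..<n}" "j \<in> {..<n}" "i < j"
          hence "b i < b j" using strict_mono_onD[OF ab(2)] by blast
          hence "idx (t i) < idx (t j)" using True ij by simp
          then show "t i < t j" using idx_mono[of "t j" "t i"] by (meson not_le)
        qed
        hence "det_fun n (\<lambda>i j. g (x (a i) - t j)) \<ge> 0"
          using tp_detsD[OF tp xa] by blast
        moreover have "(\<Prod>j<n. h (b j) (t j)) \<ge> 0" by (intro prod_nonneg) (auto simp: h_def)
        ultimately show ?thesis by (rule mult_nonneg_nonneg)
      next
        case False
        then obtain j where "j < n" "idx (t j) \<noteq> b j" by blast
        hence "(\<Prod>j<n. h (b j) (t j)) = 0" by (intro prod_zero) (auto simp: h_def intro!: bexI[of _ j])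
        then show ?thesis by (simp only: mult_zero_right order_refl)
      qed
    qed
    finally show "det_fun n (\<lambda>i j. A (a i) (b j)) \<ge> 0" .
  next
    fix i assume "i \<le> k"
    have "(LBINT y. g (x i - y) * poly p y) = (\<Sum>j<k. \<sigma> j * A i j)"
      unfolding decomp A_def using inth by (subst Bochner_Integration.integral_sum) auto
    then show "s * (LBINT y. g (x i - y) * poly p y) = (\<Sum>j<k. s * \<sigma> j * A i j)"
      by (simp add: sum_distrib_left mult.assoc)
  qed (rule alt)
qed

section \<open>From the Riemann hypothesis to total positivity\<close>

definition inv_fourier :: "(real \<Rightarrow> real) \<Rightarrow> real \<Rightarrow> complex" where
  "inv_fourier h x = 1 / (2 * of_real pi) * (LBINT \<tau>. of_real (h \<tau>) * exp (- \<i> * of_real x * of_real \<tau>))"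

lemma continuous_inv_fourier:
  assumes h: "integrable lborel h"
  shows "continuous_on UNIV (inv_fourier h)"
  unfolding continuous_on_sequentially
proof (intro allI ballI impI)
  fix X :: "nat \<Rightarrow> real" and x :: real assume "(\<forall>n. X n \<in> UNIV) \<and> X \<longlonglongrightarrow> x"
  hence X: "X \<longlonglongrightarrow> x" by simp
  have [measurable]: "h \<in> borel_measurable borel" using borel_measurable_integrable[OF h] by simp
  have "(\<lambda>n. LBINT \<tau>. of_real (h \<tau>) * exp (- \<i> * of_real (X n) * of_real \<tau>))
     \<longlonglongrightarrow> (LBINT \<tau>. of_real (h \<tau>) * exp (- \<i> * of_real x * of_real \<tau>))"
  proof (rule integral_dominated_convergence[where w = "\<lambda>\<tau>. \<bar>h \<tau>\<bar>"])
    show "AE \<tau> in lborel. (\<lambda>n. of_real (h \<tau>) * exp (- \<i> * of_real (X n) * of_real \<tau>)) \<longlonglongrightarrow> of_real (h \<tau>) * exp (- \<i> * of_real x * of_real \<tau>)"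
      by (intro AE_I2 tendsto_intros X)
    show "AE \<tau> in lborel. norm (of_real (h \<tau>) * exp (- \<i> * of_real (X n) * of_real \<tau>)) \<le> \<bar>h \<tau>\<bar>" for n
      by (intro AE_I2) (simp add: norm_mult)
  qed (use h in auto)
  then show "(inv_fourier h \<circ> X) \<longlonglongrightarrow> inv_fourier h x"
    unfolding inv_fourier_def o_def by (intro tendsto_intros)
qed

lemma inv_fourier_tendsto:
  assumes lim: "\<And>\<tau>. (\<lambda>n. h n \<tau>) \<longlonglongrightarrow> k \<tau>" and [measurable]: "\<And>n. h n \<in> borel_measurable borel"
    and w: "integrable lborel w" and dom: "\<And>n \<tau>. \<bar>h n \<tau>\<bar> \<le> w \<tau>"
  shows "(\<lambda>n. inv_fourier (h n) x) \<longlonglongrightarrow> inv_fourier k x"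
proof -
  have [measurable]: "k \<in> borel_measurable borel" by (rule borel_measurable_LIMSEQ_real[OF lim]) measurable
  have "(\<lambda>n. LBINT \<tau>. of_real (h n \<tau>) * exp (- \<i> * of_real x * of_real \<tau>))
     \<longlonglongrightarrow> (LBINT \<tau>. of_real (k \<tau>) * exp (- \<i> * of_real x * of_real \<tau>))"
  proof (rule integral_dominated_convergence[where w = w])
    show "AE \<tau> in lborel. (\<lambda>n. of_real (h n \<tau>) * exp (- \<i> * of_real x * of_real \<tau>)) \<longlonglongrightarrow> of_real (k \<tau>) * exp (- \<i> * of_real x * of_real \<tau>)"
      by (intro AE_I2 tendsto_intros lim)
    show "AE \<tau> in lborel. norm (of_real (h n \<tau>) * exp (- \<i> * of_real x * of_real \<tau>)) \<le> w \<tau>" for n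
      by (intro AE_I2) (simp add: norm_mult dom)
  qed (use w in auto)
  then show ?thesis unfolding inv_fourier_def by (intro tendsto_intros)
qed

text \<open>The invariant kept while Lorentzian factors are multiplied: g is a totally positive
  probability density and the inverse transform of h. The unit mass is recorded because it bounds
  the mass of the limit.\<close>

definition pf_pair :: "(real \<Rightarrow> real) \<Rightarrow> (real \<Rightarrow> real) \<Rightarrow> bool" where
  "pf_pair g h \<longleftrightarrow> tp_dets g \<and> integrable lborel g \<and> (LBINT x. g x) = 1 \<and> integrable lborel h \<and>
     (\<forall>x. of_real (g x) = inv_fourier h x)"

lemma integrable_lorentzian:
  assumes a: "a > (0::real)" shows "integrable lborel (\<lambda>\<tau>. 1 / (1 + \<tau>\<^sup>2 / a\<^sup>2))"
proof -
  have "integrable lborel (\<lambda>x::real. inverse (1 + x\<^sup>2))"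
    using integrable_inverse_1_plus_square by (simp add: set_integrable_def einterval_def)
  from lborel_integrable_real_affine[OF this, of "1 / a" 0] a
  show ?thesis by (simp add: power_divide inverse_eq_divide)
qed

lemma pf_pair_exp:
  assumes a: "a > 0"
  shows "pf_pair (\<lambda>x. a / 2 * exp (- (a * \<bar>x\<bar>))) (\<lambda>\<tau>. 1 / (1 + \<tau>\<^sup>2 / a\<^sup>2))"
  unfolding pf_pair_def
proof (intro conjI allI)
  define f where "f x = a / 2 * exp (- (a * \<bar>x\<bar>))" for x
  show "tp_dets (\<lambda>x. a / 2 * exp (- (a * \<bar>x\<bar>)))" using a by (intro tp_dets_scale tp_dets_exp_neg_abs) auto
  show int: "integrable lborel (\<lambda>x. a / 2 * exp (- (a * \<bar>x\<bar>)))" by (intro integrable_mult_right integrable_exp_neg_abs a)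
  show "(LBINT x. a / 2 * exp (- (a * \<bar>x\<bar>))) = 1" using integral_exp_neg_abs[OF a] a by simp
  show h: "integrable lborel (\<lambda>\<tau>. 1 / (1 + \<tau>\<^sup>2 / a\<^sup>2))" by (rule integrable_lorentzian[OF a])
  fix x
  have "of_real (f x) = 1 / (2 * of_real pi) * (LBINT \<tau>. of_real (1 / (1 + \<tau>\<^sup>2 / a\<^sup>2)) * exp (- \<i> * of_real x * of_real \<tau>))"
  proof (rule fourier_inversion[where f = f and F = "\<lambda>\<tau>. of_real (1 / (1 + \<tau>\<^sup>2 / a\<^sup>2))"])
    show "continuous_on UNIV f" unfolding f_def by (intro continuous_intros)
    show "integrable lborel f" unfolding f_def by (rule int)
    show "\<bar>f x\<bar> \<le> a / 2" for x unfolding f_def abs_mult using a by (intro order_trans[OF mult_left_le]) auto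
    show "of_real (1 / (1 + t\<^sup>2 / a\<^sup>2)) = (LBINT x. of_real (f x) * exp (\<i> * of_real t * of_real x))" for t
    proof -
      have "(LBINT x. of_real (f x) * exp (\<i> * of_real t * of_real x))
         = (LBINT x. of_real (a / 2) * (of_real (exp (- (a * \<bar>x\<bar>))) * exp (\<i> * of_real t * of_real x)))"
        unfolding f_def of_real_mult mult.assoc ..
      also have "\<dots> = of_real (a / 2) * of_real (2 * a / (a\<^sup>2 + t\<^sup>2))"
        by (subst integral_mult_right_zero) (simp only: has_bochner_integral_integral_eq[OF has_bochner_integral_exp_neg_abs_iexp[OF a]])
      also have "\<dots> = of_real (a / 2 * (2 * a / (a\<^sup>2 + t\<^sup>2)))" by (simp only: of_real_mult)
      also have "a / 2 * (2 * a / (a\<^sup>2 + t\<^sup>2)) = 1 / (1 + t\<^sup>2 / a\<^sup>2)"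
      proof -
        have "a\<^sup>2 + t\<^sup>2 > 0" using a by (simp add: add_pos_nonneg)
        moreover have "1 + t\<^sup>2 / a\<^sup>2 = (a\<^sup>2 + t\<^sup>2) / a\<^sup>2" using a by (simp add: field_simps)
        ultimately show ?thesis using a by (simp add: power2_eq_square)
      qed
      finally show ?thesis by simp
    qed
    show "complex_integrable lborel (\<lambda>\<tau>. of_real (1 / (1 + \<tau>\<^sup>2 / a\<^sup>2)))" using h by (rule integrable_of_real)
  qed
  then show "of_real (a / 2 * exp (- (a * \<bar>x\<bar>))) = inv_fourier (\<lambda>\<tau>. 1 / (1 + \<tau>\<^sup>2 / a\<^sup>2)) x"
    unfolding f_def inv_fourier_def .
qed

text \<open>Inserting the inversion formula for g into the convolution and exchanging integrals
  leaves, for each \<tau>, the transform of the exponential density, which is the new factor.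
  Boundedness of the exponential makes the convolution exist at every x.\<close>

lemma pf_pair_conv_exp:
  assumes a: "a > 0" and gh: "pf_pair g h"
  shows "\<exists>g'. pf_pair g' (\<lambda>\<tau>. 1 / (1 + \<tau>\<^sup>2 / a\<^sup>2) * h \<tau>)"
proof -
  define e where "e x = a / 2 * exp (- (a * \<bar>x\<bar>))" for x
  define l where "l \<tau> = 1 / (1 + \<tau>\<^sup>2 / a\<^sup>2)" for \<tau>
  from gh have g: "tp_dets g" "integrable lborel g" "(LBINT x. g x) = 1" "integrable lborel h"
    and inv: "\<And>x. of_real (g x) = inv_fourier h x" by (auto simp: pf_pair_def)
  have "pf_pair e l" unfolding e_def l_def by (rule pf_pair_exp[OF a])
  hence e: "tp_dets e" "integrable lborel e" "(LBINT x. e x) = 1" "integrable lborel l" by (auto simp: pf_pair_def)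
  have [measurable]: "g \<in> borel_measurable borel" "h \<in> borel_measurable borel" "e \<in> borel_measurable borel"
    using g e by (auto dest: borel_measurable_integrable)
  have eb: "norm (e x) \<le> a / 2" for x
    unfolding e_def real_norm_def abs_mult using a by (intro order_trans[OF mult_left_le]) auto
  have e0: "e x \<ge> 0" for x using a by (simp add: e_def)
  have lb: "norm (l \<tau>) \<le> 1" for \<tau>
  proof -
    define q where "q = \<tau>\<^sup>2 / a\<^sup>2"
    have "q \<ge> 0" by (simp add: q_def)
    then show ?thesis unfolding l_def q_def[symmetric] by (simp add: divide_le_eq_1)
  qed
  define g' where "g' x = (LBINT t. e (x - t) * g t)" for x
  have "tp_dets g'"
    unfolding g'_def
  proof (rule tp_dets_convolution[OF e(1) g(1)])
    fix x y
    have "integrable lborel (\<lambda>t. g (t - y))" using lborel_integrable_real_affine[OF g(2), of 1 "- y"] by simp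
    hence "integrable lborel (\<lambda>t. g (t - y) * e (x - t))" by (rule integrable_mult_bounded[OF _ _ eb]) measurable
    then show "integrable lborel (\<lambda>t. e (x - t) * g (t - y))" by (simp only: mult.commute)
  qed
  moreover have pair: "integrable (lborel \<Otimes>\<^sub>M lborel) (\<lambda>(t, x). e (x - t) * g t)"
  proof (rule lborel_pair.Fubini_integrable)
    have eint: "integrable lborel (\<lambda>x. e (x - t))" "(LBINT x. e (x - t)) = 1" for t
      using lborel_integrable_real_affine[OF e(2), of 1 "- t"] lborel_integral_real_affine[of 1 e "- t"] e(3) by auto
    have "(LBINT x. norm (case (t, x) of (t, x) \<Rightarrow> e (x - t) * g t)) = norm (g t)" for t
      using eint(2)[of t] e0 by (simp add: abs_mult)
    then show "integrable lborel (\<lambda>t. LBINT x. norm (case (t, x) of (t, x) \<Rightarrow> e (x - t) * g t))"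
      using g(2) by simp
    show "AE t in lborel. integrable lborel (\<lambda>x. case (t, x) of (t, x) \<Rightarrow> e (x - t) * g t)"
      using eint(1) by simp
  qed measurable
  have "integrable lborel g'"
    unfolding g'_def by (rule lborel_pair.integrable_snd[OF pair])
  moreover have "(LBINT x. g' x) = 1"
  proof -
    have "(LBINT x. g' x) = (LBINT t. (LBINT x. e (x - t) * g t))"
      unfolding g'_def by (rule lborel_pair.Fubini_integral[OF pair])
    also have "\<dots> = (LBINT t. g t)"
      using lborel_integral_real_affine[of 1 e "- _"] e(3) by simp
    finally show ?thesis using g(3) by simp
  qed
  moreover have "integrable lborel (\<lambda>\<tau>. l \<tau> * h \<tau>)"
    using integrable_mult_bounded[OF g(4), of l 1] lb e(4) by (simp add: mult.commute borel_measurable_integrable)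
  moreover have "of_real (g' x) = inv_fourier (\<lambda>\<tau>. l \<tau> * h \<tau>) x" for x
  proof -
    have "g' x = (LBINT t. e t * g (x - t))"
      unfolding g'_def using lborel_integral_real_affine[of "-1" "\<lambda>t. e (x - t) * g t" x] by simp
    hence "complex_of_real (g' x) = (LBINT t. of_real (e t * g (x - t)))" by (simp only: integral_complex_of_real)
    also have "\<dots> = (LBINT t. 1 / (2 * of_real pi) * (LBINT \<tau>. of_real (e t) * (of_real (h \<tau>) * exp (- \<i> * of_real (x - t) * of_real \<tau>))))"
      unfolding of_real_mult inv inv_fourier_def by (simp add: mult_ac)
    also have "\<dots> = 1 / (2 * of_real pi) * (LBINT t. (LBINT \<tau>. of_real (e t) * (of_real (h \<tau>) * exp (- \<i> * of_real (x - t) * of_real \<tau>))))"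
      by (rule integral_mult_right_zero)
    also have "(LBINT t. (LBINT \<tau>. of_real (e t) * (of_real (h \<tau>) * exp (- \<i> * of_real (x - t) * of_real \<tau>))))
       = (LBINT \<tau>. (LBINT t. of_real (e t) * (of_real (h \<tau>) * exp (- \<i> * of_real (x - t) * of_real \<tau>))))"
    proof (rule lborel_pair.Fubini_integral[symmetric])
      show "integrable (lborel \<Otimes>\<^sub>M lborel) (\<lambda>(t, \<tau>). of_real (e t) * (of_real (h \<tau>) * exp (- \<i> * of_real (x - t) * of_real \<tau>)))"
      proof (rule Bochner_Integration.integrable_bound[OF integrable_pair_lborel_mult[OF e(2) g(4)]])
        show "AE p in lborel \<Otimes>\<^sub>M lborel. norm (case p of (t, \<tau>) \<Rightarrow> of_real (e t) * (of_real (h \<tau>) * exp (- \<i> * of_real (x - t) * of_real \<tau>)))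
          \<le> norm (case p of (t, \<tau>) \<Rightarrow> e t * h \<tau>)"
          by (intro AE_I2) (auto simp: norm_mult abs_mult split: prod.splits)
      qed measurable
    qed
    also have "\<dots> = (LBINT \<tau>. of_real (l \<tau> * h \<tau>) * exp (- \<i> * of_real x * of_real \<tau>))"
    proof (rule Bochner_Integration.integral_cong[OF refl])
      fix \<tau>
      have "(LBINT t. of_real (e t) * (of_real (h \<tau>) * exp (- \<i> * of_real (x - t) * of_real \<tau>)))
        = (LBINT t. (of_real (a / 2) * of_real (h \<tau>) * exp (- \<i> * of_real x * of_real \<tau>)) * (of_real (exp (- (a * \<bar>t\<bar>))) * exp (\<i> * of_real \<tau> * of_real t)))"
      proof (rule Bochner_Integration.integral_cong[OF refl])
        fix t
        have "- \<i> * of_real (x - t) * of_real \<tau> = - \<i> * of_real x * of_real \<tau> + \<i> * of_real \<tau> * of_real t"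
          by (simp add: algebra_simps)
        then show "of_real (e t) * (of_real (h \<tau>) * exp (- \<i> * of_real (x - t) * of_real \<tau>))
          = (of_real (a / 2) * of_real (h \<tau>) * exp (- \<i> * of_real x * of_real \<tau>)) * (of_real (exp (- (a * \<bar>t\<bar>))) * exp (\<i> * of_real \<tau> * of_real t))"
          by (simp only: exp_add e_def of_real_mult mult_ac)
      qed
      also have "\<dots> = (of_real (a / 2) * of_real (h \<tau>) * exp (- \<i> * of_real x * of_real \<tau>)) * of_real (2 * a / (a\<^sup>2 + \<tau>\<^sup>2))"
        by (subst integral_mult_right_zero) (simp only: has_bochner_integral_integral_eq[OF has_bochner_integral_exp_neg_abs_iexp[OF a]])
      also have "\<dots> = of_real (a / 2 * (2 * a / (a\<^sup>2 + \<tau>\<^sup>2)) * h \<tau>) * exp (- \<i> * of_real x * of_real \<tau>)"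
        by (simp only: of_real_mult mult_ac)
      also have "a / 2 * (2 * a / (a\<^sup>2 + \<tau>\<^sup>2)) = l \<tau>"
      proof -
        have "a\<^sup>2 + \<tau>\<^sup>2 > 0" using a by (simp add: add_pos_nonneg)
        moreover have "1 + \<tau>\<^sup>2 / a\<^sup>2 = (a\<^sup>2 + \<tau>\<^sup>2) / a\<^sup>2" using a by (simp add: field_simps)
        ultimately show ?thesis using a by (simp add: l_def power2_eq_square)
      qed
      finally show "(LBINT t. of_real (e t) * (of_real (h \<tau>) * exp (- \<i> * of_real (x - t) * of_real \<tau>)))
         = of_real (l \<tau> * h \<tau>) * exp (- \<i> * of_real x * of_real \<tau>)" .
    qed
    finally show ?thesis unfolding inv_fourier_def .
  qed
  ultimately show ?thesis unfolding l_def[symmetric] by (intro exI[of _ g']) (simp add: pf_pair_def)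
qed

lemma pf_pair_product:
  assumes "as \<noteq> []" "\<And>a. a \<in> set as \<Longrightarrow> a > 0"
  shows "\<exists>g. pf_pair g (\<lambda>\<tau>. 1 / (\<Prod>a\<leftarrow>as. 1 + \<tau>\<^sup>2 / a\<^sup>2))"
  using assms
proof (induction as rule: list_nonempty_induct)
  case (single a)
  then show ?case using pf_pair_exp[of a] by auto
next
  case (cons a as)
  then obtain g where "pf_pair g (\<lambda>\<tau>. 1 / (\<Prod>a\<leftarrow>as. 1 + \<tau>\<^sup>2 / a\<^sup>2))" by auto
  from pf_pair_conv_exp[OF _ this, of a] cons.prems show ?case by simp
qed

lemma prod_list_lorentzian_ge:
  fixes \<tau> :: real
  assumes "a \<in> set as"
  shows "1 + \<tau>\<^sup>2 / a\<^sup>2 \<le> (\<Prod>a\<leftarrow>as. 1 + \<tau>\<^sup>2 / a\<^sup>2)"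
proof -
  have ge1: "(\<Prod>a\<leftarrow>bs. 1 + \<tau>\<^sup>2 / a\<^sup>2) \<ge> 1" for bs
  proof (induction bs)
    case (Cons b bs)
    have "1 * 1 \<le> (1 + \<tau>\<^sup>2 / b\<^sup>2) * (\<Prod>a\<leftarrow>bs. 1 + \<tau>\<^sup>2 / a\<^sup>2)" by (intro mult_mono Cons) auto
    then show ?case by simp
  qed auto
  show ?thesis using assms
  proof (induction as)
    case (Cons b bs)
    show ?case
    proof (cases "a = b")
      case True
      have "(1 + \<tau>\<^sup>2 / b\<^sup>2) * 1 \<le> (1 + \<tau>\<^sup>2 / b\<^sup>2) * (\<Prod>a\<leftarrow>bs. 1 + \<tau>\<^sup>2 / a\<^sup>2)" by (intro mult_left_mono ge1) auto
      then show ?thesis using True by simp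
    next
      case False
      hence "1 + \<tau>\<^sup>2 / a\<^sup>2 \<le> (\<Prod>a\<leftarrow>bs. 1 + \<tau>\<^sup>2 / a\<^sup>2)" using Cons by auto
      also have "\<dots> = 1 * (\<Prod>a\<leftarrow>bs. 1 + \<tau>\<^sup>2 / a\<^sup>2)" by simp
      also have "\<dots> \<le> (1 + \<tau>\<^sup>2 / b\<^sup>2) * (\<Prod>a\<leftarrow>bs. 1 + \<tau>\<^sup>2 / a\<^sup>2)" using ge1[of bs] by (intro mult_right_mono) auto
      finally show ?thesis by simp
    qed
  qed auto
qed

text \<open>The element a0 common to all lists supplies the majorant 1/(1 + (\<tau>/a0)^2) for all
  reciprocal products, so the inverse transforms converge pointwise; total positivity and reality
  pass to the limit. Integrability comes from Fatou's lemma, since the scaled densities all have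
  mass 1/X 0.\<close>

theorem polya_frequency_limit:
  fixes as :: "nat \<Rightarrow> real list" and X :: "real \<Rightarrow> real"
  assumes pos: "\<And>n a. a \<in> set (as n) \<Longrightarrow> a > 0" and a0: "\<And>n. a0 \<in> set (as n)"
    and X: "\<And>\<tau>. X \<tau> > 0" and lim: "\<And>\<tau>. (\<lambda>n. X 0 * (\<Prod>a\<leftarrow>as n. 1 + \<tau>\<^sup>2 / a\<^sup>2)) \<longlonglongrightarrow> X \<tau>"
  shows "tp_dets (\<lambda>x. Re (inv_fourier (\<lambda>\<tau>. 1 / X \<tau>) x))"
    and "integrable lborel (\<lambda>x. Re (inv_fourier (\<lambda>\<tau>. 1 / X \<tau>) x))"
    and "inv_fourier (\<lambda>\<tau>. 1 / X \<tau>) x \<in> \<real>"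
proof -
  define h where "h n \<tau> = 1 / (\<Prod>a\<leftarrow>as n. 1 + \<tau>\<^sup>2 / a\<^sup>2)" for n \<tau>
  have a0p: "a0 > 0" using pos a0 by blast
  have "\<exists>g. pf_pair g (h n)" for n
  proof -
    have "as n \<noteq> []" using a0[of n] by auto
    then show ?thesis unfolding h_def using pos[of _ n] by (rule pf_pair_product)
  qed
  then obtain g where g: "\<And>n. pf_pair (g n) (h n)" by metis
  have hm [measurable]: "h n \<in> borel_measurable borel" for n
    using g[of n] by (auto simp: pf_pair_def dest: borel_measurable_integrable)
  have gm [measurable]: "g n \<in> borel_measurable borel" for n
    using g[of n] by (auto simp: pf_pair_def dest: borel_measurable_integrable)
  have dom: "\<bar>h n \<tau>\<bar> \<le> 1 / (1 + \<tau>\<^sup>2 / a0\<^sup>2)" for n \<tau>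
  proof -
    have "1 + \<tau>\<^sup>2 / a0\<^sup>2 \<le> (\<Prod>a\<leftarrow>as n. 1 + \<tau>\<^sup>2 / a\<^sup>2)" by (rule prod_list_lorentzian_ge[OF a0])
    moreover have "1 + \<tau>\<^sup>2 / a0\<^sup>2 > 0" by (simp add: add_pos_nonneg)
    ultimately show ?thesis unfolding h_def by (simp add: frac_le)
  qed
  have hlim: "(\<lambda>n. h n \<tau>) \<longlonglongrightarrow> X 0 * (1 / X \<tau>)" for \<tau>
  proof -
    have "(\<lambda>n. X 0 / (X 0 * (\<Prod>a\<leftarrow>as n. 1 + \<tau>\<^sup>2 / a\<^sup>2))) \<longlonglongrightarrow> X 0 / X \<tau>"
      using X[of \<tau>] by (intro tendsto_intros lim) auto
    then show ?thesis using X[of 0] by (simp add: h_def)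
  qed
  define L where "L = inv_fourier (\<lambda>\<tau>. 1 / X \<tau>)"
  have "(\<lambda>n. inv_fourier (h n) x) \<longlonglongrightarrow> inv_fourier (\<lambda>\<tau>. X 0 * (1 / X \<tau>)) x" for x
    by (rule inv_fourier_tendsto[OF hlim hm integrable_lorentzian[OF a0p] dom])
  moreover have "inv_fourier (\<lambda>\<tau>. X 0 * (1 / X \<tau>)) x = of_real (X 0) * L x" for x
    unfolding inv_fourier_def L_def of_real_mult mult.assoc integral_mult_right_zero by (simp add: mult_ac)
  moreover have "inv_fourier (h n) x = of_real (g n x)" for n x using g[of n] by (simp add: pf_pair_def)
  ultimately have lim1: "(\<lambda>n. complex_of_real (g n x)) \<longlonglongrightarrow> of_real (X 0) * L x" for x by simp
  have "(\<lambda>n. of_real (1 / X 0) * complex_of_real (g n x)) \<longlonglongrightarrow> of_real (1 / X 0) * (of_real (X 0) * L x)" for x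
    by (intro tendsto_intros lim1)
  hence lim2: "(\<lambda>n. complex_of_real (1 / X 0 * g n x)) \<longlonglongrightarrow> L x" for x
    using X[of 0] by simp
  show "inv_fourier (\<lambda>\<tau>. 1 / X \<tau>) x \<in> \<real>"
    unfolding L_def[symmetric] by (rule closed_sequentially[OF closed_complex_Reals _ lim2]) auto
  from lim2 have lim3: "(\<lambda>n. 1 / X 0 * g n x) \<longlonglongrightarrow> Re (L x)" for x
    using tendsto_Re[OF lim2[of x]] by simp
  show tp: "tp_dets (\<lambda>x. Re (inv_fourier (\<lambda>\<tau>. 1 / X \<tau>) x))"
    unfolding L_def[symmetric]
    by (rule tp_dets_limit[OF tp_dets_scale lim3]) (use g X[of 0] in \<open>auto simp: pf_pair_def\<close>)
  have Lm: "(\<lambda>x. Re (L x)) \<in> borel_measurable borel" by (rule borel_measurable_LIMSEQ_real[OF lim3]) measurable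
  have g0: "g n x \<ge> 0" for n x using g[of n] tp_dets_nonneg by (auto simp: pf_pair_def)
  show "integrable lborel (\<lambda>x. Re (inv_fourier (\<lambda>\<tau>. 1 / X \<tau>) x))"
    unfolding L_def[symmetric]
  proof (rule integrableI_bounded)
    show "(\<lambda>x. Re (L x)) \<in> borel_measurable lborel" using Lm by simp
    have "(\<integral>\<^sup>+x. ennreal (norm (Re (L x))) \<partial>lborel) = (\<integral>\<^sup>+x. liminf (\<lambda>n. ennreal (1 / X 0 * g n x)) \<partial>lborel)"
    proof (rule nn_integral_cong)
      fix x
      have "(\<lambda>n. ennreal (1 / X 0 * g n x)) \<longlonglongrightarrow> ennreal (Re (L x))" by (intro tendsto_ennrealI lim3)
      hence "liminf (\<lambda>n. ennreal (1 / X 0 * g n x)) = ennreal (Re (L x))" by (intro lim_imp_Liminf) auto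
      moreover have "Re (L x) \<ge> 0" using tp_dets_nonneg[OF tp] by (simp add: L_def)
      ultimately show "ennreal (norm (Re (L x))) = liminf (\<lambda>n. ennreal (1 / X 0 * g n x))" by simp
    qed
    also have "\<dots> \<le> liminf (\<lambda>n. \<integral>\<^sup>+x. ennreal (1 / X 0 * g n x) \<partial>lborel)"
      by (rule nn_integral_liminf) measurable
    also have "(\<lambda>n. \<integral>\<^sup>+x. ennreal (1 / X 0 * g n x) \<partial>lborel) = (\<lambda>n. ennreal (1 / X 0))"
    proof
      fix n
      have "(\<integral>\<^sup>+x. ennreal (1 / X 0 * g n x) \<partial>lborel) = ennreal (LBINT x. 1 / X 0 * g n x)"
        using g[of n] g0[of n] X[of 0] by (intro nn_integral_eq_integral) (auto simp: pf_pair_def)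
      then show "(\<integral>\<^sup>+x. ennreal (1 / X 0 * g n x) \<partial>lborel) = ennreal (1 / X 0)" using g[of n] by (simp add: pf_pair_def)
    qed
    also have "liminf (\<lambda>n. ennreal (1 / X 0)) < \<infinity>" by (simp add: Liminf_const)
    finally show "(\<integral>\<^sup>+x. ennreal (norm (Re (L x))) \<partial>lborel) < \<infinity>" .
  qed
qed

section \<open>The reciprocal of xi on the real axis\<close>

definition xi_real :: "real \<Rightarrow> real" where
  "xi_real \<tau> = Re (xi_centered (of_real \<tau>))"

lemma xi_centered_of_real_eq: "xi_centered (of_real \<tau>) = of_real (xi_real \<tau>)"
  by (simp add: xi_real_def xi_centered_of_real)

lemma xi_real_pos: "xi_real \<tau> > 0"
proof -
  obtain c where c: "c > 0" "\<And>\<tau>. Re (xi_centered (of_real \<tau>)) \<ge> c * (1 + \<tau>\<^sup>2)" using xi_centered_of_real_ge by metis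
  have "0 < c * (1 + \<tau>\<^sup>2)" using c(1) by (simp add: add_pos_nonneg)
  with c(2)[of \<tau>] show ?thesis by (simp add: xi_real_def)
qed

lemma xi_Lambda_eq: "xi_Lambda x = inv_fourier (\<lambda>\<tau>. 1 / xi_real \<tau>) x"
  unfolding xi_Lambda_def inv_fourier_def by (simp add: riemann_xi_eq xi_centered_of_real_eq)

lemma continuous_xi_real: "continuous_on UNIV xi_real"
proof -
  have "continuous_on UNIV xi_centered"
    using holomorphic_xi_centered by (rule holomorphic_on_imp_continuous_on)
  from continuous_on_compose2[OF this continuous_on_of_real[OF continuous_on_id]]
  have "continuous_on UNIV (\<lambda>\<tau>. xi_centered (complex_of_real \<tau>))" by simp
  then show ?thesis unfolding xi_real_def by (rule continuous_on_Re)
qed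

lemma integrable_inverse_xi_real: "integrable lborel (\<lambda>\<tau>. 1 / xi_real \<tau>)"
proof -
  obtain c where c: "c > 0" "\<And>\<tau>. Re (xi_centered (of_real \<tau>)) \<ge> c * (1 + \<tau>\<^sup>2)" using xi_centered_of_real_ge by metis
  have m: "(\<lambda>\<tau>. 1 / xi_real \<tau>) \<in> borel_measurable borel"
    using xi_real_pos by (intro borel_measurable_continuous_onI continuous_intros continuous_xi_real) (auto simp: less_imp_neq[symmetric])
  show ?thesis
  proof (rule Bochner_Integration.integrable_bound)
    show "integrable lborel (\<lambda>\<tau>::real. 1 / c * (1 / (1 + \<tau>\<^sup>2 / 1\<^sup>2)))"
      by (intro integrable_mult_right integrable_lorentzian) auto
    show "AE \<tau> in lborel. norm (1 / xi_real \<tau>) \<le> norm (1 / c * (1 / (1 + \<tau>\<^sup>2 / 1\<^sup>2)))"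
    proof (rule AE_I2)
      fix \<tau> :: real
      have p: "0 < c * (1 + \<tau>\<^sup>2)" using c(1) by (simp add: add_pos_nonneg)
      have "1 / xi_real \<tau> \<le> 1 / (c * (1 + \<tau>\<^sup>2))"
        using c(2)[of \<tau>] p xi_real_pos[of \<tau>] unfolding xi_real_def[symmetric] by (intro divide_left_mono) auto
      then show "norm (1 / xi_real \<tau>) \<le> norm (1 / c * (1 / (1 + \<tau>\<^sup>2 / 1\<^sup>2)))"
        using xi_real_pos[of \<tau>] p c(1) by (simp add: abs_mult)
    qed
  qed (use m in simp)
qed

theorem riemann_hypothesis_imp_polya_frequency:
  assumes RH: "\<And>z. xi_centered z = 0 \<Longrightarrow> Re z = 0"
  shows "xi_Lambda x \<in> \<real>" and "polya_frequency_function (\<lambda>x. Re (xi_Lambda x))"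
proof -
  define F where "F w = xi_centered (csqrt w)" for w
  have F_sq: "F (z\<^sup>2) = xi_centered z" for z
    using sums_unique2[OF xi_centered_sums[of z]] xi_centered_sums[of "csqrt (z\<^sup>2)"] by (simp add: F_def)
  have Fsums: "(\<lambda>k. of_real (xi_coeff k) * w ^ k) sums F w" for w
    using xi_centered_sums[of "csqrt w"] by (simp add: F_def)
  hence hol: "F holomorphic_on UNIV" by (rule holomorphic_on_UNIV_power_series)
  have F0: "F 0 = of_real (xi_real 0)" using xi_centered_of_real_eq[of 0] by (simp add: F_def)
  have F0': "F 0 \<noteq> 0" using xi_real_pos[of 0] by (simp add: F0)
  have growth: "\<exists>C. \<forall>w. norm (F w) \<le> C * exp (\<epsilon> * norm w)" if \<epsilon>: "\<epsilon> > 0" for \<epsilon>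
  proof -
    obtain C where C: "\<And>z. norm (xi_centered z) \<le> C * exp (\<epsilon> * (norm z)\<^sup>2)" using xi_centered_growth[OF \<epsilon>] by metis
    have "norm (F w) \<le> C * exp (\<epsilon> * norm w)" for w
      using C[of "csqrt w"] by (simp add: F_def flip: norm_power)
    then show ?thesis by blast
  qed
  obtain ws where ws: "\<And>n w. w \<in> set (ws n) \<Longrightarrow> w \<noteq> 0 \<and> F w = 0"
    "\<And>w. F w = 0 \<Longrightarrow> \<forall>\<^sub>F n in sequentially. w \<in> set (ws n)"
    "\<And>z. (\<lambda>n. F 0 * (\<Prod>w\<leftarrow>ws n. 1 - z / w)) \<longlonglongrightarrow> F z"
    by (rule entire_order_lt_1_product[OF hol F0' growth], assumption, rule that)
  \<comment> \<open>A zero w of F is the square of the zero \<open>csqrt w\<close> of \<Xi>, which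
    is purely imaginary by hypothesis and not 0 because F 0 \<noteq> 0.\<close>
  have zero: "\<exists>a>0. w = - (of_real a)\<^sup>2" if "F w = 0" for w
  proof -
    define y where "y = Im (csqrt w)"
    have "Re (csqrt w) = 0" using RH[of "csqrt w"] that by (simp add: F_def)
    hence "csqrt w = \<i> * of_real y" by (simp add: complex_eq_iff y_def)
    hence "(csqrt w)\<^sup>2 = (\<i> * of_real y)\<^sup>2" by simp
    hence w: "w = - (of_real \<bar>y\<bar>)\<^sup>2" by (simp add: power_mult_distrib flip: of_real_power)
    have "y \<noteq> 0" using w that F0' by auto
    with w show ?thesis by (intro exI[of _ "\<bar>y\<bar>"]) auto
  qed
  define a where "a w = (SOME a. a > 0 \<and> w = - (complex_of_real a)\<^sup>2)" for w
  have a: "a w > 0" "w = - (of_real (a w))\<^sup>2" if "F w = 0" for w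
    using someI_ex[OF zero[OF that]] by (auto simp: a_def)
  \<comment> \<open>A zero is wanted for the factor common to all products. Without zeros the
    products would be empty and F constant, against the quadratic lower bound.\<close>
  have "\<exists>w. F w = 0"
  proof (rule ccontr)
    assume "\<nexists>w. F w = 0"
    hence nil: "ws n = []" for n using ws(1)[of _ n] by (cases "ws n") auto
    have const: "F z = F 0" for z
    proof -
      have "(\<lambda>n. F 0) \<longlonglongrightarrow> F z" using ws(3)[of z] by (simp add: nil)
      then show ?thesis using LIMSEQ_unique[OF tendsto_const] by metis
    qed
    obtain c where c: "c > 0" "\<And>\<tau>. Re (xi_centered (of_real \<tau>)) \<ge> c * (1 + \<tau>\<^sup>2)" using xi_centered_of_real_ge by metis
    have "c * (1 + \<tau>\<^sup>2) \<le> xi_real 0" for \<tau>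
    proof -
      have "complex_of_real (xi_real \<tau>) = of_real (xi_real 0)"
        using F_sq[of "of_real \<tau>"] const[of "(of_real \<tau>)\<^sup>2"] by (simp only: F0 xi_centered_of_real_eq)
      hence "xi_real \<tau> = xi_real 0" by (simp only: of_real_eq_iff)
      with c(2)[of \<tau>] show ?thesis by (simp only: xi_real_def)
    qed
    from this[of "sqrt (xi_real 0 / c)"] show False
      using c(1) xi_real_pos[of 0] by (simp add: algebra_simps)
  qed
  then obtain w0 where w0: "F w0 = 0" by blast
  obtain N where N: "\<And>n. n \<ge> N \<Longrightarrow> w0 \<in> set (ws n)" using ws(2)[OF w0] by (auto simp: eventually_sequentially)
  \<comment> \<open>The shift by N puts the chosen zero w0 into every list.\<close>
  define as where "as n = map a (ws (n + N))" for n
  have lim: "(\<lambda>n. xi_real 0 * (\<Prod>a\<leftarrow>as n. 1 + \<tau>\<^sup>2 / a\<^sup>2)) \<longlonglongrightarrow> xi_real \<tau>" for \<tau>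
  proof -
    have "(\<Prod>w\<leftarrow>xs. 1 - (of_real \<tau>)\<^sup>2 / w) = complex_of_real (\<Prod>b\<leftarrow>map a xs. 1 + \<tau>\<^sup>2 / b\<^sup>2)"
      if "\<And>w. w \<in> set xs \<Longrightarrow> F w = 0" for xs
      using that
    proof (induction xs)
      case (Cons w xs)
      have "w = - (of_real (a w))\<^sup>2" using Cons.prems by (intro a(2)) auto
      hence "(of_real \<tau>)\<^sup>2 / w = - complex_of_real (\<tau>\<^sup>2 / (a w)\<^sup>2)"
        by (metis divide_minus_right of_real_divide of_real_power)
      hence "1 - (of_real \<tau>)\<^sup>2 / w = complex_of_real (1 + \<tau>\<^sup>2 / (a w)\<^sup>2)" by simp
      with Cons show ?case by simp
    qed simp
    hence "(\<Prod>w\<leftarrow>ws (n + N). 1 - (of_real \<tau>)\<^sup>2 / w) = complex_of_real (\<Prod>b\<leftarrow>as n. 1 + \<tau>\<^sup>2 / b\<^sup>2)" for n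
      unfolding as_def using ws(1) by blast
    moreover have "(\<lambda>n. F 0 * (\<Prod>w\<leftarrow>ws (n + N). 1 - (of_real \<tau>)\<^sup>2 / w)) \<longlonglongrightarrow> F ((of_real \<tau>)\<^sup>2)"
      using LIMSEQ_ignore_initial_segment[OF ws(3)] .
    ultimately have "(\<lambda>n. complex_of_real (xi_real 0 * (\<Prod>b\<leftarrow>as n. 1 + \<tau>\<^sup>2 / b\<^sup>2))) \<longlonglongrightarrow> of_real (xi_real \<tau>)"
      by (simp add: F0 F_sq xi_centered_of_real_eq)
    then show ?thesis by (subst (asm) tendsto_of_real_iff)
  qed
  have pos: "b > 0" if "b \<in> set (as n)" for b n
    using that ws(1) a(1) by (auto simp: as_def)
  have mem: "a w0 \<in> set (as n)" for n using N[of "n + N"] by (auto simp: as_def)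
  note L = polya_frequency_limit[OF pos mem xi_real_pos lim, folded xi_Lambda_eq]
  show "xi_Lambda x \<in> \<real>" by (rule L(3))
  have "(\<lambda>x. Re (xi_Lambda x)) \<in> borel_measurable lborel" using L(2) by (rule borel_measurable_integrable)
  with L(1,2) show "polya_frequency_function (\<lambda>x. Re (xi_Lambda x))"
    unfolding polya_frequency_function_def totally_positive_def tp_dets_def
    by (auto simp: integrable_completion intro: measurable_completion)
qed

section \<open>Appell polynomials of a totally positive function\<close>

lemma det_mat_2:
  fixes f :: "nat \<Rightarrow> nat \<Rightarrow> real"
  shows "det_fun 2 (\<lambda>i j. f i j) = f 0 0 * f 1 1 - f 0 1 * f 1 0"
proof -
  define A where "A = Matrix.mat 2 2 (\<lambda>(i, j). f i j)"
  have A: "A \<in> carrier_mat 2 2" by (simp add: A_def)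
  have "Determinant.det A = (\<Sum>j<2. A $$ (0, j) * cofactor A 0 j)" by (rule laplace_expansion_row[OF A]) simp
  also have "\<dots> = f 0 0 * f 1 1 - f 0 1 * f 1 0"
    by (simp add: numeral_2_eq_2 cofactor_def mat_delete_def det_single A_def)
  finally show ?thesis by (simp add: A_def)
qed

text \<open>The two-by-two minor with rows x, x + a and columns 0, x.\<close>

lemma tp_dets_log_concave:
  assumes tp: "tp_dets g" and "x > 0" "a > 0"
  shows "g 0 * g (x + a) \<le> g x * g a"
proof -
  define X Y where "X = (\<lambda>i::nat. if i = 0 then x else x + a)" and "Y = (\<lambda>i::nat. if i = 0 then 0 else x)"
  have "strict_mono_on {..<2} X" "strict_mono_on {..<2} Y"
    using assms by (auto simp: strict_mono_on_def X_def Y_def)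
  from tp_detsD[OF tp this] show ?thesis unfolding det_mat_2[of "\<lambda>i j. g (X i - Y j)"] by (simp add: X_def Y_def)
qed

text \<open>If g stayed above g 0/2 on the positive axis, its integral would be infinite; so some a
  has g a \<le> g 0/2, and the two-by-two minors then halve g with every step a.\<close>

lemma tp_dets_exponential_decay:
  assumes tp: "tp_dets g" and int: "integrable lborel g" and even: "\<And>x. g (- x) = g x" and g0: "g 0 > 0" and B: "\<And>x. g x \<le> B"
  obtains r where "r > 0" "integrable lborel (\<lambda>u. g u * exp (r * \<bar>u\<bar>))"
proof -
  have [measurable]: "g \<in> borel_measurable borel" using borel_measurable_integrable[OF int] by simp
  have nn: "g x \<ge> 0" for x by (rule tp_dets_nonneg[OF tp])
  have "\<exists>a>0. g a \<le> g 0 / 2"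
  proof (rule ccontr)
    assume "\<not> ?thesis"
    hence gt: "g 0 / 2 < g a" if "a > 0" for a using that by (meson not_le)
    have "real n * (g 0 / 2) \<le> (LBINT x. g x)" for n
    proof -
      have "real n * (g 0 / 2) = (LBINT x. g 0 / 2 * indicator {0<..real n} x)" by simp
      also have "\<dots> \<le> (LBINT x. g x)"
      proof (rule integral_mono)
        show "integrable lborel (\<lambda>x. g 0 / 2 * indicator {0<..real n} x)" by (intro integrable_mult_right) (simp add: integrable_indicator_iff)
        show "g 0 / 2 * indicator {0<..real n} x \<le> g x" for x using gt[of x] nn[of x] by (auto simp: indicator_def)
      qed (rule int)
      finally show ?thesis .
    qed
    moreover obtain n where "(LBINT x. g x) / (g 0 / 2) < real n" using reals_Archimedean2 by blast
    hence "(LBINT x. g x) < real n * (g 0 / 2)" using g0 by (simp add: field_simps)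
    ultimately show False by (meson not_le)
  qed
  then obtain a where a: "a > 0" "g a \<le> g 0 / 2" by blast
  have half: "g (x + a) \<le> g x / 2" if "x > 0" for x
  proof -
    have "g 0 * g (x + a) \<le> g x * g a" by (rule tp_dets_log_concave[OF tp that a(1)])
    also have "\<dots> \<le> g x * (g 0 / 2)" using a nn by (intro mult_left_mono)
    also have "\<dots> = g 0 * (g x / 2)" by simp
    finally show ?thesis using g0 by (simp only: mult_le_cancel_left_pos)
  qed
  have B0: "B > 0" using B[of 0] g0 by linarith
  have pow: "g x \<le> B / 2 ^ n" if "real n * a < x" for n x
    using that
  proof (induction n arbitrary: x)
    case 0 then show ?case using B by simp
  next
    case (Suc n)
    have "real n * a < x - a" using Suc.prems by (simp add: algebra_simps)
    moreover have "0 \<le> real n * a" using a(1) by simp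
    with calculation have "x - a > 0" by linarith
    ultimately have "g (x - a) \<le> B / 2 ^ n" "g x \<le> g (x - a) / 2" using Suc.IH half[of "x - a"] by auto
    then show ?case by simp
  qed
  \<comment> \<open>Half of the decay rate ln 2/a, so that the weight exp(r|u|) leaves decay at rate
    r.\<close>
  define r where "r = ln 2 / (2 * a)"
  have r: "r > 0" using a by (simp add: r_def)
  have main: "g x \<le> 2 * B * exp (- (2 * r * x))" if x: "x > 0" for x
  proof -
    \<comment> \<open>The ceiling minus 1 is the largest n with n a < x, the strict inequality that
      \<open>pow\<close> asks for.\<close>
    define m where "m = \<lceil>x / a\<rceil>"
    have m: "m \<ge> 1" using x a by (simp add: m_def)
    define n where "n = nat (m - 1)"
    have n: "real n = of_int m - 1" using m by (simp add: n_def)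
    have "of_int m - 1 < x / a" "x / a \<le> of_int m" unfolding m_def by linarith+
    hence nx: "real n * a < x" "x / a \<le> real n + 1" using a by (auto simp: n field_simps)
    have "2 * r * x = ln 2 * (x / a)" using a by (simp add: r_def)
    also have "\<dots> \<le> ln 2 * (real n + 1)" using nx by (intro mult_left_mono) auto
    also have "\<dots> = ln (2 ^ Suc n)" by (subst ln_realpow) (simp_all add: algebra_simps)
    finally have "exp (2 * r * x) \<le> exp (ln (2 ^ Suc n))" by (simp only: exp_le_cancel_iff)
    hence e: "exp (2 * r * x) \<le> 2 * 2 ^ n" by simp
    have "g x * exp (2 * r * x) \<le> B / 2 ^ n * (2 * 2 ^ n)"
      using pow[OF nx(1)] e B0 by (intro mult_mono) auto
    also have "\<dots> = 2 * B" by simp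
    finally show ?thesis by (simp add: exp_minus field_simps)
  qed
  have le: "g x * exp (r * \<bar>x\<bar>) \<le> 2 * B * exp (- (r * \<bar>x\<bar>))" for x
  proof -
    have "g x \<le> 2 * B * exp (- (2 * r * \<bar>x\<bar>))"
      using main[of "\<bar>x\<bar>"] even[of x] B[of 0] B0 by (cases "x = 0") (auto simp: abs_if)
    hence "g x * exp (r * \<bar>x\<bar>) \<le> 2 * B * exp (- (2 * r * \<bar>x\<bar>)) * exp (r * \<bar>x\<bar>)" by (intro mult_right_mono) auto
    also have "\<dots> = 2 * B * exp (- (r * \<bar>x\<bar>))" by (simp add: mult.assoc flip: exp_add)
    finally show ?thesis .
  qed
  have "integrable lborel (\<lambda>u. g u * exp (r * \<bar>u\<bar>))"
  proof (rule Bochner_Integration.integrable_bound)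
    show "integrable lborel (\<lambda>u::real. 2 * B * exp (- (r * \<bar>u\<bar>)))" by (intro integrable_mult_right integrable_exp_neg_abs r)
    show "AE u in lborel. norm (g u * exp (r * \<bar>u\<bar>)) \<le> norm (2 * B * exp (- (r * \<bar>u\<bar>)))"
      using le nn B0 by (intro AE_I2) (simp add: abs_mult)
  qed measurable
  with r that show ?thesis by blast
qed

text \<open>\<open>appell b n\<close> is \<open>\<Psi>(D) (x\<^sup>n / n!)\<close> for the power series \<open>\<Psi>\<close> with coefficients \<open>b\<close>, and
  \<open>appell_op b n c\<close> is the image of the polynomial with coefficients \<open>c\<close> under \<open>\<Psi>(D)\<close>.\<close>
definition appell :: "(nat \<Rightarrow> 'a::field_char_0) \<Rightarrow> nat \<Rightarrow> 'a poly" where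
  "appell b n = (\<Sum>k\<le>n. monom (b k / fact (n - k)) (n - k))"

lemma poly_appell: "poly (appell b n) y = (\<Sum>k\<le>n. b k * (y ^ (n - k) / fact (n - k)))"
  by (simp add: appell_def poly_sum poly_monom)

lemma poly_appell_fps: "poly (appell b n) y = fps_nth (Abs_fps b * fps_exp y) n"
  by (simp add: poly_appell fps_mult_nth atLeast0AtMost)

lemma degree_appell_le: "degree (appell b n) \<le> n"
  unfolding appell_def by (intro degree_sum_le) (auto intro: order_trans[OF degree_monom_le])

lemma coeff_appell: "coeff (appell b n) n = b 0 / fact n"
proof -
  have "coeff (appell b n) n = (\<Sum>k\<le>n. if k = 0 then b 0 / fact n else 0)"
    unfolding appell_def coeff_sum by (intro sum.cong) auto
  then show ?thesis by simp
qed

text \<open>The generating function of the Appell polynomials at x - t is \<Psi>(X) exp(x X) exp(-t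
  X). Integrating against g replaces exp(-t X) by the series of m, whose alternating signs come from
  this reflection, and that series cancels \<Psi>.\<close>

lemma appell_convolution:
  fixes g :: "real \<Rightarrow> real"
  assumes int: "\<And>k. integrable lborel (\<lambda>t. g t * t ^ k / fact k)"
    and m: "\<And>k. m k = (-1) ^ k * (LBINT t. g t * t ^ k / fact k)"
    and inv: "Abs_fps b * Abs_fps m = 1"
  shows "has_bochner_integral lborel (\<lambda>y. g (x - y) * poly (appell b n) y) (x ^ n / fact n)"
proof -
  define C where "C i = fps_nth (Abs_fps b * fps_exp x) i" for i
  have mI: "has_bochner_integral lborel (\<lambda>t. g t * ((- t) ^ k / fact k)) (m k)" for k
  proof -
    have eq: "(\<lambda>t. g t * ((- t) ^ k / fact k)) = (\<lambda>t. (-1) ^ k * (g t * t ^ k / fact k))"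
    proof
      show "g t * ((- t) ^ k / fact k) = (-1) ^ k * (g t * t ^ k / fact k)" for t
        by (subst power_minus) simp
    qed
    show ?thesis unfolding eq m by (rule has_bochner_integral_mult_right[OF has_bochner_integral_integrable[OF int[of k]]])
  qed
  have "has_bochner_integral lborel (\<lambda>t. \<Sum>i=0..n. C i * (g t * ((- t) ^ (n - i) / fact (n - i)))) (\<Sum>i=0..n. C i * m (n - i))"
    by (intro has_bochner_integral_sum has_bochner_integral_mult_right mI)
  moreover have "(\<Sum>i=0..n. C i * m (n - i)) = x ^ n / fact n"
  proof -
    have "(\<Sum>i=0..n. C i * m (n - i)) = fps_nth ((Abs_fps b * fps_exp x) * Abs_fps m) n"
      unfolding C_def fps_mult_nth[of "Abs_fps b * fps_exp x"] by simp
    also have "(Abs_fps b * fps_exp x) * Abs_fps m = fps_exp x * (Abs_fps b * Abs_fps m)" by (simp only: mult_ac)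
    finally show ?thesis by (simp add: inv)
  qed
  moreover have "(\<Sum>i=0..n. C i * (g t * ((- t) ^ (n - i) / fact (n - i)))) = g t * poly (appell b n) (x - t)" for t
  proof -
    have "fps_exp (x - t) = fps_exp x * fps_exp (- t)" using fps_exp_add_mult[of x "- t"] by simp
    hence "poly (appell b n) (x - t) = fps_nth ((Abs_fps b * fps_exp x) * fps_exp (- t)) n"
      by (simp add: poly_appell_fps mult.assoc)
    also have "\<dots> = (\<Sum>i=0..n. C i * ((- t) ^ (n - i) / fact (n - i)))"
      unfolding C_def fps_mult_nth[of "Abs_fps b * fps_exp x"] by simp
    finally show ?thesis by (simp add: sum_distrib_left mult_ac)
  qed
  ultimately have F: "has_bochner_integral lborel (\<lambda>t. g t * poly (appell b n) (x - t)) (x ^ n / fact n)" by simp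
  have "has_bochner_integral lborel (\<lambda>y. g (x + -1 * y) * poly (appell b n) (x - (x + -1 * y))) (x ^ n / fact n)"
    using F lborel_integrable_real_affine[of "\<lambda>t. g t * poly (appell b n) (x - t)" "-1" x]
      lborel_integral_real_affine[of "-1" "\<lambda>t. g t * poly (appell b n) (x - t)" x]
    by (simp add: has_bochner_integral_iff)
  then show ?thesis by simp
qed

definition appell_op :: "(nat \<Rightarrow> 'a::field_char_0) \<Rightarrow> nat \<Rightarrow> (nat \<Rightarrow> 'a) \<Rightarrow> 'a poly" where
  "appell_op b n c = (\<Sum>i\<le>n. smult (c i * fact i) (appell b i))"

lemma poly_appell_op_of_real:
  "poly (appell_op (\<lambda>k. of_real (b k)) n (\<lambda>i. of_real (c i))) (of_real y) = complex_of_real (poly (appell_op b n c) y)"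
  by (simp add: appell_op_def poly_sum poly_appell)

lemma degree_appell_op_le: "degree (appell_op b n c) \<le> n"
  unfolding appell_op_def
  by (intro degree_sum_le) (auto intro: order_trans[OF degree_smult_le] order_trans[OF degree_appell_le])

lemma appell_op_convolution:
  fixes g :: "real \<Rightarrow> real"
  assumes int: "\<And>k. integrable lborel (\<lambda>t. g t * t ^ k / fact k)"
    and m: "\<And>k. m k = (-1) ^ k * (LBINT t. g t * t ^ k / fact k)"
    and inv: "Abs_fps b * Abs_fps m = 1"
  shows "has_bochner_integral lborel (\<lambda>y. g (x - y) * poly (appell_op b n c) y) (\<Sum>i\<le>n. c i * x ^ i)"
proof -
  have "has_bochner_integral lborel (\<lambda>y. \<Sum>i\<le>n. (c i * fact i) * (g (x - y) * poly (appell b i) y)) (\<Sum>i\<le>n. (c i * fact i) * (x ^ i / fact i))"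
    by (intro has_bochner_integral_sum has_bochner_integral_mult_right appell_convolution[OF int m inv])
  moreover have "(\<Sum>i\<le>n. (c i * fact i) * (g (x - y) * poly (appell b i) y)) = g (x - y) * poly (appell_op b n c) y" for y
    by (simp add: appell_op_def poly_sum sum_distrib_left mult_ac)
  ultimately show ?thesis by simp
qed

text \<open>Let p be the image of the polynomial Q with zeros \<epsilon> j. Convolving p with g
  returns Q, which alternates in sign at n + 1 points, so fewer than n distinct real zeros of p
  would contradict variation diminution. As the degree is at most n, there is no room for a non-real
  zero.\<close>

lemma appell_op_real_rooted:
  fixes g :: "real \<Rightarrow> real" and \<epsilon> :: real and z :: complex
  assumes tp: "tp_dets g" and gm: "g \<in> borel_measurable borel"
    and int: "\<And>k. integrable lborel (\<lambda>t. g t * t ^ k / fact k)"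
    and m: "\<And>k. m k = (-1) ^ k * (LBINT t. g t * t ^ k / fact k)"
    and inv: "Abs_fps b * Abs_fps m = 1" and \<epsilon>: "\<epsilon> > 0"
    and c: "c = coeff (\<Prod>j<n. [:- (\<epsilon> * real j), 1:])"
    and z: "poly (appell_op (\<lambda>k. of_real (b k)) n (\<lambda>i. of_real (c i))) z = 0"
  shows "Im z = 0"
proof -
  define Q where "Q = (\<Prod>j<n. [:- (\<epsilon> * real j), 1:])"
  have degQ: "degree Q = n"
    unfolding Q_def by (subst degree_prod_eq_sum_degree) auto
  have polyQ: "poly Q x = (\<Prod>j<n. x - \<epsilon> * real j)" for x by (simp add: Q_def poly_prod)
  have sumQ: "(\<Sum>i\<le>n. c i * x ^ i) = poly Q x" for x
    unfolding poly_altdef degQ c Q_def[symmetric] ..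
  define p where "p = appell_op b n c"
  have conv: "has_bochner_integral lborel (\<lambda>y. g (x - y) * poly p y) (poly Q x)" for x
    unfolding p_def sumQ[symmetric] by (rule appell_op_convolution[OF int m inv])
  \<comment> \<open>The points \<epsilon> (i - 1/2) for i from 0 to n interlace the zeros \<epsilon>
    j; exactly n - i factors are negative at the i-th one.\<close>
  have sgnQ: "(-1) ^ i * ((-1) ^ n * poly Q (\<epsilon> * (real i - 1 / 2))) > 0" if "i \<le> n" for i
  proof -
    have "(-1) ^ i * (-1) ^ n * (\<Prod>j<n. \<epsilon> * (real i - 1 / 2) - \<epsilon> * real j) > 0"
      using that
    proof (induction n)
      case (Suc n)
      have eq: "\<epsilon> * (real i - 1 / 2) - \<epsilon> * real n = \<epsilon> * (real i - real n - 1 / 2)" by (simp add: algebra_simps)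
      show ?case
      proof (cases "i \<le> n")
        case True
        hence "\<epsilon> * (real i - real n - 1 / 2) < 0" using \<epsilon> by (intro mult_pos_neg) auto
        hence "((-1) ^ i * (-1) ^ n * (\<Prod>j<n. \<epsilon> * (real i - 1 / 2) - \<epsilon> * real j)) * - (\<epsilon> * (real i - real n - 1 / 2)) > 0"
          by (intro mult_pos_pos[OF Suc.IH[OF True]]) simp
        then show ?thesis by (simp add: eq mult_ac)
      next
        case False
        hence i: "i = Suc n" using Suc.prems by simp
        have "(\<Prod>j<Suc n. \<epsilon> * (real i - 1 / 2) - \<epsilon> * real j) > 0"
        proof (rule prod_pos)
          fix j assume "j \<in> {..<Suc n}"
          hence "\<epsilon> * (real i - real j - 1 / 2) > 0" using \<epsilon> i by (intro mult_pos_pos) auto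
          then show "\<epsilon> * (real i - 1 / 2) - \<epsilon> * real j > 0" by (simp add: algebra_simps)
        qed
        moreover have "(-1) ^ i * (-1) ^ Suc n = (1::real)" by (simp add: i flip: power_mult_distrib)
        ultimately show ?thesis by simp
      qed
    qed simp
    then show ?thesis by (simp add: polyQ mult.assoc)
  qed
  have p0: "p \<noteq> 0"
  proof
    assume "p = 0"
    hence "poly Q x = 0" for x using conv[of x] by (simp add: has_bochner_integral_iff)
    with sgnQ[of 0] show False by simp
  qed
  have fin: "finite {y. poly p y = 0}" using p0 by (rule poly_roots_finite)
  have card: "card {y. poly p y = 0} \<ge> n"
  proof (rule ccontr)
    assume "\<not> ?thesis"
    hence k: "Suc (card {y. poly p y = 0}) \<le> n" by simp
    show False
    proof (rule tp_convolution_poly_alternation[OF tp gm p0, where k = "Suc (card {y. poly p y = 0})" and x = "\<lambda>i. \<epsilon> * (real i - 1 / 2)" and s = "(-1) ^ n"])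
      show "integrable lborel (\<lambda>y. g (x - y) * poly p y)" for x using conv[of x] by (simp add: has_bochner_integral_iff)
      show "strict_mono_on {..Suc (card {y. poly p y = 0})} (\<lambda>i. \<epsilon> * (real i - 1 / 2))"
        using \<epsilon> by (auto simp: strict_mono_on_def)
      fix i assume "i \<le> Suc (card {y. poly p y = 0})"
      hence "i \<le> n" using k by simp
      from sgnQ[OF this] show "(-1) ^ i * ((-1) ^ n * (LBINT y. g (\<epsilon> * (real i - 1 / 2) - y) * poly p y)) > 0"
        by (simp only: has_bochner_integral_integral_eq[OF conv])
    qed simp
  qed
  define P where "P = appell_op (\<lambda>k. complex_of_real (b k)) n (\<lambda>i. of_real (c i))"
  have Pp: "poly P (of_real y) = of_real (poly p y)" for y unfolding P_def p_def by (rule poly_appell_op_of_real)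
  have P0: "P \<noteq> 0"
  proof
    assume "P = 0"
    hence "poly p y = 0" for y using Pp[of y] by simp
    hence "p = 0" by (simp add: poly_all_0_iff_0[symmetric])
    with p0 show False by simp
  qed
  show "Im z = 0"
  proof (rule ccontr)
    assume "Im z \<noteq> 0"
    hence nz: "z \<notin> complex_of_real ` {y. poly p y = 0}" by auto
    have "insert z (complex_of_real ` {y. poly p y = 0}) \<subseteq> {w. poly P w = 0}"
      using z Pp by (auto simp: P_def)
    hence "card (insert z (complex_of_real ` {y. poly p y = 0})) \<le> card {w. poly P w = 0}"
      by (intro card_mono poly_roots_finite P0)
    also have "\<dots> \<le> degree P" using P0 by (rule card_poly_roots_bound)
    also have "\<dots> \<le> n" unfolding P_def by (rule degree_appell_op_le)
    also have "card (insert z (complex_of_real ` {y. poly p y = 0})) = Suc (card {y. poly p y = 0})"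
      using nz fin by (simp add: card_image inj_on_def)
    finally show False using card by simp
  qed
qed

section \<open>From total positivity to the Riemann hypothesis\<close>

lemma uniform_limit_sum_coeffs:
  fixes f :: "nat \<Rightarrow> complex \<Rightarrow> complex" and c :: "nat \<Rightarrow> nat \<Rightarrow> complex"
  assumes lim: "\<And>i. (\<lambda>m. c m i) \<longlonglongrightarrow> d i" and cont: "\<And>i. continuous_on K (f i)" and K: "compact K"
  shows "uniform_limit K (\<lambda>m z. \<Sum>i\<le>n. c m i * f i z) (\<lambda>z. \<Sum>i\<le>n. d i * f i z) sequentially"
proof (rule uniform_limitI)
  fix e :: real assume e: "e > 0"
  have "\<exists>B. \<forall>z\<in>K. norm (f i z) \<le> B" for i
    using compact_imp_bounded[OF compact_continuous_image[OF cont K]] unfolding bounded_iff by auto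
  then obtain B where B: "\<And>i z. z \<in> K \<Longrightarrow> norm (f i z) \<le> B i" by metis
  have "(\<lambda>m. \<Sum>i\<le>n. norm (c m i - d i) * B i) \<longlonglongrightarrow> (\<Sum>i\<le>n. norm (d i - d i) * B i)"
    by (intro tendsto_intros lim)
  hence "(\<lambda>m. \<Sum>i\<le>n. norm (c m i - d i) * B i) \<longlonglongrightarrow> 0" by simp
  hence "\<forall>\<^sub>F m in sequentially. (\<Sum>i\<le>n. norm (c m i - d i) * B i) < e" using e by (rule order_tendstoD)
  then show "\<forall>\<^sub>F m in sequentially. \<forall>z\<in>K. dist (\<Sum>i\<le>n. c m i * f i z) (\<Sum>i\<le>n. d i * f i z) < e"
  proof eventually_elim
    case (elim m)
    show ?case
    proof
      fix z assume z: "z \<in> K"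
      have "dist (\<Sum>i\<le>n. c m i * f i z) (\<Sum>i\<le>n. d i * f i z) = norm (\<Sum>i\<le>n. (c m i - d i) * f i z)"
        by (simp add: dist_norm sum_subtractf left_diff_distrib)
      also have "\<dots> \<le> (\<Sum>i\<le>n. norm ((c m i - d i) * f i z))" by (rule norm_sum)
      also have "\<dots> \<le> (\<Sum>i\<le>n. norm (c m i - d i) * B i)"
        by (intro sum_mono) (simp add: norm_mult mult_left_mono B[OF z])
      finally show "dist (\<Sum>i\<le>n. c m i * f i z) (\<Sum>i\<le>n. d i * f i z) < e" using elim by simp
    qed
  qed
qed

lemma coeff_prod_linear_tendsto:
  assumes \<epsilon>: "\<epsilon> \<longlonglongrightarrow> (0::real)"
  shows "(\<lambda>m. coeff (\<Prod>j<n. [:- (\<epsilon> m * real j), 1:]) i) \<longlonglongrightarrow> (if i = n then 1 else 0)"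
proof (induction n arbitrary: i)
  case 0
  then show ?case by (cases "i = 0") auto
next
  case (Suc n)
  define P where "P m = (\<Prod>j<n. [:- (\<epsilon> m * real j), 1:])" for m
  have eq: "coeff (\<Prod>j<Suc n. [:- (\<epsilon> m * real j), 1:]) i
      = - (\<epsilon> m * real n) * coeff (P m) i + (case i of 0 \<Rightarrow> 0 | Suc j \<Rightarrow> coeff (P m) j)" for m
  proof -
    have "(\<Prod>j<Suc n. [:- (\<epsilon> m * real j), 1:]) = P m * [:- (\<epsilon> m * real n), 1:]" by (simp add: P_def)
    also have "\<dots> = smult (- (\<epsilon> m * real n)) (P m) + pCons 0 (P m)" by (simp add: mult_pCons_right)
    finally show ?thesis by (simp add: coeff_pCons)
  qed
  have "(\<lambda>m. - (\<epsilon> m * real n) * coeff (P m) i) \<longlonglongrightarrow> - (0 * real n) * (if i = n then 1 else 0)"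
    unfolding P_def by (intro tendsto_intros \<epsilon> Suc.IH)
  moreover have "(\<lambda>m. case i of 0 \<Rightarrow> 0 | Suc j \<Rightarrow> coeff (P m) j) \<longlonglongrightarrow> (if i = Suc n then 1 else 0)"
  proof (cases i)
    case (Suc j)
    then show ?thesis using Suc.IH[of j] by (simp add: P_def)
  qed simp
  ultimately have "(\<lambda>m. - (\<epsilon> m * real n) * coeff (P m) i + (case i of 0 \<Rightarrow> 0 | Suc j \<Rightarrow> coeff (P m) j))
     \<longlonglongrightarrow> - (0 * real n) * (if i = n then 1 else 0) + (if i = Suc n then 1 else 0)"
    by (rule tendsto_add)
  then show ?case unfolding eq by simp
qed

lemma poly_constant_on_open:
  fixes p :: "complex poly"
  assumes "(\<lambda>z. poly p z) constant_on S" "open S" "S \<noteq> {}"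
  shows "degree p = 0"
proof -
  from assms(1) obtain c where c: "\<And>z. z \<in> S \<Longrightarrow> poly p z = c" by (auto simp: constant_on_def)
  have "p - [:c:] = 0"
  proof (rule ccontr)
    assume "p - [:c:] \<noteq> 0"
    hence "finite {z. poly (p - [:c:]) z = 0}" by (rule poly_roots_finite)
    moreover have "S \<subseteq> {z. poly (p - [:c:]) z = 0}" using c by auto
    ultimately have "finite S" by (rule finite_subset[rotated])
    with assms(2,3) finite_imp_not_open show False by blast
  qed
  hence "p = [:c:]" by simp
  then show ?thesis by simp
qed

text \<open>The images of the polynomials with zeros j/(k + 1) tend to that of x^n, and Hurwitz'
  theorem is applied on the lower half-plane, a connected set free of real points. The limit is not
  constant, since its coefficient at degree n is b 0 \<noteq> 0 and n \<ge> 1.\<close>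

lemma appell_nonzero_lower_half_plane:
  fixes g :: "real \<Rightarrow> real" and z :: complex
  assumes tp: "tp_dets g" and gm: "g \<in> borel_measurable borel"
    and int: "\<And>k. integrable lborel (\<lambda>t. g t * t ^ k / fact k)"
    and m: "\<And>k. m k = (-1) ^ k * (LBINT t. g t * t ^ k / fact k)"
    and inv: "Abs_fps b * Abs_fps m = 1" and n: "n \<ge> 1" and z: "Im z < 0"
  shows "poly (appell (\<lambda>k. of_real (b k)) n) z \<noteq> 0"
proof -
  define S where "S = {z. Im z < 0}"
  define A where "A i z = poly (appell (\<lambda>k. complex_of_real (b k)) i) z" for i z
  define c where "c k i = coeff (\<Prod>j<n. [:- (1 / real (Suc k) * real j), 1:]) i" for k i
  have clim: "(\<lambda>k. complex_of_real (c k i * fact i)) \<longlonglongrightarrow> of_real ((if i = n then 1 else 0) * fact i)" for i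
    unfolding c_def by (intro tendsto_intros coeff_prod_linear_tendsto) real_asymp
  have S: "open S" "connected S" "S \<noteq> {}"
    using z by (auto simp: S_def open_halfspace_Im_lt intro!: convex_connected convex_halfspace_Im_lt)
  have "b 0 * m 0 = 1" using arg_cong[OF inv, of "\<lambda>F. fps_nth F 0"] by simp
  hence b0: "b 0 \<noteq> 0" by auto
  define G where "G z = (\<Sum>i\<le>n. complex_of_real ((if i = n then 1 else 0) * fact i) * A i z)" for z
  have G: "G z = fact n * A n z" for z
  proof -
    have "G z = (\<Sum>i\<le>n. if i = n then fact n * A n z else 0)" unfolding G_def by (intro sum.cong) auto
    then show ?thesis by simp
  qed
  have "G z \<noteq> 0"
  proof (rule Hurwitz_no_zeros[where S = S and g = G and ?z0.0 = z and \<F> = "\<lambda>k z. \<Sum>i\<le>n. of_real (c k i * fact i) * A i z"])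
    show "(\<lambda>z. \<Sum>i\<le>n. of_real (c k i * fact i) * A i z) holomorphic_on S" for k
      unfolding A_def by (intro holomorphic_intros)
    show "G holomorphic_on S" unfolding G_def A_def by (intro holomorphic_intros)
    show "uniform_limit K (\<lambda>k z. \<Sum>i\<le>n. of_real (c k i * fact i) * A i z) G sequentially" if "compact K" "K \<subseteq> S" for K
      unfolding G_def by (intro uniform_limit_sum_coeffs clim that) (auto simp: A_def intro!: continuous_intros)
    show "\<not> G constant_on S"
    proof
      assume "G constant_on S"
      moreover have "G = (\<lambda>z. poly (smult (fact n) (appell (\<lambda>k. complex_of_real (b k)) n)) z)"
        by (rule ext) (simp add: G A_def)
      ultimately have "degree (smult (fact n) (appell (\<lambda>k. complex_of_real (b k)) n)) = 0"
        using poly_constant_on_open[OF _ S(1,3)] by metis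
      hence "coeff (appell (\<lambda>k. complex_of_real (b k)) n) n = 0"
        using n by (intro coeff_eq_0) simp
      with b0 show False by (simp add: coeff_appell)
    qed
    show "(\<Sum>i\<le>n. of_real (c k i * fact i) * A i z) \<noteq> 0" if "z \<in> S" for k z
    proof
      assume 0: "(\<Sum>i\<le>n. of_real (c k i * fact i) * A i z) = 0"
      have "Im z = 0"
      proof (rule appell_op_real_rooted[OF tp gm int m inv, where \<epsilon> = "1 / real (Suc k)" and n = n and c = "c k"])
        show "poly (appell_op (\<lambda>k. of_real (b k)) n (\<lambda>i. of_real (c k i))) z = 0"
          using 0 by (simp add: appell_op_def poly_sum A_def)
      qed (auto simp: c_def fun_eq_iff)
      with that show False by (simp add: S_def)
    qed
    show "z \<in> S" using z by (simp add: S_def)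
  qed (use S in auto)
  then show ?thesis by (simp add: G A_def)
qed

text \<open>The falling factorial N (N - 1) ... (N - k + 1) divided by N^k. The product form shows
  that it tends to 1 as N grows and vanishes for k > N \<ge> 1.\<close>

definition jensen_weight :: "nat \<Rightarrow> nat \<Rightarrow> real" where
  "jensen_weight N k = (\<Prod>i<k. 1 - real i / real N)"

lemma jensen_weight_eq:
  assumes "k \<le> N" "N \<ge> 1"
  shows "jensen_weight N k = fact N / (fact (N - k) * real N ^ k)"
  using assms
proof (induction k)
  case (Suc k)
  have "fact (N - k) = real (N - k) * fact (N - Suc k)"
    using Suc.prems by (metis Suc_diff_Suc Suc_le_lessD fact_Suc of_nat_fact of_nat_mult)
  moreover have "1 - real k / real N = real (N - k) / real N" using Suc.prems by (simp add: of_nat_diff field_simps)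
  moreover have "real (N - k) > 0" using Suc.prems by simp
  ultimately show ?case using Suc by (simp add: jensen_weight_def)
qed (simp add: jensen_weight_def)

lemma jensen_weight_0: "k > N \<Longrightarrow> N \<ge> 1 \<Longrightarrow> jensen_weight N k = 0"
  unfolding jensen_weight_def by (rule prod_zero) (auto intro!: bexI[of _ N])

lemma jensen_weight_bounds:
  assumes "N \<ge> 1" shows "0 \<le> jensen_weight N k" "jensen_weight N k \<le> 1"
proof -
  have "0 \<le> jensen_weight N k \<and> jensen_weight N k \<le> 1"
  proof (cases "k \<le> N")
    case True
    have f: "0 \<le> 1 - real i / real N \<and> 1 - real i / real N \<le> 1" if "i \<in> {..<k}" for i
      using that True assms by (auto simp: field_simps)
    show ?thesis unfolding jensen_weight_def using f by (auto intro!: prod_nonneg prod_le_1)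
  qed (use jensen_weight_0 assms in auto)
  then show "0 \<le> jensen_weight N k" "jensen_weight N k \<le> 1" by auto
qed

text \<open>The Jensen polynomial of a power series is its N-th Appell polynomial reversed and
  rescaled, so that a zero z of the one corresponds to a zero N/z of the other.\<close>

lemma appell_jensen:
  fixes z :: complex
  assumes "z \<noteq> 0" "N \<ge> 1"
  shows "(\<Sum>k\<le>N. b k * of_real (jensen_weight N k) * z ^ k)
      = fact N * (z / of_nat N) ^ N * poly (appell b N) (of_nat N / z)"
proof -
  have "b k * of_real (jensen_weight N k) * z ^ k = fact N * (z / of_nat N) ^ N * (b k * ((of_nat N / z) ^ (N - k) / fact (N - k)))"
    if "k \<le> N" for k
  proof -
    have "(z / of_nat N) ^ N = (z / of_nat N) ^ k * (z / of_nat N) ^ (N - k)" using that by (simp flip: power_add)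
    moreover have "(z / of_nat N) ^ (N - k) * (of_nat N / z) ^ (N - k) = 1"
      using assms by (simp flip: power_mult_distrib)
    ultimately have "(z / of_nat N) ^ N * (of_nat N / z) ^ (N - k) = (z / of_nat N) ^ k" by (simp add: mult.assoc)
    moreover have "of_real (jensen_weight N k) = (fact N / (fact (N - k) * of_nat N ^ k) :: complex)"
      unfolding jensen_weight_eq[OF that assms(2)] by simp
    moreover define X Y where "X = (z / of_nat N) ^ N" and "Y = (of_nat N / z) ^ (N - k)"
    ultimately have XY: "X * Y = z ^ k / of_nat N ^ k"
      and W: "of_real (jensen_weight N k) = (fact N / (fact (N - k) * of_nat N ^ k) :: complex)"
      by (simp_all add: power_divide)
    have "fact N * X * (b k * (Y / fact (N - k))) = fact N * b k / fact (N - k) * (X * Y)" by simp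
    also have "\<dots> = b k * of_real (jensen_weight N k) * z ^ k" unfolding XY W by simp
    finally show ?thesis by (simp only: X_def Y_def)
  qed
  then show ?thesis by (simp add: poly_appell sum_distrib_left)
qed

text \<open>As w -> N/w exchanges the half-planes, the Jensen polynomials have no zeros in the upper
  one. They converge to \<Psi> on compact sets by Tannery's theorem with majorant |b k| R^k, and
  Hurwitz' theorem applies a second time.\<close>

theorem entire_nonzero_upper_half_plane:
  fixes g :: "real \<Rightarrow> real" and \<Psi> :: "complex \<Rightarrow> complex"
  assumes tp: "tp_dets g" and gm: "g \<in> borel_measurable borel"
    and int: "\<And>k. integrable lborel (\<lambda>t. g t * t ^ k / fact k)"
    and m: "\<And>k. m k = (-1) ^ k * (LBINT t. g t * t ^ k / fact k)"
    and inv: "Abs_fps b * Abs_fps m = 1"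
    and \<Psi>: "\<And>z. (\<lambda>k. of_real (b k) * z ^ k) sums \<Psi> z" and nonconst: "\<not> \<Psi> constant_on {z. Im z > 0}" and z: "Im z > 0"
  shows "\<Psi> z \<noteq> 0"
proof -
  define S where "S = {z. Im z > 0}"
  define J where "J N z = (\<Sum>k\<le>Suc N. of_real (b k) * of_real (jensen_weight (Suc N) k) * z ^ k)" for N and z :: complex
  have Jsums: "(\<lambda>k. of_real (b k) * of_real (jensen_weight (Suc N) k) * z ^ k) sums J N z" for N z
    unfolding J_def by (rule sums_finite) (auto simp: jensen_weight_0)
  show ?thesis
  proof (rule Hurwitz_no_zeros[where S = S and g = \<Psi> and ?z0.0 = z and \<F> = J])
    show "open S" "connected S"
      by (auto simp: S_def open_halfspace_Im_gt intro!: convex_connected convex_halfspace_Im_gt)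
    show "J N holomorphic_on S" for N unfolding J_def by (intro holomorphic_intros)
    show "\<Psi> holomorphic_on S" using holomorphic_on_UNIV_power_series[OF \<Psi>] by (rule holomorphic_on_subset) auto
    show "\<not> \<Psi> constant_on S" using nonconst by (simp add: S_def)
    show "z \<in> S" using z by (simp add: S_def)
    show "J N w \<noteq> 0" if "w \<in> S" for N w
    proof -
      have w: "Im w > 0" "w \<noteq> 0" using that by (auto simp: S_def)
      have "Im (of_nat (Suc N) / w) < 0"
        using w by (simp add: Im_divide divide_less_0_iff mult_less_0_iff add_nonneg_pos del: of_nat_Suc)
      from appell_nonzero_lower_half_plane[OF tp gm int m inv _ this, of "Suc N"]
      show ?thesis unfolding J_def using w appell_jensen[of w "Suc N" "\<lambda>k. of_real (b k)"] by (simp del: of_nat_Suc sum.atMost_Suc)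
    qed
    show "uniform_limit K J \<Psi> sequentially" if K: "compact K" "K \<subseteq> S" for K
    proof (rule uniform_limitI)
      fix e :: real assume e: "e > 0"
      obtain R where R: "R > 0" "\<And>z. z \<in> K \<Longrightarrow> norm z \<le> R"
        using compact_imp_bounded[OF K(1)] unfolding bounded_pos by blast
      define M where "M k = \<bar>b k\<bar> * R ^ k" for k
      have sM: "summable M"
      proof -
        have "summable (\<lambda>k. of_real (b k) * (of_real (R + 1) :: complex) ^ k)" using \<Psi> by (rule sums_summable)
        hence "summable (\<lambda>k. norm (of_real (b k) * (of_real R :: complex) ^ k))"
          by (rule powser_insidea) (use R in auto)
        then show ?thesis using R by (simp add: M_def[abs_def] norm_mult norm_power)
      qed
      define D where "D N k = M k * (1 - jensen_weight (Suc N) k)" for N k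
      have D: "0 \<le> D N k" "D N k \<le> M k" for N k
      proof -
        have "M k \<ge> 0" using R by (simp add: M_def)
        then show "0 \<le> D N k" "D N k \<le> M k"
          using jensen_weight_bounds[of "Suc N" k] by (auto simp: D_def intro: mult_left_le)
      qed
      have sD: "summable (D N)" for N
        by (rule summable_comparison_test'[OF sM, of 0]) (use D in auto)
      have "(\<lambda>N. \<Sum>k. D N k) \<longlonglongrightarrow> (\<Sum>k. 0)"
      proof -
        have "((\<lambda>N. D N k) \<longlongrightarrow> 0) sequentially" for k
        proof -
          have "(\<lambda>N. jensen_weight (Suc N) k) \<longlonglongrightarrow> (\<Prod>i<k. 1)"
            unfolding jensen_weight_def by (intro tendsto_prod) real_asymp
          hence "(\<lambda>N. M k * (1 - jensen_weight (Suc N) k)) \<longlonglongrightarrow> M k * (1 - (\<Prod>i<k. 1))"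
            by (intro tendsto_intros)
          then show ?thesis by (simp add: D_def)
        qed
        moreover have "eventually (\<lambda>(k, N). norm (D N k) \<le> M k) (at_top \<times>\<^sub>F sequentially)"
          using D by (intro always_eventually) (auto simp: abs_of_nonneg)
        ultimately show ?thesis using tannerys_theorem[of "\<lambda>k N. D N k" "\<lambda>_. 0" sequentially M] sM by simp
      qed
      hence "\<forall>\<^sub>F N in sequentially. (\<Sum>k. D N k) < e" using e by (intro order_tendstoD(2)) auto
      then show "\<forall>\<^sub>F N in sequentially. \<forall>w\<in>K. dist (J N w) (\<Psi> w) < e"
      proof eventually_elim
        case (elim N)
        show ?case
        proof
          fix w assume w: "w \<in> K"
          have s: "(\<lambda>k. of_real (b k) * of_real (jensen_weight (Suc N) k) * w ^ k - of_real (b k) * w ^ k) sums (J N w - \<Psi> w)"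
            by (intro sums_diff Jsums \<Psi>)
          have "norm (J N w - \<Psi> w) \<le> (\<Sum>k. D N k)"
          proof (rule norm_sums_le[OF s summable_sums[OF sD]])
            fix k
            have "norm (of_real (b k) * of_real (jensen_weight (Suc N) k) * w ^ k - of_real (b k) * w ^ k)
              = norm (of_real (b k * (jensen_weight (Suc N) k - 1)) * w ^ k)"
              by (simp add: algebra_simps)
            also have "\<dots> = \<bar>b k\<bar> * norm w ^ k * (1 - jensen_weight (Suc N) k)"
              using jensen_weight_bounds[of "Suc N" k] unfolding norm_mult norm_power norm_of_real by (simp add: abs_mult)
            also have "\<dots> \<le> D N k"
              unfolding D_def M_def using jensen_weight_bounds[of "Suc N" k] R(2)[OF w]
              by (intro mult_right_mono mult_left_mono power_mono) auto
            finally show "norm (of_real (b k) * of_real (jensen_weight (Suc N) k) * w ^ k - of_real (b k) * w ^ k) \<le> D N k" .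
          qed
          with elim show "dist (J N w) (\<Psi> w) < e" by (simp add: dist_norm)
        qed
      qed
    qed
  qed
qed

lemma xi_centered_even: "xi_centered (- z) = xi_centered z"
  using sums_unique2[OF xi_centered_sums[of z]] xi_centered_sums[of "- z"] by simp

theorem polya_frequency_imp_riemann_hypothesis:
  assumes real: "\<And>x. xi_Lambda x \<in> \<real>" and pf: "polya_frequency_function (\<lambda>x. Re (xi_Lambda x))"
    and z: "xi_centered z = 0"
  shows "Re z = 0"
proof -
  obtain c where c: "c > 0" "\<And>\<tau>. Re (xi_centered (of_real \<tau>)) \<ge> c * (1 + \<tau>\<^sup>2)"
    using xi_centered_of_real_ge by metis
  define f where "f \<tau> = 1 / xi_real \<tau>" for \<tau>
  have fint: "integrable lborel f" unfolding f_def by (rule integrable_inverse_xi_real)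
  have fpos: "f \<tau> > 0" for \<tau> by (simp add: f_def xi_real_pos)
  have feven: "f (- \<tau>) = f \<tau>" for \<tau>
  proof -
    have "xi_real (- \<tau>) = xi_real \<tau>" using xi_centered_even[of "of_real \<tau>"] by (simp add: xi_real_def)
    then show ?thesis by (simp add: f_def)
  qed
  have fcont: "continuous_on UNIV f"
    unfolding f_def using xi_real_pos by (intro continuous_intros continuous_xi_real) (auto simp: less_imp_neq[symmetric])
  define g where "g x = Re (xi_Lambda x)" for x
  have g: "complex_of_real (g x) = inv_fourier f x" for x
    using real[of x] unfolding g_def f_def xi_Lambda_eq by (simp add: of_real_Re)
  have tp: "tp_dets g" using pf by (auto simp: polya_frequency_function_def totally_positive_def tp_dets_def g_def)
  \<comment> \<open>The hypothesis speaks of \<open>lebesgue\<close>; continuity of an inverse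
    transform makes g Borel measurable, so that integrals over \<open>lborel\<close> are
    available.\<close>
  have gcont: "continuous_on UNIV g"
  proof -
    have "continuous_on UNIV (\<lambda>x. Re (inv_fourier f x))" by (intro continuous_on_Re continuous_inv_fourier fint)
    then show ?thesis unfolding g[symmetric] by simp
  qed
  hence gm [measurable]: "g \<in> borel_measurable borel" by (rule borel_measurable_continuous_onI)
  have gint: "integrable lborel g"
    using pf unfolding polya_frequency_function_def g_def[symmetric] by (simp add: integrable_completion)
  have ffou: "(LBINT x. of_real (f x) * exp (\<i> * of_real t * of_real x)) = 2 * of_real pi * of_real (g t)" for t
  proof -
    have "(LBINT x. of_real (f x) * exp (\<i> * of_real t * of_real x))
       = \<bar>-1\<bar> *\<^sub>R (LBINT x. of_real (f (0 + -1 * x)) * exp (\<i> * of_real t * of_real (0 + -1 * x)))"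
      by (rule lborel_integral_real_affine) simp
    also have "\<dots> = (LBINT x. of_real (f x) * exp (- \<i> * of_real t * of_real x))" by (simp add: feven)
    also have "\<dots> = 2 * of_real pi * inv_fourier f t" by (simp add: inv_fourier_def)
    finally show ?thesis by (simp add: g)
  qed
  have geven: "g (- x) = g x" for x
  proof -
    have "2 * of_real pi * complex_of_real (g (- x)) = (LBINT y. of_real (f y) * exp (- \<i> * of_real x * of_real y))"
      unfolding ffou[symmetric] by simp
    also have "\<dots> = 2 * of_real pi * inv_fourier f x" by (simp add: inv_fourier_def)
    finally have "complex_of_real (g (- x)) = of_real (g x)" by (simp add: g)
    then show ?thesis by (simp only: of_real_eq_iff)
  qed
  have g0: "g 0 > 0"
  proof -
    have "complex_of_real (2 * pi * g 0) = (LBINT x. of_real (f x))" using ffou[of 0] by simp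
    hence "2 * pi * g 0 = (LBINT x. f x)" by (simp only: integral_complex_of_real of_real_eq_iff)
    moreover have "(LBINT x. f x) > 0" by (rule integral_pos_lborel[OF fint fpos])
    ultimately have "0 < (2 * pi) * g 0" by (simp only:)
    then show ?thesis using pi_gt_zero by (simp only: zero_less_mult_iff) linarith
  qed
  have gB: "g x \<le> (LBINT y. f y)" for x
  proof -
    have "2 * pi * g x \<le> norm (2 * of_real pi * complex_of_real (g x))" by (simp add: norm_mult)
    also have "\<dots> \<le> (LBINT y. f y)"
      unfolding ffou[symmetric]
    proof (rule norm_integral_le)
      show "complex_integrable lborel (\<lambda>y. of_real (f y) * exp (\<i> * of_real x * of_real y))"
        by (rule integrable_mult_bounded[OF integrable_of_real[OF fint], where B = 1]) auto
      show "norm (of_real (f y) * exp (\<i> * of_real x * of_real y)) \<le> f y" for y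
        using fpos[of y] by (simp add: norm_mult)
    qed (rule fint)
    finally have "2 * pi * g x \<le> (LBINT y. f y)" .
    moreover have "1 * g x \<le> 2 * pi * g x" using tp_dets_nonneg[OF tp, of x] pi_gt3 by (intro mult_right_mono) auto
    ultimately show ?thesis by simp
  qed
  obtain r where r: "r > 0" "integrable lborel (\<lambda>u. g u * exp (r * \<bar>u\<bar>))"
    by (rule tp_dets_exponential_decay[OF tp gint geven g0 gB])
  have mom: "integrable lborel (\<lambda>t. g t * t ^ k / fact k)" for k
    by (rule laplace_power_series(1)[OF gm r(2) _ r(1), of 0]) (use r in simp)
  define m where "m k = (-1) ^ k * (LBINT t. g t * t ^ k / fact k)" for k
  define L where "L w = (LBINT u. of_real (g u) * exp (- w * of_real u))" for w :: complex
  have L: "(\<lambda>k. of_real (m k) * w ^ k) sums L w" if "norm w \<le> r" for w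
  proof -
    have "(\<lambda>k. of_real (LBINT u. g u * u ^ k / fact k) * (- w) ^ k) sums L w"
      unfolding L_def by (rule laplace_power_series(3)[OF gm r(2) _ r(1)]) (use that in simp)
    moreover have "of_real (LBINT u. g u * u ^ k / fact k) * (- w) ^ k = of_real (m k) * w ^ k" for k
      by (subst power_minus) (simp add: m_def)
    ultimately show ?thesis by simp
  qed
  \<comment> \<open>Inversion in the other direction: integrability of g recovers f from g, so on
    the imaginary axis the two-sided Laplace transform of g is the reciprocal of \<Xi> on the real
    axis.\<close>
  have Limag: "L (\<i> * of_real \<tau>) = of_real (f \<tau>)" for \<tau>
  proof -
    have "complex_of_real (f \<tau>) = 1 / (2 * of_real pi) * (LBINT t. (2 * of_real pi * of_real (g t)) * exp (- \<i> * of_real \<tau> * of_real t))"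
    proof (rule fourier_inversion[OF fcont fint])
      show "\<bar>f x\<bar> \<le> 1 / c" for x
      proof -
        have "c * 1 \<le> c * (1 + x\<^sup>2)" using c(1) by (intro mult_left_mono) auto
        hence "c \<le> xi_real x" using c(2)[of x] by (simp add: xi_real_def)
        then show ?thesis using c(1) by (simp add: f_def frac_le)
      qed
      show "2 * of_real pi * complex_of_real (g t) = (LBINT x. of_real (f x) * exp (\<i> * of_real t * of_real x))" for t
        by (rule ffou[symmetric])
      show "complex_integrable lborel (\<lambda>t. 2 * of_real pi * complex_of_real (g t))"
        by (intro integrable_mult_right integrable_of_real gint)
    qed
    also have "(LBINT t. (2 * of_real pi * of_real (g t)) * exp (- \<i> * of_real \<tau> * of_real t)) = 2 * of_real pi * L (\<i> * of_real \<tau>)"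
      unfolding L_def mult.assoc integral_mult_right_zero by (simp add: mult.assoc)
    finally show ?thesis by simp
  qed
  \<comment> \<open>Coefficients of \<Psi>(w) = \<Xi>(i w): even powers only, with alternating signs
    from (i w)^2 = -w^2.\<close>
  define b where "b k = (if even k then (-1) ^ (k div 2) * xi_coeff (k div 2) else 0)" for k
  define \<Psi> where "\<Psi> w = xi_centered (\<i> * w)" for w
  have \<Psi>: "(\<lambda>k. of_real (b k) * w ^ k) sums \<Psi> w" for w
  proof -
    have "(\<lambda>k. of_real (xi_coeff k) * ((\<i> * w)\<^sup>2) ^ k) sums \<Psi> w" unfolding \<Psi>_def by (rule xi_centered_sums)
    moreover have "of_real (xi_coeff k) * ((\<i> * w)\<^sup>2) ^ k = of_real (b (2 * k)) * w ^ (2 * k)" for k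
    proof -
      have "((\<i> * w)\<^sup>2) ^ k = (- 1) ^ k * w ^ (2 * k)"
        by (subst power_mult) (simp add: power_mult_distrib flip: power_minus)
      then show ?thesis by (simp add: b_def)
    qed
    ultimately have "(\<lambda>k. of_real (b (2 * k)) * w ^ (2 * k)) sums \<Psi> w" by simp
    then show ?thesis
    proof (subst (asm) sums_mono_reindex[where g = "\<lambda>k. 2 * k"])
      fix n assume "n \<notin> range (\<lambda>k::nat. 2 * k)"
      hence "odd n" by (auto elim!: evenE)
      then show "complex_of_real (b n) * w ^ n = 0" by (simp add: b_def)
    qed (auto simp: strict_mono_def)
  qed
  \<comment> \<open>Coefficients of the Cauchy product of the two series minus 1; they vanish
    exactly when the formal series are inverse to each other.\<close>
  define a where "a n = complex_of_real (\<Sum>i\<le>n. b i * m (n - i)) - (if n = 0 then 1 else 0)" for n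
  have prod: "(\<lambda>n. a n * (w - 0) ^ n) sums (\<Psi> w * L w - 1)" if w: "norm (w - 0) < r" for w
  proof -
    have "summable (\<lambda>k. of_real (b k) * (of_real r :: complex) ^ k)" using \<Psi> by (rule sums_summable)
    hence s1: "summable (\<lambda>k. norm (of_real (b k) * w ^ k))" by (rule powser_insidea) (use w r in simp)
    have "summable (\<lambda>k. of_real (m k) * (of_real r :: complex) ^ k)" using L[of "of_real r"] r by (auto intro: sums_summable)
    hence s2: "summable (\<lambda>k. norm (of_real (m k) * w ^ k))" by (rule powser_insidea) (use w r in simp)
    have "(\<lambda>n. \<Sum>i\<le>n. (of_real (b i) * w ^ i) * (of_real (m (n - i)) * w ^ (n - i))) sums (\<Psi> w * L w)"
      using Cauchy_product_sums[OF s1 s2] \<Psi>[of w] L[of w] w by (simp add: sums_iff)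
    moreover have "(\<Sum>i\<le>n. (of_real (b i) * w ^ i) * (of_real (m (n - i)) * w ^ (n - i)))
       = complex_of_real (\<Sum>i\<le>n. b i * m (n - i)) * w ^ n" for n
    proof -
      have T: "(of_real (b i) * w ^ i) * (of_real (m (n - i)) * w ^ (n - i)) = complex_of_real (b i * m (n - i)) * w ^ n" if "i \<le> n" for i
      proof -
        have "w ^ n = w ^ i * w ^ (n - i)" using that by (simp flip: power_add)
        then show ?thesis by simp
      qed
      show ?thesis unfolding of_real_sum sum_distrib_right by (intro sum.cong refl T) simp
    qed
    ultimately have "(\<lambda>n. complex_of_real (\<Sum>i\<le>n. b i * m (n - i)) * w ^ n) sums (\<Psi> w * L w)" by (simp only:)
    from sums_diff[OF this sums_single[of 0 "\<lambda>n. w ^ n"]]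
    have "(\<lambda>n. complex_of_real (\<Sum>i\<le>n. b i * m (n - i)) * w ^ n - (if n = 0 then w ^ n else 0)) sums (\<Psi> w * L w - w ^ 0)" .
    moreover have "complex_of_real (\<Sum>i\<le>n. b i * m (n - i)) * w ^ n - (if n = 0 then w ^ n else 0) = a n * (w - 0) ^ n" for n
      by (simp add: a_def left_diff_distrib)
    ultimately show ?thesis by simp
  qed
  have imag: "\<Psi> (\<i> * of_real \<tau>) * L (\<i> * of_real \<tau>) - 1 = 0" for \<tau>
  proof -
    have "\<Psi> (\<i> * of_real \<tau>) = of_real (xi_real \<tau>)"
      using xi_centered_even[of "of_real \<tau>"] by (simp add: \<Psi>_def xi_centered_of_real_eq flip: mult.assoc)
    then show ?thesis using xi_real_pos[of \<tau>] by (simp add: Limag f_def)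
  qed
  \<comment> \<open>A power series with zero constant term and some nonzero coefficient has an
    isolated zero at 0, whereas this function vanishes on the imaginary axis. The constant
    coefficient is read off at 0.\<close>
  have a0: "a n = 0" for n
  proof (cases "n = 0")
    case True
    have "(\<lambda>n. a n * 0 ^ n) sums (\<Psi> 0 * L 0 - 1)" using prod[of 0] r by simp
    moreover have "(\<lambda>n. a n * 0 ^ n) sums a 0" by (rule powser_sums_zero)
    moreover have "\<Psi> 0 * L 0 - 1 = 0" using imag[of 0] by simp
    ultimately show ?thesis using True sums_unique2 by metis
  next
    case False
    show ?thesis
    proof (rule ccontr)
      assume "a n \<noteq> 0"
      moreover have "\<Psi> 0 * L 0 - 1 = 0" using imag[of 0] by simp
      ultimately obtain s where s: "0 < s" "\<And>z. z \<in> cball 0 s - {0} \<Longrightarrow> \<Psi> z * L z - 1 \<noteq> 0"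
        using powser_0_nonzero[OF r(1) prod, of n] False by blast
      have "\<i> * of_real s \<in> cball 0 s - {0}" using s(1) by (simp add: norm_mult)
      from s(2)[OF this] imag[of s] show False by simp
    qed
  qed
  have inv: "Abs_fps b * Abs_fps m = 1"
  proof (rule fps_ext)
    fix n
    have "complex_of_real (\<Sum>i\<le>n. b i * m (n - i)) = of_real (if n = 0 then 1 else 0)" using a0[of n] by (simp add: a_def split: if_splits)
    hence "(\<Sum>i\<le>n. b i * m (n - i)) = (if n = 0 then 1 else 0)" by (simp only: of_real_eq_iff)
    then show "fps_nth (Abs_fps b * Abs_fps m) n = fps_nth 1 n" by (simp add: fps_mult_nth atLeast0AtMost)
  qed
  have nonconst: "\<not> \<Psi> constant_on {z. Im z > 0}"
  proof
    assume "\<Psi> constant_on {z. Im z > 0}"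
    then obtain C where C: "\<And>z. Im z > 0 \<Longrightarrow> \<Psi> z = C" by (auto simp: constant_on_def)
    have le: "c * (1 + \<tau>\<^sup>2) \<le> Re C" if "\<tau> > 0" for \<tau>
    proof -
      have "\<Psi> (\<i> * of_real \<tau>) = xi_centered (of_real \<tau>)"
        using xi_centered_even[of "of_real \<tau>"] by (simp add: \<Psi>_def flip: mult.assoc)
      with C[of "\<i> * of_real \<tau>"] c(2)[of \<tau>] that show ?thesis by simp
    qed
    have "Re C > 0" using le[of 1] c(1) by simp
    with le[of "sqrt (Re C / c)"] c(1) show False by (simp add: algebra_simps)
  qed
  note upper = entire_nonzero_upper_half_plane[OF tp gm mom m_def inv \<Psi> nonconst]
  \<comment> \<open>By evenness z yields two zeros of \<Psi>, with imaginary parts -Re z and Re z;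
    neither may be positive.\<close>
  have \<Psi>z: "\<Psi> (- \<i> * z) = 0" "\<Psi> (\<i> * z) = 0"
    using z xi_centered_even[of z] by (simp_all add: \<Psi>_def flip: mult.assoc)
  have "\<not> Im (- \<i> * z) > 0" "\<not> Im (\<i> * z) > 0" using upper \<Psi>z by blast+
  then show "Re z = 0" by simp
qed

theorem theorem4:
  "riemann_hypothesis \<longleftrightarrow>
     (\<forall>x. xi_Lambda x \<in> \<real>) \<and> polya_frequency_function (\<lambda>x. Re (xi_Lambda x))"
  unfolding riemann_hypothesis_iff_xi
  using riemann_hypothesis_imp_polya_frequency polya_frequency_imp_riemann_hypothesis by metis

end
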